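(* Let $p,q\ge 1$ be integers, let $A_1,\dots,A_p>0$, $B_1,\dots,B_q>0$, $a_1,\dots,a_p>0$, $b_1,\dots,b_q>0$. Suppose that $$\mu:=\sum_{j=1}^{q}b_j-\sum_{i=1}^{p}a_i+\frac{p-q}{2}>0,\qquad \sum_{j=1}^{q}B_j=\sum_{i=1}^{p}A_i,\qquad \rho:=\prod_{i=1}^{p}A_i^{A_i}\prod_{j=1}^{q}B_j^{-B_j}\le 1,$$ and $$P(u)=\sum_{i=1}^{p}\frac{e^{-a_iu/A_i}}{1-e^{-u/A_i}}-\sum_{j=1}^{q}\frac{e^{-b_ju/B_j}}{1-e^{-u/B_j}}\ge 0\quad\text{for all }u>0.$$ Then the function $$t\mapsto\frac{\prod_{j=1}^{q}\Gamma(b_j)}{\prod_{i=1}^{p}\Gamma(a_i)}\,H^{p,0}_{q,p}\left(e^{-t}\left|\begin{array}{l}(\mathbf B,\mathbf b)\\(\mathbf A,\mathbf a)\end{array}\right.\right)$$ is the density of an infinitely divisible probability distribution on $(0,\infty)$. In particular, the condition $P(u)\ge 0$ for all $u>0$ may be replaced by any one of the following conditions: (a) $\max_{1\le i\le p}(a_i/A_i)\le \min_{1\le j\le q}(b_j-1)/B_j$; (b) $p=q$, $A_i\ge B_i$ for $i=1,\dots,p-1$, $\max_{1\le k\le p-1}b_k/B_k\le (b_p-1)/B_p$ and $a_i/A_i\le (b_i-1)/B_i$ for $i=1,\dots,p$; (c) $p=q$, $0\le a_1/A_1\le\cdots\le a_p/A_p$, $0\le b_1/B_1\le\cdots\le b_p/B_p$,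 $0<1/A_1\le\cdots\le 1/A_p$, $0<1/B_1\le\cdots\le 1/B_p$, and $\sum_{i=1}^{k}a_i/A_i\le\sum_{i=1}^{k}b_i/B_i$, $\sum_{i=1}^{k}1/A_i\le\sum_{i=1}^{k}1/B_i$ for each $k=1,\dots,p$.
   Context: Fox's $H$-function: with $\gamma=-\min_{1\le k\le p}(a_k/A_k)$ and any $c>\gamma$, for $z>0$, $$H^{p,0}_{q,p}\left(z\left|\begin{array}{l}(\mathbf B,\mathbf b)\\(\mathbf A,\mathbf a)\end{array}\right.\right)=\lim_{R\to\infty}\frac{1}{2\pi i}\int_{c-iR}^{c+iR}\frac{\prod_{k=1}^{p}\Gamma(A_ks+a_k)}{\prod_{j=1}^{q}\Gamma(B_js+b_j)}z^{-s}\,ds,$$ which exists for all $z>0$ except possibly $z=\rho$ when $\mu>0$ and $\sum_iA_i=\sum_jB_j$. Thus the density is defined for all $t>0$ except possibly the single point $t=\log(1/\rho)$, where its value is immaterial. A probability distribution $\pi$ on $[0,\infty)$ is infinitely divisible if for every integer $n\ge 1$ there is a probability distribution $\pi_n$ on $[0,\infty)$ whose $n$-fold convolution is $\pi$. In (b), when $p=1$ the condition with a maximum over the empty set is vacuous. *)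

theory Defs
  imports "HOL-Probability.Probability" "HOL-Complex_Analysis.Complex_Analysis"
begin

definition fox_gamma :: "nat \<Rightarrow> (nat \<Rightarrow> real) \<Rightarrow> (nat \<Rightarrow> real) \<Rightarrow> real" where
  "fox_gamma p A a = - Min ((\<lambda>k. a k / A k) ` {1..p})"

(* At a pole of some Gamma (B j * s + b j) the library value Gamma = 0 and x / 0 = 0 give
   the correct value 0 of the integrand. *)
definition fox_integrand ::
  "nat \<Rightarrow> nat \<Rightarrow> (nat \<Rightarrow> real) \<Rightarrow> (nat \<Rightarrow> real) \<Rightarrow> (nat \<Rightarrow> real) \<Rightarrow> (nat \<Rightarrow> real) \<Rightarrow> real \<Rightarrow> complex \<Rightarrow> complex"
where
  "fox_integrand p q A a B b z s =
     (\<Prod>k=1..p. Gamma (of_real (A k) * s + of_real (a k))) /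
     (\<Prod>j=1..q. Gamma (of_real (B j) * s + of_real (b j))) * of_real z powr (- s)"

(* The defining limit exists with value L for every admissible abscissa c. *)
definition has_fox_H ::
  "nat \<Rightarrow> nat \<Rightarrow> (nat \<Rightarrow> real) \<Rightarrow> (nat \<Rightarrow> real) \<Rightarrow> (nat \<Rightarrow> real) \<Rightarrow> (nat \<Rightarrow> real) \<Rightarrow> real \<Rightarrow> complex \<Rightarrow> bool"
where
  "has_fox_H p q A a B b z L \<longleftrightarrow>
     (\<forall>c > fox_gamma p A a.
        ((\<lambda>R. 1 / (2 * of_real pi * \<i>) *
              contour_integral (linepath (Complex c (- R)) (Complex c R)) (fox_integrand p q A a B b z))
          \<longlongrightarrow> L) at_top)"

definition fox_H ::
  "nat \<Rightarrow> nat \<Rightarrow> (nat \<Rightarrow> real) \<Rightarrow> (nat \<Rightarrow> real) \<Rightarrow> (nat \<Rightarrow> real) \<Rightarrow> (nat \<Rightarrow> real) \<Rightarrow> real \<Rightarrow> complex"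
where
  "fox_H p q A a B b z = (THE L. has_fox_H p q A a B b z L)"

definition fox_mu :: "nat \<Rightarrow> nat \<Rightarrow> (nat \<Rightarrow> real) \<Rightarrow> (nat \<Rightarrow> real) \<Rightarrow> real" where
  "fox_mu p q a b = (\<Sum>j=1..q. b j) - (\<Sum>i=1..p. a i) + (real p - real q) / 2"

definition fox_rho :: "nat \<Rightarrow> nat \<Rightarrow> (nat \<Rightarrow> real) \<Rightarrow> (nat \<Rightarrow> real) \<Rightarrow> real" where
  "fox_rho p q A B = (\<Prod>i=1..p. A i powr A i) * (\<Prod>j=1..q. B j powr (- B j))"

definition fox_P ::
  "nat \<Rightarrow> nat \<Rightarrow> (nat \<Rightarrow> real) \<Rightarrow> (nat \<Rightarrow> real) \<Rightarrow> (nat \<Rightarrow> real) \<Rightarrow> (nat \<Rightarrow> real) \<Rightarrow> real \<Rightarrow> real"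
where
  "fox_P p q A a B b u =
     (\<Sum>i=1..p. exp (- a i * u / A i) / (1 - exp (- u / A i))) -
     (\<Sum>j=1..q. exp (- b j * u / B j) / (1 - exp (- u / B j)))"

definition cond_a ::
  "nat \<Rightarrow> nat \<Rightarrow> (nat \<Rightarrow> real) \<Rightarrow> (nat \<Rightarrow> real) \<Rightarrow> (nat \<Rightarrow> real) \<Rightarrow> (nat \<Rightarrow> real) \<Rightarrow> bool"
where
  "cond_a p q A a B b \<longleftrightarrow>
     Max ((\<lambda>i. a i / A i) ` {1..p}) \<le> Min ((\<lambda>j. (b j - 1) / B j) ` {1..q})"

definition cond_b ::
  "nat \<Rightarrow> nat \<Rightarrow> (nat \<Rightarrow> real) \<Rightarrow> (nat \<Rightarrow> real) \<Rightarrow> (nat \<Rightarrow> real) \<Rightarrow> (nat \<Rightarrow> real) \<Rightarrow> bool"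
where
  "cond_b p q A a B b \<longleftrightarrow>
     p = q \<and>
     (\<forall>i\<in>{1..p-1}. B i \<le> A i) \<and>
     (p > 1 \<longrightarrow> Max ((\<lambda>k. b k / B k) ` {1..p-1}) \<le> (b p - 1) / B p) \<and>
     (\<forall>i\<in>{1..p}. a i / A i \<le> (b i - 1) / B i)"

definition cond_c ::
  "nat \<Rightarrow> nat \<Rightarrow> (nat \<Rightarrow> real) \<Rightarrow> (nat \<Rightarrow> real) \<Rightarrow> (nat \<Rightarrow> real) \<Rightarrow> (nat \<Rightarrow> real) \<Rightarrow> bool"
where
  "cond_c p q A a B b \<longleftrightarrow>
     p = q \<and>
     0 \<le> a 1 / A 1 \<and> mono_on {1..p} (\<lambda>i. a i / A i) \<and>
     0 \<le> b 1 / B 1 \<and> mono_on {1..p} (\<lambda>i. b i / B i) \<and>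
     0 < 1 / A 1 \<and> mono_on {1..p} (\<lambda>i. 1 / A i) \<and>
     0 < 1 / B 1 \<and> mono_on {1..p} (\<lambda>i. 1 / B i) \<and>
     (\<forall>k\<in>{1..p}. (\<Sum>i=1..k. a i / A i) \<le> (\<Sum>i=1..k. b i / B i)) \<and>
     (\<forall>k\<in>{1..p}. (\<Sum>i=1..k. 1 / A i) \<le> (\<Sum>i=1..k. 1 / B i))"

definition nonneg_distribution :: "real measure \<Rightarrow> bool" where
  "nonneg_distribution M \<longleftrightarrow> real_distribution M \<and> emeasure M {..<0} = 0"

primrec convolution_power :: "real measure \<Rightarrow> nat \<Rightarrow> real measure" where
  "convolution_power M 0 = return borel 0"
| "convolution_power M (Suc n) = convolution M (convolution_power M n)"

definition infinitely_divisible :: "real measure \<Rightarrow> bool" where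
  "infinitely_divisible M \<longleftrightarrow>
     nonneg_distribution M \<and>
     (\<forall>n\<ge>1. \<exists>N. nonneg_distribution N \<and> convolution_power N n = M)"

definition fox_density ::
  "nat \<Rightarrow> nat \<Rightarrow> (nat \<Rightarrow> real) \<Rightarrow> (nat \<Rightarrow> real) \<Rightarrow> (nat \<Rightarrow> real) \<Rightarrow> (nat \<Rightarrow> real) \<Rightarrow> real \<Rightarrow> real"
where
  "fox_density p q A a B b t =
     (\<Prod>j=1..q. Gamma (b j)) / (\<Prod>i=1..p. Gamma (a i)) * Re (fox_H p q A a B b (exp (- t)))"

end

theory Submission
  imports Defs "HOL-Real_Asymp.Real_Asymp"
begin

text \<open>
  Write \<open>F(s)\<close> for the quotient of gamma products under the integral, \<open>\<Lambda> = F'/F\<close>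
  and \<open>T = ln (1/\<rho>)\<close>. The theorem holds because \<open>F(s)/F(0)\<close> is the Laplace transform of an
  infinitely divisible law on \<open>[0,\<infinity>)\<close>, and the limit that defines the H-function at \<open>exp (-t)\<close>
  is the inversion of this transform at \<open>t\<close>.

  The law. \<open>\<Lambda>\<close> is a signed sum of digamma functions, and the difference of two digamma values is
  a Laplace integral whose kernel is the sum of a geometric series (\<open>Digamma_diff_integral\<close>).
  Summing over the parameters gives
  \<open>\<Lambda>(s) - \<Lambda>(s') = \<integral> (e^(-s'u) - e^(-su)) P(u) du\<close>. Since \<open>\<Lambda>(s') \<longlonglongrightarrow> -T\<close> as \<open>s' \<longlonglongrightarrow> \<infinity>\<close>,
  \<open>P \<ge> 0\<close> is integrable and \<open>\<Lambda>(s) = -T - \<integral> e^(-su) P(u) du\<close>, that is,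
  \<open>F(s)/F(0) = exp (-T s - \<integral> (1 - e^(-su)) P(u)/u du)\<close>. For \<open>T \<ge> 0\<close>, which is the condition
  \<open>\<rho> \<le> 1\<close>, this is the Levy-Khintchine form of a law with drift \<open>T\<close> and Levy density \<open>P(u)/u\<close>
  (\<open>exists_infinitely_divisible\<close>); its convolution roots belong to \<open>T/n\<close> and \<open>P/n\<close>.

  The density. The expansion of the digamma function gives \<open>\<Lambda>(s) = -T - \<mu>/s + O(1/(Im s)^2)\<close> on
  vertical strips, so \<open>F\<close> decays like \<open>|Im s|^(-\<mu>)\<close> and \<open>F' + T F\<close> one power faster
  (\<open>F_decay\<close>). If \<open>\<mu> \<le> 1\<close>, the integral of \<open>F\<close> along a vertical line need not converge
  absolutely. However, \<open>F(s) e^(ts) = (F(s) e^(Ts)) e^((t-T)s)\<close>, and integration by parts moves a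
  derivative onto \<open>F(s) e^(Ts)\<close> at the price of a factor \<open>1/(t-T)\<close>. This is why \<open>t = T\<close> is
  exceptional; for \<open>t \<noteq> T\<close> the limit exists, depends continuously on \<open>t\<close>, and the truncated
  integrals are locally bounded. By Levy's inversion formula the limit, divided by \<open>F(0)\<close>, integrates
  to the probability of every interval that avoids \<open>T\<close>. Continuity makes it real and nonnegative;
  the decay of the characteristic function excludes atoms, and the fundamental theorem of calculus with
  one exceptional point turns the limit into the density (\<open>density_of_inversion\<close>). The integrals
  over horizontal segments tend to zero, so every abscissa \<open>c > \<gamma>\<close> gives the same limit.

  The conditions (a), (b), (c) each imply \<open>P \<ge> 0\<close>: the first two by
  \<open>1/(e^x - 1) \<le> 1/x \<le> 1/(1 - e^(-x))\<close>, the third because \<open>P\<close> is a series of differences of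
  exponential sums, each nonnegative by weak majorization.
\<close>

section \<open>Asymptotics of the digamma function on vertical strips\<close>

text \<open>
  The increment of the logarithm is the integral of \<open>1/(z+x)\<close> over the unit interval, and the
  fraction on the left is its trapezoidal approximation. The decay of the third order in \<open>r\<close> makes
  the errors summable along \<open>z, z + 1, z + 2, \<dots>\<close>, with a sum of the second order.
\<close>

lemma Ln_trapezoid_error:
  fixes z :: complex
  assumes slit: "\<And>x. x \<in> {0..1} \<Longrightarrow> z + of_real x \<notin> \<real>\<^sub>\<le>\<^sub>0"
    and far: "\<And>x. x \<in> {0..1} \<Longrightarrow> r \<le> norm (z + of_real x)" and r: "r > 0"
  shows "norm (Ln (z + 1) - Ln z - (1 / z + 1 / (z + 1)) / 2) \<le> 1 / (2 * r ^ 3)"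
proof -
  \<comment> \<open>The trapezoidal error on the segment from 0 to \<open>w\<close>; its derivative collapses to the single
    fraction \<open>h'\<close>.\<close>
  define h where "h = (\<lambda>w. Ln (z + w) - Ln z - w / 2 * (1 / z + 1 / (z + w)))"
  define h' where "h' = (\<lambda>w. - (w ^ 2) / (2 * z * (z + w) ^ 2))"
  have seg: "\<exists>x\<in>{0..1}. w = of_real x" if "w \<in> closed_segment 0 (1::complex)" for w
    using that by (auto simp: closed_segment_def scaleR_conv_of_real)
  have z0: "z \<noteq> 0" using far[of 0] r by auto
  have "norm (h 1 - h 0) \<le> 1 / (2 * r ^ 3) * norm (1 - 0 :: complex)"
  proof (rule field_differentiable_bound[where S = "closed_segment 0 1" and f' = h'])
    fix w :: complex assume w: "w \<in> closed_segment 0 1"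
    then obtain x where x: "x \<in> {0..1}" "w = of_real x" using seg by blast
    have zw: "z + w \<notin> \<real>\<^sub>\<le>\<^sub>0" "r \<le> norm (z + w)" using slit[OF x(1)] far[OF x(1)] x(2) by auto
    then have zw0: "z + w \<noteq> 0" using r by auto
    have "w * 4 + z * 4 = 4 * (z + w)" by (simp add: algebra_simps)
    then have zw4: "w * 4 + z * 4 \<noteq> 0" using zw0 by (simp only: mult_eq_0_iff) simp
    have "(h has_field_derivative (1 / (z + w) - (1 / 2 * (1 / z + 1 / (z + w)) - w / 2 * (1 / (z + w) ^ 2)))) (at w)"
      unfolding h_def
      by (rule derivative_eq_intros refl | use zw zw0 z0 in \<open>simp; fail\<close>)+
         (use zw0 z0 zw4 in \<open>simp add: divide_simps power2_eq_square; simp add: algebra_simps\<close>)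
    also have "1 / (z + w) - (1 / 2 * (1 / z + 1 / (z + w)) - w / 2 * (1 / (z + w) ^ 2)) = h' w"
      unfolding h'_def using zw0 z0 by (simp add: divide_simps power2_eq_square) (simp add: algebra_simps)
    finally show "(h has_field_derivative h' w) (at w within closed_segment 0 1)"
      by (rule has_field_derivative_at_within)
    have "norm (h' w) = x ^ 2 / (2 * norm z * norm (z + w) ^ 2)"
      using x by (simp add: h'_def norm_divide norm_mult norm_power)
    also have "\<dots> \<le> 1 / (2 * r * r ^ 2)"
      using x zw(2) far[of 0] r
      by (intro frac_le mult_mono power_mono) (auto simp: power_le_one)
    finally show "norm (h' w) \<le> 1 / (2 * r ^ 3)" by (simp add: power2_eq_square power3_eq_cube mult_ac)
  qed auto
  then show ?thesis by (simp add: h_def)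
qed

text \<open>
  The remainder after the first two terms of the asymptotic expansion of the digamma function. The
  recurrence \<open>Digamma (z + 1) = Digamma z + 1/z\<close> turns its increments into trapezoidal errors, so
  it is a telescoping sum of quantities that \<open>Ln_trapezoid_error\<close> controls.
\<close>

definition Digamma_rem :: "complex \<Rightarrow> complex" where
  "Digamma_rem z = Digamma z - Ln z + 1 / (2 * z)"

lemma Digamma_rem_plus1:
  assumes "z \<noteq> 0"
  shows "Digamma_rem z - Digamma_rem (z + 1) = Ln (z + 1) - Ln z - (1 / z + 1 / (z + 1)) / 2"
  using Digamma_plus1[OF assms] by (simp add: Digamma_rem_def add_divide_distrib distrib_left mult.commute)

lemma Digamma_plus_of_nat:
  fixes z :: complex
  assumes "z \<notin> \<int>\<^sub>\<le>\<^sub>0"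
  shows "Digamma (z + of_nat m) = Digamma z + (\<Sum>n<m. inverse (z + of_nat n))"
proof (induction m)
  case (Suc m)
  have "z + of_nat m \<noteq> 0" using assms
    by (metis add.commute add_eq_0_iff minus_of_nat_in_nonpos_Ints)
  then show ?case using Suc Digamma_plus1[of "z + of_nat m"]
    by (simp add: add_ac inverse_eq_divide)
qed simp

text \<open>
  The telescoping sum has no boundary term at infinity: the limit formula for the digamma function
  says that \<open>Digamma (z + m) - ln m\<close> tends to zero.
\<close>

lemma Digamma_rem_tendsto_0:
  fixes z :: complex
  assumes z: "z \<notin> \<int>\<^sub>\<le>\<^sub>0"
  shows "(\<lambda>m. Digamma_rem (z + of_nat m)) \<longlonglongrightarrow> 0"
proof -
  have zm: "z + of_nat m \<noteq> 0" for m using z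
    by (metis add.commute add_eq_0_iff minus_of_nat_in_nonpos_Ints)
  have inv: "(\<lambda>m. z / of_nat m) \<longlonglongrightarrow> 0"
    using tendsto_mult_right_zero[OF lim_1_over_n[where 'a=complex], of z] by simp
  have "(\<lambda>m. Ln (1 + z / of_nat m)) \<longlonglongrightarrow> Ln (1 + 0)"
    by (intro tendsto_Ln tendsto_add tendsto_const inv) simp
  moreover have "\<forall>\<^sub>F m in sequentially. Ln (1 + z / of_nat m) = Ln (z + of_nat m) - of_real (ln (real m))"
  proof (rule eventually_mono[OF eventually_gt_at_top[of 0]])
    fix m :: nat assume m: "m > 0"
    have "z + of_nat m = of_real (real m) * (1 + z / of_nat m)" using m by (simp add: field_simps)
    moreover have "1 + z / of_nat m \<noteq> 0" using zm[of m] m by (auto simp: field_simps)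
    ultimately show "Ln (1 + z / of_nat m) = Ln (z + of_nat m) - of_real (ln (real m))"
      using Ln_times_of_real[of "real m" "1 + z / of_nat m"] m by simp
  qed
  ultimately have 1: "(\<lambda>m. Ln (z + of_nat m) - of_real (ln (real m))) \<longlonglongrightarrow> 0"
    by (simp add: tendsto_cong)
  have 2: "(\<lambda>m. Digamma z - (of_real (ln (real m)) - (\<Sum>n<m. inverse (z + of_nat n)))) \<longlonglongrightarrow> Digamma z - Digamma z"
    by (intro tendsto_diff tendsto_const Digamma_LIMSEQ) (use zm[of 0] in auto)
  have "filterlim (\<lambda>m. z + of_nat m) at_infinity sequentially"
    by (intro tendsto_add_filterlim_at_infinity[OF tendsto_const] tendsto_of_nat)
  then have 3: "(\<lambda>m. 1 / 2 * inverse (z + of_nat m)) \<longlonglongrightarrow> 1 / 2 * 0"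
    by (intro tendsto_mult tendsto_const) (rule filterlim_compose[OF tendsto_inverse_0])
  have "(\<lambda>m. (Digamma z - (of_real (ln (real m)) - (\<Sum>n<m. inverse (z + of_nat n))))
      - (Ln (z + of_nat m) - of_real (ln (real m))) + 1 / 2 * inverse (z + of_nat m)) \<longlonglongrightarrow> (Digamma z - Digamma z) - 0 + 1 / 2 * 0"
    by (intro tendsto_add tendsto_diff[OF 2 1] 3)
  then show ?thesis
    by (simp add: Digamma_rem_def Digamma_plus_of_nat[OF z] field_simps)
qed

lemma norm_add_of_real_ge:
  fixes z :: complex
  assumes "Re z \<ge> 0" "x \<ge> 0"
  shows "norm (z + of_real x) \<ge> norm z" "norm (z + of_real x) \<ge> (norm z + x) / 2"
proof -
  show 1: "norm (z + of_real x) \<ge> norm z"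
    using assms by (simp add: cmod_def power_mono)
  have "norm (z + of_real x) \<ge> x"
    using complex_Re_le_cmod[of "z + of_real x"] assms by simp
  with 1 show "norm (z + of_real x) \<ge> (norm z + x) / 2" by simp
qed

lemma Digamma_rem_bound_right:
  fixes z :: complex
  assumes Re: "Re z \<ge> 0" and r: "norm z \<ge> 1"
  shows "norm (Digamma_rem z) \<le> 8 / norm z ^ 2"
proof -
  let ?r = "norm z"
  define u where "u n = Digamma_rem (z + of_nat n)" for n
  \<comment> \<open>A telescoping majorant: its decrements dominate \<open>4 / (n + r)^3\<close>, because
    \<open>(t - 1/2)^(-2) - (t + 1/2)^(-2) = 2 t / (t^2 - 1/4)^2 \<ge> 2 / t^3\<close>.\<close>
  define v where "v n = 2 / (real n + ?r - 1/2) ^ 2" for n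
  have slit: "z + of_real x \<notin> \<real>\<^sub>\<le>\<^sub>0" if "x \<ge> 0" for x
  proof
    assume "z + of_real x \<in> \<real>\<^sub>\<le>\<^sub>0"
    then have "Re z + x \<le> 0" "Im z = 0" by (auto simp: complex_nonpos_Reals_iff)
    with Re that have "z = 0" by (auto simp: complex_eq_iff)
    with r show False by simp
  qed
  have "z \<notin> \<int>\<^sub>\<le>\<^sub>0" using slit[of 0] nonpos_Ints_subset_nonpos_Reals by auto
  note lim = Digamma_rem_tendsto_0[OF this]
  have step: "norm (u n - u (Suc n)) \<le> v n - v (Suc n)" for n
  proof -
    define t where "t = real n + ?r"
    have t: "t \<ge> 1" using r by (simp add: t_def)
    have ge: "t / 2 \<le> norm (z + of_nat n + of_real x)" if "x \<in> {0..1}" for x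
    proof -
      have "t / 2 \<le> (norm z + (real n + x)) / 2" using that by (simp add: t_def)
      also have "\<dots> \<le> norm (z + of_real (real n + x))"
        using that Re by (intro norm_add_of_real_ge) auto
      finally show ?thesis by (simp add: add_ac)
    qed
    have nz: "z + of_nat n \<noteq> 0" using ge[of 0] t by auto
    have "norm (u n - u (Suc n)) = norm (Digamma_rem (z + of_nat n) - Digamma_rem (z + of_nat n + 1))"
      by (simp add: u_def add_ac)
    also have "\<dots> \<le> 1 / (2 * (t / 2) ^ 3)"
      unfolding Digamma_rem_plus1[OF nz]
    proof (rule Ln_trapezoid_error)
      fix x :: real assume "x \<in> {0..1}"
      then show "z + of_nat n + of_real x \<notin> \<real>\<^sub>\<le>\<^sub>0" using slit[of "real n + x"] by (simp add: add_ac)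
    qed (use ge t in auto)
    also have "\<dots> = 4 / t ^ 3" by (simp add: power_divide)
    also have "\<dots> \<le> 2 / (t - 1/2) ^ 2 - 2 / (t + 1/2) ^ 2"
    proof -
      have "2 / (t - 1/2) ^ 2 - 2 / (t + 1/2) ^ 2 = 2 * ((t + 1/2) ^ 2 - (t - 1/2) ^ 2) / ((t - 1/2) ^ 2 * (t + 1/2) ^ 2)"
        using t by (simp add: diff_frac_eq right_diff_distrib)
      also have "\<dots> = 4 * t / (t ^ 2 - 1/4) ^ 2"
      proof -
        have "(t + 1/2) ^ 2 - (t - 1/2) ^ 2 = 2 * t" by (simp add: power2_eq_square algebra_simps)
        moreover have "(t - 1/2) ^ 2 * (t + 1/2) ^ 2 = (t ^ 2 - 1/4) ^ 2"
          by (simp add: power_mult_distrib[symmetric] power2_eq_square algebra_simps)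
        ultimately show ?thesis by simp
      qed
      also have "\<dots> \<ge> 4 * t / (t ^ 2) ^ 2"
      proof (intro divide_left_mono power_mono)
        have "t ^ 2 \<ge> 1" using t by simp
        then show "0 \<le> t\<^sup>2 - 1/4" "0 < (t\<^sup>2)\<^sup>2 * (t\<^sup>2 - 1/4)\<^sup>2" by (auto intro!: mult_pos_pos)
      qed (use t in auto)
      also have "4 * t / (t ^ 2) ^ 2 = 4 / t ^ 3" using t by (simp add: power2_eq_square power3_eq_cube)
      finally show ?thesis .
    qed
    also have "\<dots> = v n - v (Suc n)" by (simp add: v_def t_def algebra_simps)
    finally show ?thesis .
  qed
  have sum: "norm (u 0 - u n) \<le> v 0 - v n" for n
  proof (induction n)
    case (Suc n)
    have "norm (u 0 - u (Suc n)) \<le> norm (u 0 - u n) + norm (u n - u (Suc n))"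
      using norm_triangle_ineq[of "u 0 - u n" "u n - u (Suc n)"] by simp
    with Suc step[of n] show ?case by simp
  qed simp
  have "v n \<ge> 0" for n by (simp add: v_def)
  then have "norm (u 0 - u n) \<le> v 0" for n using sum[of n] by (meson diff_le_eq le_add_same_cancel1 order_trans)
  moreover have "(\<lambda>n. norm (u 0 - u n)) \<longlonglongrightarrow> norm (u 0 - 0)"
    unfolding u_def by (intro tendsto_intros lim)
  ultimately have "norm (u 0) \<le> v 0"
    by (metis (no_types, lifting) Lim_bounded diff_zero)
  also have "v 0 \<le> 2 / (?r / 2) ^ 2" unfolding v_def using r
    by (intro divide_left_mono power_mono mult_pos_pos) auto
  also have "\<dots> = 8 / ?r ^ 2" by (simp add: power_divide)
  finally show ?thesis by (simp add: u_def)
qed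

text \<open>
  To the left of the imaginary axis the distance from the poles is only bounded below by
  \<open>|Im z|\<close>. Each unit step to the left adds one trapezoidal error of order \<open>|Im z|^(-3)\<close>.
\<close>

lemma Digamma_rem_bound_strip:
  "\<exists>C. \<forall>z::complex. Re z \<ge> - real k \<and> \<bar>Im z\<bar> \<ge> 1 \<longrightarrow> norm (Digamma_rem z) \<le> C / (Im z) ^ 2"
proof (induction k)
  case 0
  show ?case
  proof (intro exI[of _ 8] allI impI)
    fix z :: complex assume z: "Re z \<ge> - real 0 \<and> \<bar>Im z\<bar> \<ge> 1"
    have le: "\<bar>Im z\<bar> \<le> norm z" by (rule abs_Im_le_cmod)
    have "norm (Digamma_rem z) \<le> 8 / norm z ^ 2"
      using z le by (intro Digamma_rem_bound_right) auto
    also have "\<dots> \<le> 8 / \<bar>Im z\<bar> ^ 2" using z le by (intro divide_left_mono power_mono mult_pos_pos) auto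
    finally show "norm (Digamma_rem z) \<le> 8 / (Im z) ^ 2" by simp
  qed
next
  case (Suc k)
  then obtain C where C: "\<And>z::complex. Re z \<ge> - real k \<Longrightarrow> \<bar>Im z\<bar> \<ge> 1 \<Longrightarrow> norm (Digamma_rem z) \<le> C / (Im z) ^ 2"
    by blast
  show ?case
  proof (intro exI[of _ "C + 1"] allI impI)
    fix z :: complex assume z: "Re z \<ge> - real (Suc k) \<and> \<bar>Im z\<bar> \<ge> 1"
    let ?y = "\<bar>Im z\<bar>"
    have "norm (Ln (z + 1) - Ln z - (1 / z + 1 / (z + 1)) / 2) \<le> 1 / (2 * ?y ^ 3)"
    proof (rule Ln_trapezoid_error)
      fix x :: real
      show "z + of_real x \<notin> \<real>\<^sub>\<le>\<^sub>0" using z by (auto simp: complex_nonpos_Reals_iff)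
      show "?y \<le> norm (z + of_real x)" using abs_Im_le_cmod[of "z + of_real x"] by simp
    qed (use z in auto)
    also have "\<dots> \<le> 1 / ?y ^ 2"
    proof (intro divide_left_mono mult_pos_pos)
      have "?y ^ 2 * 1 \<le> ?y ^ 2 * (2 * ?y)" using z by (intro mult_left_mono) auto
      then show "?y ^ 2 \<le> 2 * ?y ^ 3" by (simp add: power2_eq_square power3_eq_cube)
    qed (use z in auto)
    finally have "norm (Digamma_rem z - Digamma_rem (z + 1)) \<le> 1 / (Im z) ^ 2"
      using z by (subst Digamma_rem_plus1) auto
    moreover have "norm (Digamma_rem (z + 1)) \<le> C / (Im z) ^ 2" using C[of "z + 1"] z by simp
    ultimately show "norm (Digamma_rem z) \<le> (C + 1) / (Im z) ^ 2"
      using norm_triangle_ineq[of "Digamma_rem z - Digamma_rem (z + 1)" "Digamma_rem (z + 1)"]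
      by (simp add: add_divide_distrib)
  qed
qed

text \<open>
  The filter of \<open>|Im s| \<longlonglongrightarrow> \<infinity>\<close> within a vertical strip. With it the uniform estimates become
  Landau symbols, which add up over the finitely many gamma factors.
\<close>

definition vertical_strip :: "real \<Rightarrow> complex filter" where
  "vertical_strip K = inf (principal {s. \<bar>Re s\<bar> \<le> K}) (filtercomap (\<lambda>s. \<bar>Im s\<bar>) at_top)"

lemma eventually_vertical_strip:
  "eventually P (vertical_strip K) \<longleftrightarrow> (\<exists>Y. \<forall>s. \<bar>Re s\<bar> \<le> K \<and> \<bar>Im s\<bar> \<ge> Y \<longrightarrow> P s)"
  unfolding vertical_strip_def inf_commute[of "principal _"] eventually_inf_principal eventually_filtercomap_at_top_linorder
  by auto

lemma eventually_vertical_stripI: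
  assumes "\<And>s. \<bar>Re s\<bar> \<le> K \<Longrightarrow> \<bar>Im s\<bar> \<ge> Y \<Longrightarrow> P s"
  shows "eventually P (vertical_strip K)"
  using assms unfolding eventually_vertical_strip by blast

lemma Ln_affine_strip:
  assumes A: "A > 0"
  shows "(\<lambda>s. Ln (of_real A * s + of_real a) - of_real (ln A) - Ln s - of_real a / (of_real A * s))
     \<in> O[vertical_strip K](\<lambda>s. of_real (1 / (Im s) ^ 2))"
proof (rule bigoI[where c = "(a / A) ^ 2"], rule eventually_vertical_stripI[where Y = 1])
  fix s :: complex assume s: "\<bar>Im s\<bar> \<ge> 1"
  define \<alpha> where "\<alpha> = a / A"
  define h where "h = (\<lambda>w. Ln (s + w) - Ln s - w / s)"
  have sx: "s + of_real x \<notin> \<real>\<^sub>\<le>\<^sub>0" "s + of_real x \<noteq> 0" "\<bar>Im s\<bar> \<le> norm (s + of_real x)" for x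
    using s abs_Im_le_cmod[of "s + of_real x"] by (auto simp: complex_nonpos_Reals_iff complex_eq_iff)
  have s0: "s \<noteq> 0" using sx(2)[of 0] by simp
  have "norm (h (of_real \<alpha>) - h 0) \<le> \<bar>\<alpha>\<bar> / \<bar>Im s\<bar> ^ 2 * norm (of_real \<alpha> - 0 :: complex)"
  proof (rule field_differentiable_bound[where S = "closed_segment 0 (of_real \<alpha>)" and f' = "\<lambda>w. - w / (s * (s + w))"])
    fix w :: complex assume "w \<in> closed_segment 0 (of_real \<alpha>)"
    then obtain u where u: "0 \<le> u" "u \<le> 1" "w = of_real (u * \<alpha>)"
      by (auto simp: closed_segment_def scaleR_conv_of_real)
    have "(h has_field_derivative (1 / (s + w) - 1 / s)) (at w)"
      unfolding h_def using sx[of "u * \<alpha>"] u s0 by (auto intro!: derivative_eq_intros simp: divide_simps)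
    also have "1 / (s + w) - 1 / s = - w / (s * (s + w))"
      using sx(2)[of "u * \<alpha>"] u s0 by (simp add: divide_simps)
    finally show "(h has_field_derivative - w / (s * (s + w))) (at w within closed_segment 0 (of_real \<alpha>))"
      by (rule has_field_derivative_at_within)
    have "norm (- w / (s * (s + w))) = u * \<bar>\<alpha>\<bar> / (norm s * norm (s + w))"
      using u by (simp add: norm_divide norm_mult abs_mult)
    also have "\<dots> \<le> \<bar>\<alpha>\<bar> / (\<bar>Im s\<bar> * \<bar>Im s\<bar>)"
      using u s sx(3)[of 0] sx(3)[of "u * \<alpha>"]
      by (intro frac_le mult_mono) (auto intro: mult_left_le_one_le simp: zero_less_mult_iff)
    finally show "norm (- w / (s * (s + w))) \<le> \<bar>\<alpha>\<bar> / \<bar>Im s\<bar> ^ 2" by (simp add: power2_eq_square)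
  qed auto
  then have "norm (h (of_real \<alpha>)) \<le> \<alpha> ^ 2 / (Im s) ^ 2"
    by (simp add: h_def power2_eq_square)
  moreover have "Ln (of_real A * s + of_real a) = of_real (ln A) + Ln (s + of_real \<alpha>)"
  proof -
    have "of_real A * s + of_real a = of_real A * (s + of_real \<alpha>)" using A by (simp add: \<alpha>_def field_simps)
    then show ?thesis using A sx(2) by (simp add: Ln_times_of_real Ln_of_real)
  qed
  ultimately show "norm (Ln (of_real A * s + of_real a) - of_real (ln A) - Ln s - of_real a / (of_real A * s))
      \<le> (a / A) ^ 2 * norm (of_real (1 / (Im s) ^ 2) :: complex)"
    by (simp add: h_def \<alpha>_def power_divide norm_divide norm_power)
qed

text \<open>
  The leading terms are arranged so that, in the signed sum over all gamma factors, the coefficient of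
  \<open>Ln s\<close> is \<open>\<Sum>A - \<Sum>B = 0\<close>, the constants add up to \<open>ln \<rho>\<close>, and the coefficients of
  \<open>1/s\<close> add up to \<open>-\<mu>\<close>.
\<close>

lemma Digamma_affine_strip:
  assumes A: "A > 0"
  shows "(\<lambda>s. of_real A * Digamma (of_real A * s + of_real a) -
       (of_real (A * ln A) + of_real A * Ln s + of_real (a - 1/2) / s))
     \<in> O[vertical_strip K](\<lambda>s. of_real (1 / (Im s) ^ 2))"
proof -
  let ?z = "\<lambda>s. of_real A * s + of_real a :: complex"
  have 1: "(\<lambda>s. Digamma_rem (?z s)) \<in> O[vertical_strip K](\<lambda>s. of_real (1 / (Im s) ^ 2))"
  proof -
    define k where "k = nat \<lceil>A * K + \<bar>a\<bar>\<rceil>"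
    obtain C where C: "\<And>z::complex. Re z \<ge> - real k \<Longrightarrow> \<bar>Im z\<bar> \<ge> 1 \<Longrightarrow> norm (Digamma_rem z) \<le> C / (Im z) ^ 2"
      using Digamma_rem_bound_strip[of k] by blast
    show ?thesis
    proof (rule bigoI[where c = "C / A ^ 2"], rule eventually_vertical_stripI[where Y = "1 / A"])
      fix s :: complex assume s: "\<bar>Re s\<bar> \<le> K" "\<bar>Im s\<bar> \<ge> 1 / A"
      have "real k \<ge> A * K + \<bar>a\<bar>" unfolding k_def by linarith
      moreover have "A * Re s \<ge> - (A * K)" using A s(1) by (smt (verit) mult_left_mono mult_minus_right)
      ultimately have "Re (?z s) \<ge> - real k" by (simp add: )
      moreover have "\<bar>Im (?z s)\<bar> \<ge> 1" using s(2) A by (simp add: abs_mult field_simps)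
      ultimately have "norm (Digamma_rem (?z s)) \<le> C / (Im (?z s)) ^ 2" by (rule C)
      then show "norm (Digamma_rem (?z s)) \<le> C / A ^ 2 * norm (of_real (1 / (Im s) ^ 2) :: complex)"
        by (simp add: power_mult_distrib norm_divide norm_power)
    qed
  qed
  have 3: "(\<lambda>s. 1 / (2 * s) - of_real A / (2 * ?z s)) \<in> O[vertical_strip K](\<lambda>s. of_real (1 / (Im s) ^ 2))"
  proof (rule bigoI[where c = "\<bar>a\<bar> / (2 * A)"], rule eventually_vertical_stripI[where Y = 1])
    fix s :: complex assume s: "\<bar>Im s\<bar> \<ge> 1"
    have le: "\<bar>Im s\<bar> \<le> norm s" "A * \<bar>Im s\<bar> \<le> norm (?z s)"
      using abs_Im_le_cmod[of s] abs_Im_le_cmod[of "?z s"] A by (auto simp: abs_mult)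
    have nz: "s \<noteq> 0" "?z s \<noteq> 0" using s A by (auto simp: complex_eq_iff)
    have "1 / (2 * s) - of_real A / (2 * ?z s) = of_real a / (2 * s * ?z s)"
    proof -
      have "1 / (2 * s) - of_real A / (2 * w) = (w - of_real A * s) / (2 * s * w)" if "w \<noteq> 0" for w
        using nz(1) that by (simp add: divide_simps)
      from this[OF nz(2)] show ?thesis by simp
    qed
    also have "norm \<dots> = \<bar>a\<bar> / (2 * norm s * norm (?z s))" by (simp add: norm_divide norm_mult)
    also have "\<dots> \<le> \<bar>a\<bar> / (2 * \<bar>Im s\<bar> * (A * \<bar>Im s\<bar>))"
      using le s A by (intro divide_left_mono mult_mono mult_pos_pos) (auto intro: order_trans[OF _ le(1)] simp: nz)
    finally show "norm (1 / (2 * s) - of_real A / (2 * ?z s)) \<le> \<bar>a\<bar> / (2 * A) * norm (of_real (1 / (Im s) ^ 2) :: complex)"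
      by (simp add: norm_divide norm_mult norm_power power2_eq_square mult_ac)
  qed
  have "(\<lambda>s. of_real A * Digamma_rem (?z s) + of_real A * (Ln (?z s) - of_real (ln A) - Ln s - of_real a / (of_real A * s))
      + (1 / (2 * s) - of_real A / (2 * ?z s))) \<in> O[vertical_strip K](\<lambda>s. of_real (1 / (Im s) ^ 2))"
    by (rule sum_in_bigo(1)[OF sum_in_bigo(1) 3]) (use 1 Ln_affine_strip[OF A] A in simp_all)
  moreover have "of_real A * Digamma_rem (?z s) + of_real A * (Ln (?z s) - of_real (ln A) - Ln s - of_real a / (of_real A * s))
      + (1 / (2 * s) - of_real A / (2 * ?z s)) =
      of_real A * Digamma (?z s) - (of_real (A * ln A) + of_real A * Ln s + of_real (a - 1/2) / s)" for s
    using A by (simp add: Digamma_rem_def algebra_simps diff_divide_distrib)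
  ultimately show ?thesis by simp
qed

section \<open>The kernel of P and the sufficient conditions (a), (b), (c)\<close>

text \<open>
  The contribution of one gamma factor to \<open>P\<close>: by \<open>Digamma_diff_integral\<close> below, it is the
  kernel in the Laplace integral for increments of the logarithmic derivative of \<open>\<Gamma>(A s + a)\<close>.
\<close>

definition gamma_kernel :: "real \<Rightarrow> real \<Rightarrow> real \<Rightarrow> real" where
  "gamma_kernel A a u = exp (- a * u / A) / (1 - exp (- u / A))"

lemma gamma_kernel_measurable [measurable]: "gamma_kernel A a \<in> borel_measurable borel"
  unfolding gamma_kernel_def by measurable

lemma fox_P_eq_gamma_kernel:
  "fox_P p q A a B b u = (\<Sum>i=1..p. gamma_kernel (A i) (a i) u) - (\<Sum>j=1..q. gamma_kernel (B j) (b j) u)"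
  by (simp add: fox_P_def gamma_kernel_def)

lemma gamma_kernel_sums:
  assumes "A > 0" "u > 0"
  shows "(\<lambda>n. exp (- ((a + real n) / A) * u)) sums gamma_kernel A a u"
proof -
  have "(\<lambda>n. exp (- a * u / A) * exp (- u / A) ^ n) sums (exp (- a * u / A) * (1 / (1 - exp (- u / A))))"
    using assms by (intro sums_mult geometric_sums) auto
  moreover have "exp (- a * u / A) * exp (- u / A) ^ n = exp (- ((a + real n) / A) * u)" for n
    by (simp add: exp_of_nat_mult[symmetric] exp_add[symmetric] algebra_simps add_divide_distrib)
  ultimately show ?thesis by (simp add: gamma_kernel_def)
qed

lemma gamma_kernel_ge:
  assumes "A > 0" "u > 0"
  shows "A / u * exp (- (a / A) * u) \<le> gamma_kernel A a u"
proof -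
  have pos: "0 < 1 - exp (- u / A)" using assms by simp
  have "1 - exp (- u / A) \<le> u / A" using exp_ge_add_one_self[of "- u / A"] by simp
  then have "1 / (u / A) \<le> 1 / (1 - exp (- u / A))" using pos assms by (intro divide_left_mono) auto
  then have "exp (- a * u / A) * (A / u) \<le> exp (- a * u / A) * (1 / (1 - exp (- u / A)))"
    by (intro mult_left_mono) auto
  then show ?thesis by (simp add: gamma_kernel_def mult_ac)
qed

text \<open>
  Taking a factor \<open>e^(-x)\<close> out of the numerator is what
  shifts \<open>b\<close> to \<open>b - 1\<close> in the conditions (a) and (b).
\<close>

lemma gamma_kernel_le:
  assumes "B > 0" "u > 0"
  shows "gamma_kernel B b u \<le> B / u * exp (- ((b - 1) / B) * u)"
proof -
  define x where "x = u / B"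
  have x: "x > 0" using assms by (simp add: x_def)
  have "exp (- x) * (1 + x) \<le> exp (- x) * exp x" by (intro mult_left_mono exp_ge_add_one_self) auto
  then have "exp (- x) * x \<le> 1 - exp (- x)" by (simp add: exp_add[symmetric] algebra_simps)
  then have "exp (- x) / (1 - exp (- x)) \<le> 1 / x" using x by (simp add: field_simps)
  then have "exp (- ((b - 1) / B) * u) * (exp (- x) / (1 - exp (- x))) \<le> exp (- ((b - 1) / B) * u) * (1 / x)"
    by (intro mult_left_mono) auto
  moreover have "exp (- b * u / B) = exp (- ((b - 1) / B) * u) * exp (- x)"
    using assms by (simp add: x_def exp_add[symmetric] field_simps)
  ultimately show ?thesis by (simp add: gamma_kernel_def x_def mult_ac)
qed

lemma fox_P_nonneg_of_exp_sums:
  assumes "\<And>i. i \<in> {1..p} \<Longrightarrow> A i > 0" and "\<And>j. j \<in> {1..q} \<Longrightarrow> B j > 0" and u: "u > 0"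
    and le: "(\<Sum>j=1..q. B j * exp (- ((b j - 1) / B j) * u)) \<le> (\<Sum>i=1..p. A i * exp (- (a i / A i) * u))"
  shows "fox_P p q A a B b u \<ge> 0"
proof -
  have "(\<Sum>j=1..q. gamma_kernel (B j) (b j) u) \<le> (\<Sum>j=1..q. B j / u * exp (- ((b j - 1) / B j) * u))"
    using assms by (intro sum_mono gamma_kernel_le) auto
  also have "\<dots> = (\<Sum>j=1..q. B j * exp (- ((b j - 1) / B j) * u)) / u"
    by (simp add: sum_divide_distrib)
  also have "\<dots> \<le> (\<Sum>i=1..p. A i * exp (- (a i / A i) * u)) / u"
    using le u by (intro divide_right_mono) auto
  also have "\<dots> = (\<Sum>i=1..p. A i / u * exp (- (a i / A i) * u))"
    by (simp add: sum_divide_distrib)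
  also have "\<dots> \<le> (\<Sum>i=1..p. gamma_kernel (A i) (a i) u)"
    using assms by (intro sum_mono gamma_kernel_ge) auto
  finally show ?thesis by (simp add: fox_P_eq_gamma_kernel)
qed

text \<open>
  Both exponential sums are compared with \<open>e^(-m u)\<close>, where \<open>m\<close> separates the two families of
  exponents; the total weights \<open>\<Sum>A\<close> and \<open>\<Sum>B\<close> agree.
\<close>

lemma cond_a_imp_fox_P_nonneg:
  assumes A: "\<And>i. i \<in> {1..p} \<Longrightarrow> A i > 0" and B: "\<And>j. j \<in> {1..q} \<Longrightarrow> B j > 0"
    and eq: "(\<Sum>j=1..q. B j) = (\<Sum>i=1..p. A i)" and cond: "cond_a p q A a B b" and u: "u > 0"
  shows "fox_P p q A a B b u \<ge> 0"
proof (rule fox_P_nonneg_of_exp_sums[OF A B u])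
  define m where "m = Max ((\<lambda>i. a i / A i) ` {1..p})"
  have m1: "a i / A i \<le> m" if "i \<in> {1..p}" for i using that by (simp add: m_def)
  have m2: "m \<le> (b j - 1) / B j" if "j \<in> {1..q}" for j
    using cond that unfolding cond_a_def m_def[symmetric]
    by (meson Min_le finite_atLeastAtMost finite_imageI image_eqI order_trans)
  have "(\<Sum>j=1..q. B j * exp (- ((b j - 1) / B j) * u)) \<le> (\<Sum>j=1..q. B j * exp (- m * u))"
  proof (intro sum_mono mult_left_mono)
    fix j assume j: "j \<in> {1..q}"
    have "m * u \<le> (b j - 1) / B j * u" using m2[OF j] u by (intro mult_right_mono) auto
    then show "exp (- ((b j - 1) / B j) * u) \<le> exp (- m * u)" by simp
  qed (use B less_imp_le in blast)
  also have "\<dots> = (\<Sum>i=1..p. A i * exp (- m * u))" using eq by (simp add: sum_distrib_right[symmetric])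
  also have "\<dots> \<le> (\<Sum>i=1..p. A i * exp (- (a i / A i) * u))"
  proof (intro sum_mono mult_left_mono)
    fix i assume i: "i \<in> {1..p}"
    have "a i / A i * u \<le> m * u" using m1[OF i] u by (intro mult_right_mono) auto
    then show "exp (- m * u) \<le> exp (- (a i / A i) * u)" by simp
  qed (use A less_imp_le in blast)
  finally show "(\<Sum>j=1..q. B j * exp (- ((b j - 1) / B j) * u)) \<le> (\<Sum>i=1..p. A i * exp (- (a i / A i) * u))" .
qed auto

text \<open>
  With \<open>a_i/A_i\<close> replaced by its upper bound \<open>(b_i - 1)/B_i\<close>, the coefficients
  \<open>A_i - B_i\<close> of the exponentials sum to zero and are nonnegative except possibly the last one, which
  carries the smallest exponential, so their weighted sum is nonnegative.
\<close>

lemma cond_b_imp_fox_P_nonneg: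
  assumes p: "p \<ge> 1" and A: "\<And>i. i \<in> {1..p} \<Longrightarrow> A i > 0" and B: "\<And>j. j \<in> {1..q} \<Longrightarrow> B j > 0"
    and eq: "(\<Sum>j=1..q. B j) = (\<Sum>i=1..p. A i)" and cond: "cond_b p q A a B b" and u: "u > 0"
  shows "fox_P p q A a B b u \<ge> 0"
proof (rule fox_P_nonneg_of_exp_sums[OF A B u])
  define \<beta> where "\<beta> j = (b j - 1) / B j" for j
  have pq: "q = p" using cond by (simp add: cond_b_def)
  have a\<beta>: "a i / A i \<le> \<beta> i" if "i \<in> {1..p}" for i using cond that by (simp add: cond_b_def \<beta>_def)
  have \<beta>p: "\<beta> k \<le> \<beta> p" if k: "k \<in> {1..p-1}" for k
  proof -
    have "p > 1" using k by auto
    then have "b k / B k \<le> \<beta> p" using cond k unfolding cond_b_def \<beta>_def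
      by (meson Max_ge finite_atLeastAtMost finite_imageI image_eqI order_trans)
    moreover have "B k > 0" using B[of k] k pq by auto
    ultimately show ?thesis by (simp add: \<beta>_def diff_divide_distrib) (smt (verit) divide_pos_pos zero_less_one)
  qed
  have AB: "B i \<le> A i" if "i \<in> {1..p-1}" for i using cond that by (simp add: cond_b_def)
  have split: "{1..p} = insert p {1..p-1}" using p by auto
  have "0 = (\<Sum>i=1..p. (A i - B i) * exp (- \<beta> p * u))"
    using eq by (simp add: pq sum_distrib_right[symmetric] sum_subtractf)
  also have "\<dots> \<le> (\<Sum>i=1..p. (A i - B i) * exp (- \<beta> i * u))"
  proof (rule sum_mono)
    fix i assume i: "i \<in> {1..p}"
    show "(A i - B i) * exp (- \<beta> p * u) \<le> (A i - B i) * exp (- \<beta> i * u)"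
    proof (cases "i = p")
      case False
      then have i: "i \<in> {1..p-1}" using i by auto
      have "\<beta> i * u \<le> \<beta> p * u" using \<beta>p[OF i] u by (intro mult_right_mono) auto
      then show ?thesis using AB[OF i] by (intro mult_left_mono) auto
    qed simp
  qed
  finally have "(\<Sum>i=1..p. B i * exp (- \<beta> i * u)) \<le> (\<Sum>i=1..p. A i * exp (- \<beta> i * u))"
    by (simp add: left_diff_distrib sum_subtractf)
  also have "\<dots> \<le> (\<Sum>i=1..p. A i * exp (- (a i / A i) * u))"
  proof (intro sum_mono mult_left_mono)
    fix i assume i: "i \<in> {1..p}"
    have "a i / A i * u \<le> \<beta> i * u" using a\<beta>[OF i] u by (intro mult_right_mono) auto
    then show "exp (- \<beta> i * u) \<le> exp (- (a i / A i) * u)" by simp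
  qed (use A less_imp_le in blast)
  finally show "(\<Sum>j=1..q. B j * exp (- ((b j - 1) / B j) * u)) \<le> (\<Sum>i=1..p. A i * exp (- (a i / A i) * u))"
    by (simp add: \<beta>_def pq)
qed auto

text \<open>
  Summation by parts: the partial sums of \<open>w d\<close> dominate \<open>w k\<close> times the partial sums of
  \<open>d\<close>.
\<close>

lemma Abel_sum_nonneg:
  fixes w d :: "nat \<Rightarrow> real"
  assumes "\<And>i. i \<in> {1..p} \<Longrightarrow> w i \<ge> 0" "\<And>i. i \<in> {1..<p} \<Longrightarrow> w (Suc i) \<le> w i"
    and "\<And>k. k \<in> {1..p} \<Longrightarrow> (\<Sum>i=1..k. d i) \<ge> 0"
  shows "(\<Sum>i=1..p. w i * d i) \<ge> 0"
proof -
  have "(\<Sum>i=1..k. w i * d i) \<ge> w k * (\<Sum>i=1..k. d i)" if "k \<in> {1..p}" for k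
    using that
  proof (induction k)
    case (Suc k)
    show ?case
    proof (cases "k = 0")
      case False
      then have k: "k \<in> {1..p}" "k \<in> {1..<p}" using Suc.prems by auto
      have "w (Suc k) * (\<Sum>i=1..k. d i) \<le> w k * (\<Sum>i=1..k. d i)"
        using assms(2)[OF k(2)] assms(3)[OF k(1)] by (intro mult_right_mono) auto
      with Suc.IH[OF k(1)] show ?thesis by (simp add: distrib_left)
    qed simp
  qed auto
  from this[of p] show ?thesis
    using assms(1)[of p] assms(3)[of p] by (cases "p = 0") (auto intro: order_trans[rotated] mult_nonneg_nonneg)
qed

text \<open>
  The case of a decreasing convex function, here \<open>x \<mapsto> e^(-xu)\<close>, in the Tomic-Weyl inequality for
  weakly majorized sequences. The tangent at \<open>y_i\<close> gives
  \<open>e^(-x_i u) - e^(-y_i u) \<ge> u e^(-y_i u) (y_i - x_i)\<close>, and Abel summation applies with the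
  nonincreasing weights \<open>e^(-y_i u)\<close>.
\<close>

lemma weak_majorization_exp_sum_le:
  fixes x y :: "nat \<Rightarrow> real"
  assumes mono: "mono_on {1..p} y" and u: "u \<ge> 0"
    and le: "\<And>k. k \<in> {1..p} \<Longrightarrow> (\<Sum>i=1..k. x i) \<le> (\<Sum>i=1..k. y i)"
  shows "(\<Sum>i=1..p. exp (- y i * u)) \<le> (\<Sum>i=1..p. exp (- x i * u))"
proof -
  have "0 \<le> (\<Sum>i=1..p. exp (- y i * u) * (y i - x i))"
  proof (rule Abel_sum_nonneg)
    fix i assume "i \<in> {1..<p}"
    then have "y i \<le> y (Suc i)" by (intro mono_onD[OF mono]) auto
    then show "exp (- y (Suc i) * u) \<le> exp (- y i * u)" using u by (simp add: mult_right_mono)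
  qed (use le in \<open>auto simp: sum_subtractf\<close>)
  then have "0 \<le> u * (\<Sum>i=1..p. exp (- y i * u) * (y i - x i))" using u by simp
  also have "\<dots> = (\<Sum>i=1..p. exp (- y i * u) * ((y i - x i) * u))" by (simp add: sum_distrib_left mult_ac)
  also have "\<dots> \<le> (\<Sum>i=1..p. exp (- x i * u) - exp (- y i * u))"
  proof (rule sum_mono)
    fix i
    have "exp (- y i * u) * (1 + (y i - x i) * u) \<le> exp (- y i * u) * exp ((y i - x i) * u)"
      by (intro mult_left_mono exp_ge_add_one_self) auto
    also have "\<dots> = exp (- x i * u)" by (simp add: exp_add[symmetric] algebra_simps)
    finally show "exp (- y i * u) * ((y i - x i) * u) \<le> exp (- x i * u) - exp (- y i * u)"
      by (simp add: algebra_simps)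
  qed
  finally show ?thesis by (simp add: sum_subtractf)
qed

lemma cond_c_imp_fox_P_nonneg:
  assumes A: "\<And>i. i \<in> {1..p} \<Longrightarrow> A i > 0" and B: "\<And>j. j \<in> {1..q} \<Longrightarrow> B j > 0"
    and cond: "cond_c p q A a B b" and u: "u > 0"
  shows "fox_P p q A a B b u \<ge> 0"
proof -
  have pq: "q = p" using cond by (simp add: cond_c_def)
  let ?x = "\<lambda>m i. (a i + real m) / A i" and ?y = "\<lambda>m i. (b i + real m) / B i"
  have sx: "(\<lambda>m. \<Sum>i=1..p. exp (- ?x m i * u)) sums (\<Sum>i=1..p. gamma_kernel (A i) (a i) u)"
    using A u by (intro sums_sum gamma_kernel_sums) auto
  have sy: "(\<lambda>m. \<Sum>i=1..p. exp (- ?y m i * u)) sums (\<Sum>i=1..p. gamma_kernel (B i) (b i) u)"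
    using B u pq by (intro sums_sum gamma_kernel_sums) auto
  have split: "(c + real m) / D = c / D + real m * (1 / D)" for c D :: real and m :: nat
    by (simp add: add_divide_distrib)
  \<comment> \<open>The exponents of the \<open>m\<close>-th terms of the geometric series are sums of the sequences in the
    hypothesis with nonnegative weights, so they inherit monotonicity and majorization.\<close>
  have "(\<Sum>i=1..p. exp (- ?y m i * u)) \<le> (\<Sum>i=1..p. exp (- ?x m i * u))" for m
  proof (rule weak_majorization_exp_sum_le)
    show "mono_on {1..p} (?y m)"
    proof (rule mono_onI)
      fix r s assume rs: "r \<in> {1..p}" "s \<in> {1..p}" "r \<le> s"
      have "b r / B r \<le> b s / B s" "1 / B r \<le> 1 / B s"
        using mono_onD[OF _ rs, of "\<lambda>i. b i / B i"] mono_onD[OF _ rs, of "\<lambda>i. 1 / B i"] cond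
        unfolding cond_c_def by blast+
      then show "?y m r \<le> ?y m s" unfolding split by (intro add_mono mult_left_mono) auto
    qed
    fix k assume k: "k \<in> {1..p}"
    have "(\<Sum>i=1..k. a i / A i) \<le> (\<Sum>i=1..k. b i / B i)" "(\<Sum>i=1..k. 1 / A i) \<le> (\<Sum>i=1..k. 1 / B i)"
      using cond k by (auto simp: cond_c_def)
    then show "(\<Sum>i=1..k. ?x m i) \<le> (\<Sum>i=1..k. ?y m i)"
      unfolding split sum.distrib sum_distrib_left[symmetric] by (intro add_mono mult_left_mono) auto
  qed (use u in auto)
  from sums_le[OF this sy sx] show ?thesis by (simp add: fox_P_eq_gamma_kernel pq)
qed

section \<open>Infinitely divisible laws with given drift and Levy density\<close>

lemma convolution_real_distribution:
  assumes "real_distribution M" "real_distribution N"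
  shows "real_distribution (convolution M N)"
    and "char (convolution M N) t = char M t * char N t"
proof -
  interpret M: real_distribution M by fact
  interpret N: real_distribution N by fact
  interpret P: pair_prob_space M N ..
  show "real_distribution (convolution M N)"
    unfolding convolution_def by (intro P.real_distribution_distr) simp
  have int: "integrable (M \<Otimes>\<^sub>M N) (\<lambda>z. iexp (t * fst z) * iexp (t * snd z))"
    by (rule P.integrable_const_bound[where B = 1]) (auto simp: norm_mult)
  have "char (convolution M N) t = (CLINT z|M \<Otimes>\<^sub>M N. iexp (t * fst z) * iexp (t * snd z))"
    unfolding char_def convolution_def
    by (subst integral_distr) (auto simp: case_prod_unfold exp_add[symmetric] distrib_left)
  also have "\<dots> = (CLINT x|M. CLINT y|N. iexp (t * x) * iexp (t * y))"
    using P.integral_fst'[OF int] by simp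
  also have "\<dots> = char M t * char N t" by (simp add: char_def)
  finally show "char (convolution M N) t = char M t * char N t" .
qed

lemma nonneg_distribution_AE:
  assumes "real_distribution M"
  shows "nonneg_distribution M \<longleftrightarrow> (AE x in M. 0 \<le> x)"
proof -
  interpret real_distribution M by fact
  show ?thesis unfolding nonneg_distribution_def
    by (subst AE_iff_measurable[where N = "{..<0}"]) (auto simp: assms)
qed

lemma convolution_nonneg_distribution:
  assumes M: "nonneg_distribution M" and N: "nonneg_distribution N"
  shows "nonneg_distribution (convolution M N)"
proof -
  have rd: "real_distribution M" "real_distribution N" using M N by (auto simp: nonneg_distribution_def)
  interpret M: real_distribution M by fact
  interpret N: real_distribution N by fact
  interpret P: pair_prob_space M N ..
  have aeM: "AE x in M. 0 \<le> x" and aeN: "AE y in N. 0 \<le> y"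
    using M N rd nonneg_distribution_AE by blast+
  have "AE x in M. AE y in N. 0 \<le> x + y"
    by (rule eventually_mono[OF aeM], rule eventually_mono[OF aeN]) simp
  then have "(\<integral>\<^sup>+x. \<integral>\<^sup>+y. indicator {..<0} (x + y) \<partial>N \<partial>M) = (\<integral>\<^sup>+x. \<integral>\<^sup>+y. 0 \<partial>N \<partial>M)"
    by (intro nn_integral_cong_AE, elim eventually_mono, intro nn_integral_cong_AE, elim eventually_mono) auto
  then have "emeasure (convolution M N) {..<0} = 0"
    using rd by (subst convolution_emeasure') (auto intro: M.finite_measure_axioms N.finite_measure_axioms)
  then show ?thesis using convolution_real_distribution(1)[OF rd] by (simp add: nonneg_distribution_def)
qed

text \<open>
  The function \<open>ennreal\<close> truncates at zero, so this is subadditivity of the mean of the positive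
  part. It bounds the means of the approximating laws and thereby yields tightness.
\<close>

lemma nn_integral_id_convolution_le:
  assumes M: "real_distribution M" and N: "real_distribution N"
  shows "(\<integral>\<^sup>+x. ennreal x \<partial>convolution M N) \<le> (\<integral>\<^sup>+x. ennreal x \<partial>M) + (\<integral>\<^sup>+x. ennreal x \<partial>N)"
proof -
  interpret M: real_distribution M by fact
  interpret N: real_distribution N by fact
  have "(\<integral>\<^sup>+x. ennreal x \<partial>convolution M N) = (\<integral>\<^sup>+x. \<integral>\<^sup>+y. ennreal (x + y) \<partial>N \<partial>M)"
    by (intro nn_integral_convolution) (auto intro: M.finite_measure_axioms N.finite_measure_axioms)
  also have "\<dots> \<le> (\<integral>\<^sup>+x. \<integral>\<^sup>+y. ennreal x + ennreal y \<partial>N \<partial>M)"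
  proof (intro nn_integral_mono)
    fix x y :: real
    have "ennreal (x + y) \<le> ennreal (max 0 x + max 0 y)" by (intro ennreal_leI) auto
    also have "\<dots> = ennreal x + ennreal y" by (simp add: ennreal_plus ennreal_max_0)
    finally show "ennreal (x + y) \<le> ennreal x + ennreal y" .
  qed
  also have "\<dots> = (\<integral>\<^sup>+x. ennreal x \<partial>M) + (\<integral>\<^sup>+x. ennreal x \<partial>N)"
    by (simp add: nn_integral_add M.emeasure_space_1[simplified] N.emeasure_space_1[simplified])
  finally show ?thesis .
qed

lemma nonneg_distribution_return_0: "nonneg_distribution (return borel 0)"
  unfolding nonneg_distribution_def real_distribution_def real_distribution_axioms_def
  by (simp add: prob_space_return)

lemma convolution_power_props:
  assumes N: "nonneg_distribution N"
  shows "nonneg_distribution (convolution_power N k)"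
    and "char (convolution_power N k) t = char N t ^ k"
    and "(\<integral>\<^sup>+x. ennreal x \<partial>convolution_power N k) \<le> of_nat k * (\<integral>\<^sup>+x. ennreal x \<partial>N)"
proof -
  have rdN: "real_distribution N" using N by (simp add: nonneg_distribution_def)
  have nn: "nonneg_distribution (convolution_power N k)" for k
  proof (induction k)
    case 0
    show ?case by (simp add: nonneg_distribution_return_0)
  next
    case (Suc k)
    then show ?case using convolution_nonneg_distribution[OF N] by simp
  qed
  then have rd: "real_distribution (convolution_power N k)" for k by (simp add: nonneg_distribution_def)
  show "nonneg_distribution (convolution_power N k)" by (rule nn)
  show "char (convolution_power N k) t = char N t ^ k"
  proof (induction k)
    case 0
    show ?case by (simp add: char_def integral_return)
  next
    case (Suc k)
    then show ?case by (simp add: convolution_real_distribution(2)[OF rdN rd])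
  qed
  show "(\<integral>\<^sup>+x. ennreal x \<partial>convolution_power N k) \<le> of_nat k * (\<integral>\<^sup>+x. ennreal x \<partial>N)"
  proof (induction k)
    case 0
    show ?case by (simp add: nn_integral_return)
  next
    case (Suc k)
    have "(\<integral>\<^sup>+x. ennreal x \<partial>convolution_power N (Suc k)) \<le> (\<integral>\<^sup>+x. ennreal x \<partial>N) + (\<integral>\<^sup>+x. ennreal x \<partial>convolution_power N k)"
      using nn_integral_id_convolution_le[OF rdN rd] by simp
    also have "\<dots> \<le> (\<integral>\<^sup>+x. ennreal x \<partial>N) + of_nat k * (\<integral>\<^sup>+x. ennreal x \<partial>N)"
      by (intro add_left_mono Suc)
    finally show ?case by (simp add: distrib_right)
  qed
qed

text \<open>
  The law of a variable that keeps the value \<open>u\<close> drawn from \<open>Q\<close> with probability \<open>r u\<close> and is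
  0 otherwise. It is realised with an independent uniform variable that is compared with \<open>r u\<close>. Convolution
  powers of such laws with small \<open>r\<close> approximate infinitely divisible laws.
\<close>

lemma thinned_distribution_exists:
  assumes Q: "real_distribution Q" and r[measurable]: "r \<in> borel_measurable borel"
    and r01: "\<And>u. 0 \<le> r u" "\<And>u. r u \<le> 1" and nn: "AE u in Q. 0 < u"
    and bd: "\<And>u. r u * u \<le> c"
  shows "\<exists>N. nonneg_distribution N \<and>
    (\<forall>t. char N t = 1 + (CLINT u|Q. r u *\<^sub>R (iexp (t * u) - 1))) \<and>
    (\<integral>\<^sup>+x. ennreal x \<partial>N) \<le> ennreal c"
proof -
  interpret Q: real_distribution Q by fact
  define U where "U = uniform_measure lborel {0..1::real}"
  interpret U: prob_space U unfolding U_def by (rule prob_space_uniform_measure) auto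
  have [measurable_cong, simp]: "sets U = sets borel" by (simp add: U_def)
  interpret P: pair_prob_space Q U ..
  have Ur: "measure U {..r u} = r u" for u
  proof -
    have "{0..1} \<inter> {..r u} = {0..r u}" using r01[of u] by auto
    then show ?thesis unfolding U_def using r01[of u]
      by (subst measure_uniform_measure) auto
  qed
  define X where "X = (\<lambda>z. if snd z \<le> r (fst z) then fst z else (0::real))"
  have [measurable]: "X \<in> borel_measurable (Q \<Otimes>\<^sub>M U)" unfolding X_def by measurable
  define N where "N = distr (Q \<Otimes>\<^sub>M U) borel X"
  have rd: "real_distribution N" unfolding N_def by (intro P.real_distribution_distr) simp
  have "AE z in Q \<Otimes>\<^sub>M U. 0 \<le> X z"
  proof (rule P.AE_pair_measure)
    show "AE x in Q. AE y in U. 0 \<le> X (x, y)" 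
      by (rule eventually_mono[OF nn], rule AE_I2) (simp add: X_def)
  qed measurable
  then have "AE x in N. 0 \<le> x" unfolding N_def by (subst AE_distr_iff) auto
  then have "nonneg_distribution N" using nonneg_distribution_AE[OF rd] by simp
  moreover have "char N t = 1 + (CLINT u|Q. r u *\<^sub>R (iexp (t * u) - 1))" for t
  proof -
    have int: "integrable (Q \<Otimes>\<^sub>M U) (\<lambda>z. iexp (t * X z))"
      by (rule P.integrable_const_bound[where B = 1]) auto
    have inner: "(CLINT v|U. iexp (t * X (u, v))) = 1 + r u *\<^sub>R (iexp (t * u) - 1)" for u
    proof -
      have "(CLINT v|U. iexp (t * X (u, v))) = (CLINT v|U. 1 + indicator {..r u} v *\<^sub>R (iexp (t * u) - 1))"
        by (intro Bochner_Integration.integral_cong) (auto simp: X_def indicator_def)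
      also have "\<dots> = 1 + measure U {..r u} *\<^sub>R (iexp (t * u) - 1)"
      proof -
        have ii: "integrable U (indicat_real {..r u})"
          by (rule U.integrable_const_bound[where B = 1]) (auto simp: indicator_def)
        then have "integrable U (\<lambda>v. indicator {..r u} v *\<^sub>R (iexp (t * u) - 1))"
          by (intro integrable_scaleR_left) auto
        then have "(CLINT v|U. 1 + indicator {..r u} v *\<^sub>R (iexp (t * u) - 1)) =
            (CLINT v|U. 1) + (CLINT v|U. indicator {..r u} v *\<^sub>R (iexp (t * u) - 1))"
          by (intro Bochner_Integration.integral_add) auto
        also have "(CLINT v|U. indicator {..r u} v *\<^sub>R (iexp (t * u) - 1)) = (LINT v|U. indicator {..r u} v) *\<^sub>R (iexp (t * u) - 1)"
          using ii by (intro integral_scaleR_left) auto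
        finally show ?thesis using U.prob_space by simp
      qed
      finally show ?thesis by (simp add: Ur)
    qed
    have "char N t = (CLINT z|Q \<Otimes>\<^sub>M U. iexp (t * X z))"
      unfolding char_def N_def by (subst integral_distr) auto
    also have "\<dots> = (CLINT u|Q. 1 + r u *\<^sub>R (iexp (t * u) - 1))"
      using P.integral_fst'[OF int] inner by simp
    also have "\<dots> = 1 + (CLINT u|Q. r u *\<^sub>R (iexp (t * u) - 1))"
    proof (subst Bochner_Integration.integral_add)
      show "integrable Q (\<lambda>u. r u *\<^sub>R (iexp (t * u) - 1))"
      proof (rule Q.integrable_const_bound[where B = 2])
        have "norm (r u *\<^sub>R (iexp (t * u) - 1)) \<le> 1 * (1 + 1)" for u
          using r01[of u] norm_triangle_ineq4[of "iexp (t * u)" 1]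
          unfolding norm_scaleR by (intro mult_mono) auto
        then show "AE u in Q. norm (r u *\<^sub>R (iexp (t * u) - 1)) \<le> 2" by simp
      qed simp
    qed (auto simp: Q.prob_space[simplified])
    finally show ?thesis .
  qed
  moreover have "(\<integral>\<^sup>+x. ennreal x \<partial>N) \<le> ennreal c"
  proof -
    have inner: "(\<integral>\<^sup>+v. ennreal (X (u, v)) \<partial>U) \<le> ennreal c" for u
    proof -
      have "(\<integral>\<^sup>+v. ennreal (X (u, v)) \<partial>U) = (\<integral>\<^sup>+v. ennreal u * indicator {..r u} v \<partial>U)"
        by (intro nn_integral_cong) (auto simp: X_def indicator_def)
      also have "\<dots> = ennreal u * ennreal (r u)"
        by (subst nn_integral_cmult_indicator) (auto simp: U.emeasure_eq_measure Ur)
      also have "\<dots> \<le> ennreal c"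
      proof (cases "u \<ge> 0")
        case True
        then show ?thesis using bd[of u] r01[of u] by (simp add: ennreal_mult[symmetric] mult.commute ennreal_leI)
      qed (simp add: ennreal_neg)
      finally show ?thesis .
    qed
    have "(\<integral>\<^sup>+x. ennreal x \<partial>N) = (\<integral>\<^sup>+z. ennreal (X z) \<partial>(Q \<Otimes>\<^sub>M U))"
      unfolding N_def by (subst nn_integral_distr) auto
    also have "\<dots> = (\<integral>\<^sup>+u. \<integral>\<^sup>+v. ennreal (X (u, v)) \<partial>U \<partial>Q)"
      by (subst U.nn_integral_fst) auto
    also have "\<dots> \<le> (\<integral>\<^sup>+u. ennreal c \<partial>Q)" by (intro nn_integral_mono inner)
    also have "\<dots> = ennreal c" using Q.emeasure_space_1 by simp
    finally show ?thesis .
  qed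
  ultimately show ?thesis by blast
qed

lemma norm_iexp_minus_one_le: "norm (iexp x - 1) \<le> \<bar>x\<bar>"
  using iexp_approx1[of x 0] by simp

text \<open>
  Markov's inequality; the left end point -1 makes the half-open interval contain 0.
\<close>

lemma tight_of_bounded_mean:
  assumes nn: "\<And>n. nonneg_distribution (M n)" and mean: "\<And>n. (\<integral>\<^sup>+x. ennreal x \<partial>M n) \<le> ennreal I"
    and I: "I \<ge> 0"
  shows "tight M"
  unfolding tight_def
proof (intro conjI allI impI)
  have rd: "real_distribution (M n)" for n using nn[of n] by (simp add: nonneg_distribution_def)
  then show "real_distribution (M n)" for n .
  fix \<epsilon> :: real assume \<epsilon>: "\<epsilon> > 0"
  define K where "K = (I + 1) / \<epsilon>"
  have K: "K > 0" "I / K < \<epsilon>" using \<epsilon> I by (auto simp: K_def field_simps)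
  have "measure (M n) {-1<..K} > 1 - \<epsilon>" for n
  proof -
    interpret real_distribution "M n" by (rule rd)
    have "emeasure (M n) {x\<in>space (M n). 1 \<le> ennreal (1 / K) * ennreal x} \<le> ennreal (1 / K) * (\<integral>\<^sup>+x. ennreal x * indicator (space (M n)) x \<partial>M n)"
      by (rule nn_integral_Markov_inequality) auto
    also have "\<dots> \<le> ennreal (1 / K) * ennreal I"
      using mean[of n] by (intro mult_left_mono) auto
    also have "\<dots> = ennreal (I / K)" using K I by (simp add: ennreal_mult[symmetric])
    finally have 1: "emeasure (M n) {x. 1 \<le> ennreal (1 / K) * ennreal x} \<le> ennreal (I / K)" by simp
    have "{K<..} \<subseteq> {x. 1 \<le> ennreal (1 / K) * ennreal x}"
    proof
      fix x assume "x \<in> {K<..}"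
      then have "1 \<le> x / K" "x \<ge> 0" using K by auto
      then show "x \<in> {x. 1 \<le> ennreal (1 / K) * ennreal x}" using K
        by (simp add: ennreal_mult[symmetric] one_ennreal_def[symmetric] flip: ennreal_1)
    qed
    then have "emeasure (M n) {K<..} \<le> emeasure (M n) {x. 1 \<le> ennreal (1 / K) * ennreal x}"
      by (intro emeasure_mono) auto
    from order_trans[OF this 1] have "ennreal (measure (M n) {K<..}) \<le> ennreal (I / K)"
      by (simp add: emeasure_eq_measure)
    then have tail: "measure (M n) {K<..} \<le> I / K" using K I by (subst (asm) ennreal_le_iff) auto
    have neg: "measure (M n) {..<0} = 0"
      using nn[of n] by (simp add: nonneg_distribution_def measure_def)
    have "1 = measure (M n) UNIV" using prob_space by simp
    also have "\<dots> \<le> measure (M n) ({..<0} \<union> {-1<..K} \<union> {K<..})"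
      by (intro finite_measure_mono) auto
    also have "\<dots> \<le> measure (M n) {..<0} + measure (M n) {-1<..K} + measure (M n) {K<..}"
      by (intro order_trans[OF measure_Un_le] add_right_mono measure_Un_le) auto
    finally show ?thesis using neg tail K by simp
  qed
  then show "\<exists>a b. a < b \<and> (\<forall>n. 1 - \<epsilon> < measure (M n) {a<..b})"
    using K(1) by (intro exI[of _ "-1"] exI[of _ K]) auto
qed

text \<open>
  The bound by 1 is the one that characteristic functions satisfy. It forces \<open>Re (z n) \<le> 0\<close>, so both
  \<open>1 + v\<close> and \<open>exp v\<close> lie in the unit disc for \<open>v = z n / k n\<close>, and their \<open>k n\<close>-th powers differ
  by at most \<open>k n\<close> times \<open>|exp v - 1 - v|\<close>.
\<close>

lemma power_one_plus_tendsto_exp: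
  fixes z :: "nat \<Rightarrow> complex" and k :: "nat \<Rightarrow> nat"
  assumes z: "z \<longlonglongrightarrow> w" and k: "filterlim k at_top sequentially"
    and bd: "\<And>n. norm (1 + z n / of_nat (k n)) \<le> 1"
  shows "(\<lambda>n. (1 + z n / of_nat (k n)) ^ k n) \<longlonglongrightarrow> exp w"
proof -
  have kr: "filterlim (\<lambda>n. real (k n)) at_top sequentially"
    by (rule filterlim_compose[OF filterlim_real_sequentially k])
  have "norm ((1 + z n / of_nat (k n)) ^ k n - exp (z n)) \<le> exp (norm (z n)) * norm (z n) ^ 2 / real (k n)"
    if n: "k n > 0" for n
  proof -
    define v where "v = z n / of_nat (k n)"
    have Re: "Re v \<le> 0" using bd[of n] complex_Re_le_cmod[of "1 + v"] by (simp add: v_def)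
    have "norm ((1 + v) ^ k n - exp v ^ k n) \<le> k n * norm ((1 + v) - exp v)"
      using bd[of n] Re by (intro norm_power_diff) (auto simp: v_def)
    also have "norm ((1 + v) - exp v) = norm (exp v - (\<Sum>i\<le>1. v ^ i / fact i))"
      by (simp add: norm_minus_commute)
    also have "\<dots> \<le> exp \<bar>Re v\<bar> * norm v ^ Suc 1 / fact 1" by (rule Taylor_exp)
    also have "\<dots> \<le> exp (norm (z n)) * norm v ^ 2"
    proof -
      have "\<bar>Re v\<bar> \<le> norm v" by (rule abs_Re_le_cmod)
      also have "\<dots> \<le> norm (z n)" using n by (simp add: v_def norm_divide divide_le_eq mult_le_cancel_left1)
      finally show ?thesis by (simp add: power2_eq_square mult_right_mono)
    qed
    finally have "norm ((1 + v) ^ k n - exp v ^ k n) \<le> k n * (exp (norm (z n)) * norm v ^ 2)"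
      by (simp add: mult_left_mono)
    also have "\<dots> = exp (norm (z n)) * norm (z n) ^ 2 / real (k n)"
      using n by (simp add: v_def norm_divide power2_eq_square field_simps)
    also have "exp v ^ k n = exp (z n)" using n by (simp add: v_def exp_of_nat_mult[symmetric])
    finally show ?thesis by (simp add: v_def)
  qed
  then have "\<forall>\<^sub>F n in sequentially. norm ((1 + z n / of_nat (k n)) ^ k n - exp (z n)) \<le> exp (norm (z n)) * norm (z n) ^ 2 / real (k n)"
    using filterlim_at_top[THEN iffD1, OF k, rule_format, of 1] by (auto elim: eventually_mono)
  moreover have "(\<lambda>n. exp (norm (z n)) * norm (z n) ^ 2 / real (k n)) \<longlonglongrightarrow> 0"
    by (rule real_tendsto_divide_at_top[OF tendsto_mult[OF tendsto_exp[OF tendsto_norm[OF z]] tendsto_power[OF tendsto_norm[OF z]]] kr])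
  ultimately have "(\<lambda>n. (1 + z n / of_nat (k n)) ^ k n - exp (z n)) \<longlonglongrightarrow> 0"
    by (rule Lim_null_comparison)
  from tendsto_add[OF this tendsto_exp[OF z]] show ?thesis by simp
qed

text \<open>
  Infinitely divisible laws from their canonical measure \<open>u \<nu>(du)\<close>, where \<open>\<nu>\<close> is the Levy
  measure. The measure \<open>\<nu>\<close> may be infinite near 0, so it is regularised to
  \<open>Q(du) / (u + \<delta>_n)\<close>. Thinning the normalised \<open>Q\<close> accordingly gives a law with
  characteristic function \<open>1 + z_n / k_n\<close>, and its \<open>k_n\<close>-th convolution power tends to the law
  sought: the means stay below the mass of \<open>Q\<close>, so Helly's theorem provides a limit, and its
  characteristic function is \<open>lim exp z_n\<close>.
\<close>

lemma exists_distribution_of_canonical_measure: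
  assumes Q: "finite_measure Q" and sets[measurable_cong]: "sets Q = sets borel"
    and pos: "AE u in Q. 0 < u" and I: "measure Q (space Q) > 0"
  shows "\<exists>M. nonneg_distribution M \<and> (\<forall>t. char M t = exp (CLINT u|Q. (iexp (t * u) - 1) / of_real u))"
proof -
  interpret Q: finite_measure Q by fact
  define I where "I = measure Q (space Q)"
  have I0: "I > 0" using I by (simp add: I_def)
  define Q0 where "Q0 = density Q (\<lambda>_. ennreal (1 / I))"
  have rdQ0: "real_distribution Q0"
    unfolding real_distribution_def real_distribution_axioms_def
  proof
    show "prob_space Q0"
      by (rule prob_spaceI) (use I0 in \<open>simp add: Q0_def emeasure_density nn_integral_cmult Q.emeasure_eq_measure I_def ennreal_mult[symmetric]\<close>)
  qed (simp add: Q0_def sets)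
  have posQ0: "AE u in Q0. 0 < u" using pos unfolding Q0_def by (subst AE_density) auto
  define \<delta> where "\<delta> n = 1 / (real n + 1)" for n :: nat
  have \<delta>: "\<delta> n > 0" for n by (simp add: \<delta>_def)
  \<comment> \<open>Large enough for the thinning probability \<open>r n\<close> to be at most 1, and unbounded.\<close>
  define k where "k n = nat \<lceil>I * (real n + 1)\<rceil> + n + 1" for n
  have k: "real (k n) \<ge> I * (real n + 1)" "k n > 0" "k n \<ge> n" for n unfolding k_def by linarith+
  have k_top: "filterlim k at_top sequentially"
    by (rule filterlim_at_top_mono[OF filterlim_ident]) (use k(3) in auto)
  define r where "r n u = (if u > 0 then I / (real (k n) * (u + \<delta> n)) else 0)" for n u
  have r_meas: "r n \<in> borel_measurable borel" for n unfolding r_def by measurable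
  have r0: "0 \<le> r n u" for n u using I0 \<delta>[of n] by (auto simp: r_def)
  have r1: "r n u \<le> 1" for n u
  proof (cases "u > 0")
    case True
    have "I = I * (real n + 1) * \<delta> n" by (simp add: \<delta>_def)
    also have "\<dots> \<le> real (k n) * (u + \<delta> n)" using k(1)[of n] True \<delta>[of n] I0 by (intro mult_mono) auto
    finally show ?thesis using True k(2)[of n] \<delta>[of n] by (simp add: r_def divide_le_eq)
  qed (simp add: r_def)
  have ru: "r n u * u \<le> I / real (k n)" for n u
  proof (cases "u > 0")
    case True
    have "r n u * u = I / real (k n) * (u / (u + \<delta> n))" using True by (simp add: r_def)
    also have "\<dots> \<le> I / real (k n) * 1" using True I0 \<delta>[of n] by (intro mult_left_mono) auto
    finally show ?thesis by simp
  qed (use I0 in \<open>simp add: r_def\<close>)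
  obtain N where N: "\<And>n. nonneg_distribution (N n)"
    "\<And>n t. char (N n) t = 1 + (CLINT u|Q0. r n u *\<^sub>R (iexp (t * u) - 1))"
    "\<And>n. (\<integral>\<^sup>+x. ennreal x \<partial>N n) \<le> ennreal (I / real (k n))"
    using thinned_distribution_exists[OF rdQ0 r_meas r0 r1 posQ0 ru] by metis
  define M where "M n = convolution_power (N n) (k n)" for n
  have M: "nonneg_distribution (M n)" for n unfolding M_def by (rule convolution_power_props(1)[OF N(1)])
  have meanM: "(\<integral>\<^sup>+x. ennreal x \<partial>M n) \<le> ennreal I" for n
  proof -
    have "(\<integral>\<^sup>+x. ennreal x \<partial>M n) \<le> of_nat (k n) * (\<integral>\<^sup>+x. ennreal x \<partial>N n)"
      unfolding M_def by (rule convolution_power_props(3)[OF N(1)])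
    also have "\<dots> \<le> of_nat (k n) * ennreal (I / real (k n))" by (intro mult_left_mono N(3)) auto
    also have "\<dots> = ennreal I" using k(2)[of n] I0 by (simp add: ennreal_of_nat_eq_real_of_nat ennreal_mult[symmetric])
    finally show ?thesis .
  qed
  define e where "e n t u = (if u > 0 then (iexp (t * u) - 1) / of_real (u + \<delta> n) else 0)" for n t u
  have [measurable]: "e n t \<in> borel_measurable borel" for n t unfolding e_def by measurable
  define z where "z n t = (CLINT u|Q. e n t u)" for n t
  have charN: "char (N n) t = 1 + z n t / of_nat (k n)" for n t
  proof -
    have "(CLINT u|Q0. r n u *\<^sub>R (iexp (t * u) - 1)) = (CLINT u|Q. (1 / I) *\<^sub>R (r n u *\<^sub>R (iexp (t * u) - 1)))"
      unfolding Q0_def using r_meas[of n] I0 by (subst integral_density) auto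
    also have "\<dots> = (CLINT u|Q. e n t u / of_nat (k n))"
    proof (intro Bochner_Integration.integral_cong refl)
      fix u :: real
      have "1 / I * r n u = (if u > 0 then 1 / (u + \<delta> n) / real (k n) else 0)" using I0 by (simp add: r_def)
      then show "(1 / I) *\<^sub>R (r n u *\<^sub>R (iexp (t * u) - 1)) = e n t u / of_nat (k n)"
        unfolding scaleR_scaleR by (simp add: e_def scaleR_conv_of_real)
    qed
    also have "\<dots> = z n t / of_nat (k n)" by (simp add: z_def)
    finally show ?thesis by (simp add: N(2))
  qed
  have z_lim: "(\<lambda>n. z n t) \<longlonglongrightarrow> (CLINT u|Q. (iexp (t * u) - 1) / of_real u)" for t
    unfolding z_def
  proof (rule integral_dominated_convergence[where w = "\<lambda>_. \<bar>t\<bar>"])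
    have \<delta>0: "\<delta> \<longlonglongrightarrow> 0" unfolding \<delta>_def by real_asymp
    show "AE u in Q. (\<lambda>n. e n t u) \<longlonglongrightarrow> (iexp (t * u) - 1) / of_real u"
    proof (rule eventually_mono[OF pos])
      fix u :: real assume u: "0 < u"
      have "(\<lambda>n. (iexp (t * u) - 1) / of_real (u + \<delta> n)) \<longlonglongrightarrow> (iexp (t * u) - 1) / of_real (u + 0)"
        using u by (intro tendsto_intros \<delta>0) auto
      then show "(\<lambda>n. e n t u) \<longlonglongrightarrow> (iexp (t * u) - 1) / of_real u"
        using u by (simp add: e_def)
    qed
    fix n
    show "AE u in Q. norm (e n t u) \<le> \<bar>t\<bar>"
    proof (rule AE_I2)
      fix u :: real
      show "norm (e n t u) \<le> \<bar>t\<bar>"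
      proof (cases "u > 0")
        case True
        have "norm (iexp (t * u) - 1) \<le> \<bar>t\<bar> * (u + \<delta> n)"
          using norm_iexp_minus_one_le[of "t * u"] True \<delta>[of n]
          by (simp add: abs_mult) (smt (verit) abs_ge_zero mult_left_mono)
        then show ?thesis using True \<delta>[of n] by (simp add: e_def norm_divide divide_le_eq del: of_real_add)
      qed (simp add: e_def)
    qed
  qed (use \<delta> in auto)
  have charM: "(\<lambda>n. char (M n) t) \<longlonglongrightarrow> exp (CLINT u|Q. (iexp (t * u) - 1) / of_real u)" for t
  proof -
    have "norm (1 + z n t / of_nat (k n)) \<le> 1" for n
      using real_distribution.cmod_char_le_1[of "N n" t] N(1)[of n] unfolding charN[symmetric] by (simp add: nonneg_distribution_def)
    from power_one_plus_tendsto_exp[OF z_lim k_top this] show ?thesis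
      by (simp add: M_def convolution_power_props(2)[OF N(1)] charN)
  qed
  have "tight M" using M meanM I0 by (intro tight_of_bounded_mean[where I = I]) auto
  from tight_imp_convergent_subsubsequence[OF this strict_mono_id] obtain s M' where s: "strict_mono s"
    and M': "real_distribution M'" and wc: "weak_conv_m (M \<circ> id \<circ> s) M'" by blast
  have rdM: "real_distribution ((M \<circ> id \<circ> s) n)" for n using M by (simp add: nonneg_distribution_def)
  have "char M' t = exp (CLINT u|Q. (iexp (t * u) - 1) / of_real u)" for t
  proof (rule LIMSEQ_unique)
    show "(\<lambda>n. char ((M \<circ> id \<circ> s) n) t) \<longlonglongrightarrow> char M' t"
      by (rule levy_continuity1[OF rdM M' wc])
    show "(\<lambda>n. char ((M \<circ> id \<circ> s) n) t) \<longlonglongrightarrow> exp (CLINT u|Q. (iexp (t * u) - 1) / of_real u)"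
      using LIMSEQ_subseq_LIMSEQ[OF charM s] by (simp add: comp_def)
  qed
  moreover have "nonneg_distribution M'"
  proof -
    interpret M': real_distribution M' by fact
    \<comment> \<open>A bounded continuous function that vanishes exactly on \<open>[0,\<infinity>)\<close> carries nonnegativity over to
      the weak limit.\<close>
    define g where "g = (\<lambda>x::real. min 1 (max 0 (- x)))"
    have "(\<lambda>n. integral\<^sup>L ((M \<circ> id \<circ> s) n) g) \<longlonglongrightarrow> integral\<^sup>L M' g"
      using rdM M' wc by (rule weak_conv_imp_integral_bdd_continuous_conv[where B = 1])
        (auto simp: g_def intro!: continuous_intros)
    moreover have "integral\<^sup>L ((M \<circ> id \<circ> s) n) g = 0" for n
    proof -
      have "AE x in (M \<circ> id \<circ> s) n. 0 \<le> x"
        using M[of "s n"] nonneg_distribution_AE[OF rdM[of n]] by simp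
      then have "AE x in (M \<circ> id \<circ> s) n. g x = 0" by (rule eventually_mono) (simp add: g_def)
      then show ?thesis by (rule integral_eq_zero_AE)
    qed
    ultimately have 0: "integral\<^sup>L M' g = 0" by (simp add: LIMSEQ_const_iff)
    have "AE x in M'. g x = 0"
    proof (rule integral_nonneg_eq_0_iff_AE[THEN iffD1, OF _ _ 0])
      show "integrable M' g" by (rule M'.integrable_const_bound[where B = 1]) (auto simp: g_def)
    qed (simp add: g_def)
    then have "AE x in M'. 0 \<le> x" by (rule eventually_mono) (auto simp: g_def min_def max_def split: if_splits)
    then show ?thesis using nonneg_distribution_AE[OF M'] by simp
  qed
  ultimately show ?thesis by blast
qed

text \<open>
  The Levy-Khintchine exponent for the Levy density \<open>P(u)/u\<close> on the positive half-line. The factor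
  \<open>1/u\<close> is grouped with the increment of the exponential; that quotient is bounded, so integrability of \<open>P\<close> suffices.
\<close>

definition levy_exponent :: "(real \<Rightarrow> real) \<Rightarrow> real \<Rightarrow> complex" where
  "levy_exponent P t = (CLINT u:{0<..}|lborel. P u *\<^sub>R ((iexp (t * u) - 1) / of_real u))"

lemma exists_distribution_of_drift_and_density:
  fixes P :: "real \<Rightarrow> real"
  assumes P[measurable]: "P \<in> borel_measurable borel" and int: "set_integrable lborel {0<..} P"
    and nn: "\<And>u. u > 0 \<Longrightarrow> P u \<ge> 0" and T: "T \<ge> 0"
  shows "\<exists>M. nonneg_distribution M \<and>
    (\<forall>t. char M t = exp (\<i> * of_real (T * t) + levy_exponent P t))"
proof -
  define Q where "Q = density lborel (\<lambda>u. ennreal (indicator {0<..} u * P u))"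
  have sets[measurable_cong]: "sets Q = sets borel" by (simp add: Q_def)
  have iP: "integrable lborel (\<lambda>u. indicator {0<..} u * P u)" using int by (simp add: set_integrable_def)
  have nnP: "0 \<le> indicator {0<..} u * P u" for u using nn by (auto simp: indicator_def)
  have fin: "finite_measure Q"
  proof (rule finite_measureI)
    show "emeasure Q (space Q) \<noteq> \<infinity>"
      using iP nnP by (simp add: Q_def emeasure_density nn_integral_eq_integral)
  qed
  have Qint: "(CLINT u|Q. f u) = (CLINT u:{0<..}|lborel. P u *\<^sub>R f u)"
    if [measurable]: "f \<in> borel_measurable borel" for f
    unfolding Q_def set_lebesgue_integral_def using nnP
    by (subst integral_density) auto
  have pos: "AE u in Q. 0 < u"
    unfolding Q_def by (subst AE_density) (auto simp: indicator_def)
  obtain M where M: "nonneg_distribution M" "\<And>t. char M t = exp (CLINT u|Q. (iexp (t * u) - 1) / of_real u)"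
  proof (cases "measure Q (space Q) > 0")
    case True
    from exists_distribution_of_canonical_measure[OF fin sets pos True] show ?thesis using that by blast
  next
    case False
    \<comment> \<open>Without jumps the law is the point mass at 0.\<close>
    then have "measure Q (space Q) = 0" by (simp add: zero_less_measure_iff)
    then have "emeasure Q (space Q) = 0" using fin by (simp add: finite_measure.emeasure_eq_measure)
    then have "AE u in Q. False" by (subst AE_iff_measurable[where N = "space Q"]) auto
    then have "(CLINT u|Q. (iexp (t * u) - 1) / of_real u) = 0" for t
      by (intro integral_eq_zero_AE) (auto elim: eventually_mono)
    moreover have "char (return borel 0) t = 1" for t
      by (simp add: char_def integral_return)
    ultimately show ?thesis using that nonneg_distribution_return_0 by simp
  qed
  have rd: "real_distribution M" using M(1) by (simp add: nonneg_distribution_def)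
  interpret M: real_distribution M by fact
  define M' where "M' = distr M borel (\<lambda>x. x + T)"
  have rd': "real_distribution M'" unfolding M'_def by (rule M.real_distribution_distr) simp
  have ae: "AE x in M. 0 \<le> x" using M(1) nonneg_distribution_AE[OF rd] by simp
  have "AE x in M'. 0 \<le> x"
    unfolding M'_def by (subst AE_distr_iff) (use T in \<open>auto intro: eventually_mono[OF ae]\<close>)
  then have "nonneg_distribution M'" using nonneg_distribution_AE[OF rd'] by simp
  moreover have "char M' t = exp (\<i> * of_real (T * t) + levy_exponent P t)" for t
  proof -
    have "char M' t = (CLINT x|M. iexp (T * t) * iexp (t * x))"
      unfolding M'_def char_def by (subst integral_distr) (auto simp: exp_add[symmetric] algebra_simps)
    also have "\<dots> = iexp (T * t) * char M t" by (simp add: char_def)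
    finally show ?thesis by (simp add: M(2) exp_add Qint levy_exponent_def)
  qed
  ultimately show ?thesis by blast
qed

text \<open>
  The family is closed under division of drift and Levy density by \<open>n\<close>, which divides the exponent by
  \<open>n\<close>; uniqueness of characteristic functions identifies the convolution power of the root.
\<close>

lemma exists_infinitely_divisible:
  fixes P :: "real \<Rightarrow> real"
  assumes P: "P \<in> borel_measurable borel" and int: "set_integrable lborel {0<..} P"
    and nn: "\<And>u. u > 0 \<Longrightarrow> P u \<ge> 0" and T: "T \<ge> 0"
  shows "\<exists>M. infinitely_divisible M \<and>
    (\<forall>t. char M t = exp (\<i> * of_real (T * t) + levy_exponent P t))"
proof -
  obtain M where M: "nonneg_distribution M"
    "\<And>t. char M t = exp (\<i> * of_real (T * t) + levy_exponent P t)"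
    using exists_distribution_of_drift_and_density[OF assms] by blast
  have "\<exists>N. nonneg_distribution N \<and> convolution_power N n = M" if n: "n \<ge> 1" for n :: nat
  proof -
    have P': "(\<lambda>u. P u / n) \<in> borel_measurable borel" using P by simp
    have int': "set_integrable lborel {0<..} (\<lambda>u. P u / n)" using int by simp
    obtain N where N: "nonneg_distribution N"
      "\<And>t. char N t = exp (\<i> * of_real (T / n * t) + levy_exponent (\<lambda>u. P u / n) t)"
      using exists_distribution_of_drift_and_density[OF P' int', of "T / n"] nn T by auto
    have "char (convolution_power N n) = char M"
    proof
      fix t
      have "levy_exponent (\<lambda>u. P u / n) t = (CLINT u:{0<..}|lborel. (1 / real n) *\<^sub>R (P u *\<^sub>R ((iexp (t * u) - 1) / of_real u)))"
        by (simp add: levy_exponent_def divide_inverse mult.commute)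
      also have "\<dots> = levy_exponent P t / of_nat n"
        unfolding set_integral_scaleR_right by (simp add: levy_exponent_def scaleR_conv_of_real divide_inverse)
      finally have "\<i> * of_real (T / n * t) + levy_exponent (\<lambda>u. P u / n) t = (\<i> * of_real (T * t) + levy_exponent P t) / of_nat n"
        by (simp add: add_divide_distrib)
      then have "char N t = exp ((\<i> * of_real (T * t) + levy_exponent P t) / of_nat n)"
        unfolding N(2) by simp
      then show "char (convolution_power N n) t = char M t"
        using n by (simp add: convolution_power_props(2)[OF N(1)] M(2) exp_of_nat_mult[symmetric])
    qed
    then have "convolution_power N n = M"
      using convolution_power_props(1)[OF N(1)] M(1) by (intro Levy_uniqueness) (auto simp: nonneg_distribution_def)
    with N(1) show ?thesis by blast
  qed
  then have "infinitely_divisible M" using M(1) by (simp add: infinitely_divisible_def)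
  with M(2) show ?thesis by blast
qed

text \<open>
  Differentiation under the integral sign. The error of the difference quotient is dominated by
  \<open>P u * min 2 (|h| u)\<close>, which is integrable and tends to zero pointwise.
\<close>

lemma levy_exponent_has_vector_derivative:
  fixes P :: "real \<Rightarrow> real"
  assumes P[measurable]: "P \<in> borel_measurable borel" and int: "set_integrable lborel {0<..} P"
    and nn: "\<And>u. u > 0 \<Longrightarrow> P u \<ge> 0"
  shows "(levy_exponent P has_vector_derivative
      \<i> * (CLINT u:{0<..}|lborel. P u *\<^sub>R iexp (t * u))) (at t)"
proof -
  define f where "f t u = P u *\<^sub>R ((iexp (t * u) - 1) / of_real u)" for t u
  define g where "g u = P u *\<^sub>R iexp (t * u)" for u
  define J where "J t = (CLINT u:{0<..}|lborel. f t u)" for t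
  define K where "K = (CLINT u:{0<..}|lborel. g u)"
  define m where "m h u = P u * min 2 (\<bar>h\<bar> * u)" for h u
  have f_int: "set_integrable lborel {0<..} (f t)" for t
  proof (rule set_integrable_bound[OF set_integrable_mult_right[OF int, of "\<bar>t\<bar>"]])
    show "set_borel_measurable lborel {0<..} (f t)" by (auto simp: set_borel_measurable_def f_def)
    show "AE u in lborel. u \<in> {0<..} \<longrightarrow> norm (f t u) \<le> norm (\<bar>t\<bar> * P u)"
    proof (intro AE_I2 impI)
      fix u :: real assume u: "u \<in> {0<..}"
      then have "norm ((iexp (t * u) - 1) / of_real u) \<le> \<bar>t\<bar>"
        using norm_iexp_minus_one_le[of "t * u"] by (simp add: norm_divide divide_le_eq abs_mult)
      then show "norm (f t u) \<le> norm (\<bar>t\<bar> * P u)"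
        by (simp add: f_def abs_mult mult.commute[of "\<bar>P u\<bar>"] mult_right_mono del: of_real_mult)
    qed
  qed
  have g_int: "set_integrable lborel {0<..} g"
    by (rule set_integrable_bound[OF int]) (auto simp: set_borel_measurable_def g_def)
  have m_int: "set_integrable lborel {0<..} (m h)" for h
    by (rule set_integrable_bound[OF set_integrable_mult_right[OF int, of 2]])
       (auto simp: set_borel_measurable_def m_def abs_mult mult.commute[of "\<bar>P _\<bar>"] intro!: AE_I2 mult_right_mono)
  have pt: "norm (f (t + h) u - f t u - (of_real h * \<i>) * g u) \<le> \<bar>h\<bar> * m h u" if u: "u > 0" for h u
  proof -
    define x where "x = h * u"
    have eq: "f (t + h) u - f t u - (of_real h * \<i>) * g u = P u *\<^sub>R (iexp (t * u) * (iexp x - 1 - \<i> * of_real x) / of_real u)"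
      using u by (simp add: f_def g_def x_def scaleR_conv_of_real distrib_left distrib_right exp_add divide_simps) (simp add: algebra_simps)
    have sum: "(\<Sum>k\<le>1. (\<i> * complex_of_real x) ^ k / fact k) = 1 + \<i> * of_real x" by simp
    let ?r = "norm (iexp x - 1 - \<i> * of_real x)"
    have "?r \<le> x ^ 2 / 2"
      using iexp_approx1[of x 1] unfolding sum by (simp add: diff_diff_eq power2_eq_square abs_mult_self_eq)
    moreover have "?r \<le> 2 * \<bar>x\<bar>"
      using iexp_approx2[of x 1] unfolding sum by (simp add: diff_diff_eq)
    moreover have "x ^ 2 / 2 \<le> x ^ 2" by simp
    ultimately have "?r \<le> x ^ 2" "?r \<le> 2 * \<bar>x\<bar>"
      by linarith+
    then have "?r \<le> \<bar>x\<bar> * min 2 \<bar>x\<bar>"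
      by (simp add: min_def power2_eq_square abs_mult_self_eq mult.commute)
    also have "\<dots> = \<bar>h\<bar> * min 2 (\<bar>h\<bar> * u) * u" using u by (simp add: x_def abs_mult)
    finally have le: "?r \<le> \<bar>h\<bar> * min 2 (\<bar>h\<bar> * u) * u" .
    have "norm (f (t + h) u - f t u - (of_real h * \<i>) * g u) = P u * (?r / u)"
      unfolding eq using u nn[OF u] by (simp add: norm_divide norm_mult del: of_real_mult)
    also have "\<dots> \<le> P u * (\<bar>h\<bar> * min 2 (\<bar>h\<bar> * u))"
      using u nn[OF u] le by (intro mult_left_mono) (simp_all add: pos_divide_le_eq)
    finally show ?thesis by (simp add: m_def mult_ac)
  qed
  have le: "norm (J (t + h) - J t - h *\<^sub>R (\<i> * K)) / norm h \<le> (LINT u:{0<..}|lborel. m h u)" for h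
  proof (cases "h = 0")
    case False
    have "J (t + h) - J t - h *\<^sub>R (\<i> * K) = (CLINT u:{0<..}|lborel. f (t + h) u - f t u - (of_real h * \<i>) * g u)"
      unfolding J_def K_def using f_int g_int by (simp add: scaleR_conv_of_real mult.assoc)
    also have "norm \<dots> \<le> (LINT u:{0<..}|lborel. norm (f (t + h) u - f t u - (of_real h * \<i>) * g u))"
      using f_int g_int by (intro set_integral_norm_bound) auto
    also have "\<dots> \<le> (LINT u:{0<..}|lborel. \<bar>h\<bar> * m h u)"
    proof (rule set_integral_mono)
      show "set_integrable lborel {0<..} (\<lambda>u. norm (f (t + h) u - f t u - (of_real h * \<i>) * g u))"
        using f_int g_int by (intro set_integrable_norm) auto
    qed (use pt m_int in auto)
    also have "\<dots> = \<bar>h\<bar> * (LINT u:{0<..}|lborel. m h u)" by simp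
    finally show ?thesis using False by (simp add: divide_le_eq mult.commute)
  qed (simp add: m_def)
  have lim: "((\<lambda>h. LINT u:{0<..}|lborel. m h u) \<longlongrightarrow> 0) (at 0)"
    unfolding tendsto_at_iff_sequentially comp_def
  proof (intro allI impI)
    fix X :: "nat \<Rightarrow> real" assume X: "X \<longlonglongrightarrow> 0"
    have "(\<lambda>n. LINT u|lborel. indicator {0<..} u *\<^sub>R m (X n) u) \<longlonglongrightarrow> (LINT u|(lborel :: real measure). 0)"
    proof (rule integral_dominated_convergence[where w = "\<lambda>u. indicator {0<..} u *\<^sub>R (2 * P u)"])
      show "integrable lborel (\<lambda>u. indicator {0<..} u *\<^sub>R (2 * P u))"
        using set_integrable_mult_right[OF int, of 2] by (simp add: set_integrable_def)
      show "AE u in lborel. (\<lambda>n. indicator {0<..} u *\<^sub>R m (X n) u) \<longlonglongrightarrow> 0"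
      proof (rule AE_I2)
        fix u :: real
        have "(\<lambda>n. indicator {0<..} u *\<^sub>R (P u * min 2 (\<bar>X n\<bar> * u))) \<longlonglongrightarrow> indicator {0<..} u *\<^sub>R (P u * min 2 (\<bar>0\<bar> * u))"
          by (intro tendsto_intros X)
        then show "(\<lambda>n. indicator {0<..} u *\<^sub>R m (X n) u) \<longlonglongrightarrow> 0" by (simp add: m_def)
      qed
      show "AE u in lborel. norm (indicator {0<..} u *\<^sub>R m (X n) u) \<le> indicator {0<..} u *\<^sub>R (2 * P u)" for n
        using nn by (intro AE_I2) (auto simp: m_def abs_mult indicator_def mult.commute[of "P _"] intro!: mult_right_mono)
    qed (auto simp: m_def)
    then show "(\<lambda>n. LINT u:{0<..}|lborel. m (X n) u) \<longlonglongrightarrow> 0" by (simp add: set_lebesgue_integral_def)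
  qed
  have "(J has_vector_derivative \<i> * K) (at t)"
    unfolding has_vector_derivative_def has_derivative_at
  proof (intro conjI bounded_linear_scaleR_left tendsto_sandwich[OF _ _ tendsto_const lim])
    show "\<forall>\<^sub>F h in at 0. norm (J (t + h) - J t - h *\<^sub>R (\<i> * K)) / norm h \<le> (LINT u:{0<..}|lborel. m h u)"
      using le by simp
  qed simp
  then show ?thesis unfolding J_def[abs_def] K_def f_def g_def levy_exponent_def[abs_def] .
qed

section \<open>Levy inversion for slowly decaying characteristic functions\<close>

lemma integrable_of_power_decay:
  fixes f :: "real \<Rightarrow> 'a::{banach, second_countable_topology}"
  assumes f[measurable]: "f \<in> borel_measurable borel" and Y: "Y > 0" and e: "\<epsilon> > 0"
    and bd: "\<And>y. \<bar>y\<bar> \<le> Y \<Longrightarrow> norm (f y) \<le> D"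
    and decay: "\<And>y. \<bar>y\<bar> \<ge> Y \<Longrightarrow> norm (f y) \<le> C * \<bar>y\<bar> powr (- 1 - \<epsilon>)"
  shows "integrable lborel f"
proof -
  define h where "h y = indicator {Y..} y * y powr (- 1 - \<epsilon>)" for y :: real
  have h_nn: "h y \<ge> 0" for y by (simp add: h_def)
  have [measurable]: "h \<in> borel_measurable borel" unfolding h_def by measurable
  have h_int: "integrable lborel h"
  proof (rule integrableI_nn_integral_finite)
    have "((\<lambda>x. x powr (- 1 - \<epsilon>)) has_integral - (Y powr (- 1 - \<epsilon> + 1)) / (- 1 - \<epsilon> + 1)) {Y..}"
      using e Y by (intro has_integral_powr_to_inf) auto
    from nn_integral_has_integral_lebesgue[OF _ this]
    show "(\<integral>\<^sup>+ y. ennreal (h y) \<partial>lborel) = ennreal (- (Y powr (- 1 - \<epsilon> + 1)) / (- 1 - \<epsilon> + 1))"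
      by (simp add: h_def)
  qed (use h_nn in auto)
  have h_int': "integrable lborel (\<lambda>y. h (- y))"
    using lborel_integrable_real_affine[OF h_int, of "-1" 0] by simp
  have i: "integrable lborel (\<lambda>y. \<bar>D\<bar> * indicator {- Y..Y} y + C * h y + C * h (- y))"
    using h_int h_int' by (intro Bochner_Integration.integrable_add integrable_mult_right integrable_real_indicator) (auto simp: emeasure_lborel_Icc_eq)
  have C: "C \<ge> 0"
  proof -
    have "0 \<le> C * \<bar>Y\<bar> powr (- 1 - \<epsilon>)" using decay[of Y] Y norm_ge_zero[of "f Y"] by linarith
    then show ?thesis using Y by (simp add: zero_le_mult_iff)
  qed
  show ?thesis
  proof (rule Bochner_Integration.integrable_bound[OF i])
    show "AE y in lborel. norm (f y) \<le> norm (\<bar>D\<bar> * indicator {- Y..Y} y + C * h y + C * h (- y))"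
    proof (rule AE_I2)
      fix y :: real
      have "norm (f y) \<le> \<bar>D\<bar> * indicator {- Y..Y} y + C * h y + C * h (- y)"
      proof (cases "\<bar>y\<bar> \<le> Y")
        case True
        then have "norm (f y) \<le> \<bar>D\<bar>" "y \<in> {- Y..Y}" using bd[OF True] by auto
        then show ?thesis using C h_nn[of y] h_nn[of "- y"] by (simp add: add_increasing2)
      next
        case False
        then show ?thesis using decay[of y] Y by (cases "y \<ge> 0") (auto simp: h_def)
      qed
      then show "norm (f y) \<le> norm (\<bar>D\<bar> * indicator {- Y..Y} y + C * h y + C * h (- y))" by simp
    qed
  qed simp
qed

text \<open>
  The kernel of Levy's inversion formula. Its value at \<open>t = 0\<close> is 0 by division by zero, rather
  than the limit \<open>b - a\<close>.
\<close>

definition Levy_kernel :: "real \<Rightarrow> real \<Rightarrow> real \<Rightarrow> complex" where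
  "Levy_kernel a b t = (iexp (-(t * a)) - iexp (-(t * b))) / (\<i> * t)"

lemma Levy_kernel_measurable [measurable]: "Levy_kernel a b \<in> borel_measurable borel"
  unfolding Levy_kernel_def by measurable

lemma norm_Levy_kernel_le:
  fixes a b t :: real
  assumes "a \<le> b"
  shows "norm (Levy_kernel a b t) \<le> min (b - a) (2 / \<bar>t\<bar>)"
proof (cases "t = 0")
  case False
  have "norm (iexp (-(t * a)) - iexp (-(t * b))) \<le> 1 + 1"
    using norm_triangle_ineq4[of "iexp (-(t * a))" "iexp (-(t * b))"] by simp
  then have "norm (Levy_kernel a b t) \<le> 2 / \<bar>t\<bar>"
    by (simp add: Levy_kernel_def norm_divide norm_mult divide_right_mono)
  moreover have "norm (Levy_kernel a b t) \<le> b - a"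
    using Levy_Inversion_aux2[of "- b" "- a" t] assms False by (simp add: Levy_kernel_def)
  ultimately show ?thesis by simp
qed (use assms in \<open>auto simp: Levy_kernel_def\<close>)

lemma Levy_kernel_eq_integral:
  fixes a b t :: real
  assumes "a \<le> b" "t \<noteq> 0"
  shows "Levy_kernel a b t = (CLINT x:{a..b}|lborel. iexp (-(t * x)))"
proof -
  have eq: "iexp (-(t * x)) = exp (- (\<i> * t) * of_real x)" for x by (simp add: mult.assoc)
  have "has_bochner_integral lborel (\<lambda>x. indicator {a..b} x *\<^sub>R iexp (-(t * x)))
      (- iexp (-(t * b)) / (\<i> * t) - (- iexp (-(t * a)) / (\<i> * t)))"
  proof (rule has_bochner_integral_FTC_Icc[OF assms(1)])
    show "((\<lambda>x. - iexp (-(t * x)) / (\<i> * t)) has_vector_derivative iexp (-(t * x))) (at x within {a..b})" for x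
      unfolding eq by (rule has_vector_derivative_real_field)
         (use assms(2) in \<open>auto intro!: derivative_eq_intros\<close>)
    show "continuous_on {a..b} (\<lambda>x. iexp (-(t * x)))" by (intro continuous_intros)
  qed
  then show ?thesis unfolding set_lebesgue_integral_def Levy_kernel_def
    by (subst has_bochner_integral_integral_eq) (auto simp: diff_divide_distrib)
qed

definition Levy_integral :: "real measure \<Rightarrow> real \<Rightarrow> real \<Rightarrow> nat \<Rightarrow> complex" where
  "Levy_integral M a b n = (CLINT t:{- real n<..<real n}|lborel. Levy_kernel a b t * char M t)"

definition char_inversion :: "real measure \<Rightarrow> nat \<Rightarrow> real \<Rightarrow> complex" where
  "char_inversion M n x = (CLINT y:{- real n<..<real n}|lborel. iexp (-(y * x)) * char M y)"

context real_distribution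
begin

lemma Levy_Inversion_Ioo:
  assumes "a \<le> b" "prob {a} = 0" "prob {b} = 0"
  shows "(\<lambda>n. 1 / (2 * pi) * Levy_integral M a b n)
    \<longlonglongrightarrow> of_real (prob {a<..b})"
  using Levy_Inversion[OF assms]
  by (simp add: interval_lebesgue_integral_def set_lebesgue_integral_def Levy_integral_def Levy_kernel_def)

text \<open>
  The inversion formula bounds the probability of a short interval by
  \<open>\<integral> |char M y| min \<delta> (2/|y|) dy / (2 \<pi>)\<close>. The integrand is dominated by its value for \<open>\<delta> = 1\<close>,
  which decays like \<open>|y|^(-1-\<mu>)\<close>, so the bound tends to zero with \<open>\<delta>\<close>.
\<close>

lemma no_atoms_of_char_decay:
  assumes mu: "\<mu> > 0" and Y: "Y > 0"
    and decay: "\<And>y. \<bar>y\<bar> \<ge> Y \<Longrightarrow> norm (char M y) \<le> C * \<bar>y\<bar> powr (- \<mu>)"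
  shows "prob {x} = 0"
proof -
  define m where "m \<delta> y = norm (char M y) * min \<delta> (2 / \<bar>y\<bar>)" for \<delta> y
  have m_meas [measurable]: "m \<delta> \<in> borel_measurable borel" for \<delta> unfolding m_def by measurable
  have m_nn: "m \<delta> y \<ge> 0" if "\<delta> \<ge> 0" for \<delta> y using that by (simp add: m_def)
  have m1_int: "integrable lborel (m 1)"
  proof (rule integrable_of_power_decay[where Y = Y and \<epsilon> = \<mu> and D = 1 and C = "2 * C"])
    fix y :: real
    have "norm (char M y) * min 1 (2 / \<bar>y\<bar>) \<le> 1 * 1"
      by (intro mult_mono cmod_char_le_1) auto
    then show "norm (m 1 y) \<le> 1" by (simp add: m_def)
    assume y: "\<bar>y\<bar> \<ge> Y"
    have "norm (char M y) * min 1 (2 / \<bar>y\<bar>) \<le> (C * \<bar>y\<bar> powr (- \<mu>)) * (2 / \<bar>y\<bar>)"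
      using decay[OF y] by (intro mult_mono) (auto intro: order_trans[OF norm_ge_zero])
    also have "\<dots> = 2 * C * \<bar>y\<bar> powr (- 1 - \<mu>)"
      using y Y by (simp add: powr_diff powr_minus divide_inverse mult_ac)
    finally show "norm (m 1 y) \<le> 2 * C * \<bar>y\<bar> powr (- 1 - \<mu>)" by (simp add: m_def)
  qed (use mu Y in auto)
  have m_int: "integrable lborel (m \<delta>)" if "0 \<le> \<delta>" "\<delta> \<le> 1" for \<delta>
    by (rule Bochner_Integration.integrable_bound[OF m1_int])
       (use that in \<open>auto simp: m_def intro!: AE_I2 mult_left_mono\<close>)
  have bound: "prob {u<..v} \<le> 1 / (2 * pi) * (LINT y|lborel. m \<delta> y)"
    if uv: "u < v" "v - u \<le> \<delta>" "\<delta> \<le> 1" and at: "prob {u} = 0" "prob {v} = 0" for u v \<delta>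
  proof -
    have le: "norm (1 / (2 * pi) * Levy_integral M u v n)
       \<le> 1 / (2 * pi) * (LINT y|lborel. m \<delta> y)" for n
    proof -
      have pt: "norm (Levy_kernel u v t * char M t) \<le> m \<delta> t" for t
      proof -
        have "norm (Levy_kernel u v t) \<le> min \<delta> (2 / \<bar>t\<bar>)"
          using norm_Levy_kernel_le[of u v t] uv by linarith
        then show ?thesis unfolding m_def norm_mult by (subst mult.commute, intro mult_left_mono) auto
      qed
      have "norm (Levy_integral M u v n)
          \<le> (LINT t|lborel. norm (indicator {- real n<..<real n} t *\<^sub>R (Levy_kernel u v t * char M t)))"
        unfolding Levy_integral_def set_lebesgue_integral_def by (rule integral_norm_bound)
      also have "\<dots> \<le> (LINT y|lborel. m \<delta> y)"
      proof (rule integral_mono')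
        show "integrable lborel (m \<delta>)" using m_int uv by simp
        fix t :: real
        show "0 \<le> m \<delta> t" using m_nn uv by simp
        show "norm (indicator {- real n<..<real n} t *\<^sub>R (Levy_kernel u v t * char M t)) \<le> m \<delta> t"
          using pt[of t] m_nn[of \<delta> t] uv by (simp add: indicator_def del: of_real_minus of_real_mult)
      qed
      finally have "1 / (2 * pi) * norm (Levy_integral M u v n)
         \<le> 1 / (2 * pi) * (LINT y|lborel. m \<delta> y)" by (intro mult_left_mono) auto
      then show ?thesis by (simp add: norm_mult norm_divide)
    qed
    have "norm (complex_of_real (prob {u<..v})) \<le> 1 / (2 * pi) * (LINT y|lborel. m \<delta> y)"
      by (rule tendsto_upperbound[OF tendsto_norm[OF Levy_Inversion_Ioo[of u v]]]) (use uv at le in auto)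
    then show ?thesis by simp
  qed
  define \<delta> where "\<delta> k = 1 / (real k + 1)" for k
  have \<delta>: "0 < \<delta> k" "\<delta> k \<le> 1" for k by (auto simp: \<delta>_def)
  have "(\<lambda>k. LINT y|lborel. m (\<delta> k) y) \<longlonglongrightarrow> (LINT y|(lborel :: real measure). 0)"
  proof (rule integral_dominated_convergence[where w = "m 1"])
    have "(\<lambda>k. min (\<delta> k) (2 / \<bar>y\<bar>)) \<longlonglongrightarrow> min 0 (2 / \<bar>y\<bar>)" for y :: real
    proof -
      have "\<delta> \<longlonglongrightarrow> 0" unfolding \<delta>_def by real_asymp
      then show ?thesis by (intro tendsto_min tendsto_const)
    qed
    then have "(\<lambda>k. m (\<delta> k) y) \<longlonglongrightarrow> norm (char M y) * min 0 (2 / \<bar>y\<bar>)" for y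
      unfolding m_def by (intro tendsto_mult tendsto_const)
    then show "AE y in lborel. (\<lambda>k. m (\<delta> k) y) \<longlonglongrightarrow> 0" by (intro AE_I2) (simp add: min_def)
    show "AE y in lborel. norm (m (\<delta> k) y) \<le> m 1 y" for k
      using \<delta>[of k] by (auto simp: m_def abs_mult less_imp_le intro!: AE_I2 mult_left_mono)
  qed (use m1_int in auto)
  then have lim: "(\<lambda>k. 1 / (2 * pi) * (LINT y|lborel. m (\<delta> k) y)) \<longlonglongrightarrow> 1 / (2 * pi) * 0"
    by (intro tendsto_mult tendsto_const) simp
  have "prob {x} \<le> 1 / (2 * pi) * (LINT y|lborel. m (\<delta> k) y)" for k
  proof -
    \<comment> \<open>The inversion formula requires end points that are not atoms; only countably many are excluded.\<close>
    obtain u where u: "u \<in> {x - \<delta> k / 2<..<x}" "prob {u} = 0"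
      using open_minus_countable[OF countable_support, of "{x - \<delta> k / 2<..<x}"] \<delta>[of k] by auto
    obtain v where v: "v \<in> {x<..<x + \<delta> k / 2}" "prob {v} = 0"
      using open_minus_countable[OF countable_support, of "{x<..<x + \<delta> k / 2}"] \<delta>[of k] by auto
    have "prob {x} \<le> prob {u<..v}" using u v by (intro finite_measure_mono) auto
    also have "\<dots> \<le> 1 / (2 * pi) * (LINT y|lborel. m (\<delta> k) y)"
      using u v \<delta>[of k] by (intro bound) auto
    finally show ?thesis .
  qed
  then have "prob {x} \<le> 1 / (2 * pi) * 0" by (intro tendsto_lowerbound[OF lim]) auto
  then show ?thesis using measure_nonneg[of M "{x}"] by simp
qed

text \<open>
  The kernel of the inversion formula is the integral of \<open>e^(-itx)\<close> over the interval. Fubini's theorem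
  turns the formula into an integral of truncated inversion integrals, and dominated convergence passes to
  the limit.
\<close>

lemma prob_Ioc_eq_integral_of_inversion:
  fixes l :: "real \<Rightarrow> complex"
  assumes ab: "a \<le> b" and atoms: "\<And>x. prob {x} = 0"
    and l_meas: "set_borel_measurable lborel {a..b} l"
    and lim: "\<And>x. x \<in> {a..b} \<Longrightarrow> (\<lambda>n. 1 / (2 * pi) * char_inversion M n x) \<longlonglongrightarrow> l x"
    and bd: "\<And>x n. x \<in> {a..b} \<Longrightarrow> norm (char_inversion M n x) \<le> D"
  shows "of_real (prob {a<..b}) = (CLINT x:{a..b}|lborel. l x)"
proof -
  have D: "D \<ge> 0" using order_trans[OF norm_ge_zero bd[of a 0]] ab by auto
  have swap: "Levy_integral M a b n
     = (CLINT x:{a..b}|lborel. char_inversion M n x)"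
    and inversion_meas: "(\<lambda>x. indicator {a..b} x *\<^sub>R char_inversion M n x) \<in> borel_measurable lborel" for n
  proof -
    define f where "f x t = indicator {a..b} x *\<^sub>R (indicator {- real n<..<real n} t *\<^sub>R (iexp (-(t * x)) * char M t))" for x t
    have f_meas: "case_prod f \<in> borel_measurable (lborel \<Otimes>\<^sub>M lborel)"
      unfolding f_def by measurable
    have f_int: "integrable (lborel \<Otimes>\<^sub>M lborel) (case_prod f)"
    proof (rule integrableI_bounded_set[where A = "{a..b} \<times> {- real n<..<real n}" and B = 1])
      show "emeasure (lborel \<Otimes>\<^sub>M lborel) ({a..b} \<times> {- real n<..<real n}) < \<infinity>"
        using ab by (subst lborel.emeasure_pair_measure_Times) (auto simp: ennreal_mult_less_top)
      show "AE z in lborel \<Otimes>\<^sub>M lborel. z \<in> {a..b} \<times> {- real n<..<real n} \<longrightarrow> norm (case_prod f z) \<le> 1"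
        using cmod_char_le_1 by (intro AE_I2) (auto simp: f_def norm_mult)
      show "AE z in lborel \<Otimes>\<^sub>M lborel. z \<notin> {a..b} \<times> {- real n<..<real n} \<longrightarrow> case_prod f z = 0"
        by (intro AE_I2) (auto simp: f_def indicator_def)
    qed (use f_meas in auto)
    have fx: "(CLINT t|lborel. f x t) = indicator {a..b} x *\<^sub>R char_inversion M n x" for x
      unfolding f_def char_inversion_def set_lebesgue_integral_def by (rule integral_scaleR_right)
    have "(\<lambda>x. CLINT t|lborel. f x t) \<in> borel_measurable lborel"
      using f_meas by (rule lborel.borel_measurable_lebesgue_integral)
    then show "(\<lambda>x. indicator {a..b} x *\<^sub>R char_inversion M n x) \<in> borel_measurable lborel" unfolding fx .
    have ft: "(CLINT x|lborel. f x t) = indicator {- real n<..<real n} t *\<^sub>R (Levy_kernel a b t * char M t)"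
      if "t \<noteq> 0" for t
    proof -
      have "(CLINT x|lborel. f x t) = (CLINT x|lborel. (indicator {a..b} x *\<^sub>R iexp (-(t * x))) * (indicator {- real n<..<real n} t *\<^sub>R char M t))"
        by (simp add: f_def mult_ac)
      also have "\<dots> = (CLINT x:{a..b}|lborel. iexp (-(t * x))) * (indicator {- real n<..<real n} t *\<^sub>R char M t)"
        unfolding set_lebesgue_integral_def by (rule integral_mult_left_zero)
      finally show ?thesis unfolding Levy_kernel_eq_integral[OF ab that] by simp
    qed
    have "(CLINT t|lborel. CLINT x|lborel. f x t) = (CLINT x|lborel. CLINT t|lborel. f x t)"
      by (rule lborel_pair.Fubini_integral[OF f_int])
    moreover have "(CLINT t|lborel. CLINT x|lborel. f x t) =
       Levy_integral M a b n"
      unfolding Levy_integral_def set_lebesgue_integral_def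
    proof (rule integral_cong_AE)
      have "AE t in lborel. t \<noteq> (0::real)" by (rule AE_lborel_singleton)
      then show "AE t in lborel. (CLINT x|lborel. f x t) = indicator {- real n<..<real n} t *\<^sub>R (Levy_kernel a b t * char M t)"
        by (rule eventually_mono) (rule ft)
      have "case_prod (\<lambda>t x. f x t) \<in> borel_measurable (lborel \<Otimes>\<^sub>M lborel)" unfolding f_def by measurable
      then show "(\<lambda>t. CLINT x|lborel. f x t) \<in> borel_measurable lborel"
        by (rule lborel.borel_measurable_lebesgue_integral)
    qed measurable
    ultimately show "Levy_integral M a b n
     = (CLINT x:{a..b}|lborel. char_inversion M n x)" unfolding fx set_lebesgue_integral_def by simp
  qed
  have "(\<lambda>n. CLINT x|lborel. indicator {a..b} x *\<^sub>R (1 / (2 * pi) * char_inversion M n x)) \<longlonglongrightarrow> (CLINT x|lborel. indicator {a..b} x *\<^sub>R l x)"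
  proof (rule integral_dominated_convergence[where w = "\<lambda>x. indicator {a..b} x *\<^sub>R (1 / (2 * pi) * D)"])
    show "AE x in lborel. (\<lambda>n. indicator {a..b} x *\<^sub>R (1 / (2 * pi) * char_inversion M n x)) \<longlonglongrightarrow> indicator {a..b} x *\<^sub>R l x"
      using lim by (intro AE_I2) (auto simp: indicator_def)
    show "AE x in lborel. norm (indicator {a..b} x *\<^sub>R (1 / (2 * pi) * char_inversion M n x)) \<le> indicator {a..b} x *\<^sub>R (1 / (2 * pi) * D)" for n
      using bd by (intro AE_I2) (auto simp: indicator_def norm_mult norm_divide intro!: divide_right_mono)
    show "(\<lambda>x. indicator {a..b} x *\<^sub>R (1 / (2 * pi) * char_inversion M n x)) \<in> borel_measurable lborel" for n
      using borel_measurable_times[OF borel_measurable_const[of "1 / (2 * pi) :: complex"] inversion_meas[of n]]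
      by (simp add: scaleR_conv_of_real mult_ac)
    show "integrable lborel (\<lambda>x. indicator {a..b} x *\<^sub>R (1 / (2 * pi) * D))"
      by (intro integrable_scaleR_left integrable_real_indicator) (auto simp: emeasure_lborel_Icc_eq)
  qed (use l_meas in \<open>auto simp: set_borel_measurable_def\<close>)
  moreover have "(CLINT x|lborel. indicator {a..b} x *\<^sub>R (1 / (2 * pi) * char_inversion M n x)) =
      1 / (2 * pi) * Levy_integral M a b n" for n
  proof -
    have "(CLINT x|lborel. indicator {a..b} x *\<^sub>R (1 / (2 * pi) * char_inversion M n x)) = (CLINT x|lborel. 1 / (2 * pi) * (indicator {a..b} x *\<^sub>R char_inversion M n x))"
      by (intro Bochner_Integration.integral_cong) (simp_all add: scaleR_conv_of_real mult_ac)
    also have "\<dots> = 1 / (2 * pi) * (CLINT x:{a..b}|lborel. char_inversion M n x)"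
      unfolding set_lebesgue_integral_def by (rule integral_mult_right_zero)
    finally show ?thesis unfolding swap .
  qed
  ultimately have "(\<lambda>n. 1 / (2 * pi) * Levy_integral M a b n)
     \<longlonglongrightarrow> (CLINT x:{a..b}|lborel. l x)" by (simp add: set_lebesgue_integral_def)
  from LIMSEQ_unique[OF Levy_Inversion_Ioo[OF ab atoms atoms] this] show ?thesis .
qed

text \<open>
  The exceptional point \<open>T\<close> is where the inversion integral may diverge. Away from it the distribution
  function has the derivative \<open>l\<close>. Its derivative as a complex-valued function is real since the function
  is real, and nonnegative by monotonicity. At \<open>T\<close> continuity of the distribution function suffices for
  the fundamental theorem of calculus.
\<close>

lemma density_of_inversion:
  fixes l :: "real \<Rightarrow> complex"
  assumes atoms: "\<And>x. prob {x} = 0" and cont: "continuous_on (- {T}) l"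
    and lim: "\<And>x. x \<noteq> T \<Longrightarrow> (\<lambda>n. 1 / (2 * pi) * char_inversion M n x) \<longlonglongrightarrow> l x"
    and bd: "\<And>x n. x \<noteq> T \<Longrightarrow> norm (char_inversion M n x) \<le> K / \<bar>x - T\<bar>"
  shows "\<And>x. x \<noteq> T \<Longrightarrow> Im (l x) = 0 \<and> Re (l x) \<ge> 0"
    and "(\<lambda>x. if x = T then 0 else Re (l x)) \<in> borel_measurable borel"
    and "M = density lborel (\<lambda>x. ennreal (if x = T then 0 else Re (l x)))"
proof -
  have K: "K \<ge> 0" using bd[of "T + 1" 0] norm_ge_zero[of "char_inversion M 0 (T + 1)"] by (simp del: norm_ge_zero)
  have cdf_int: "complex_of_real (cdf M b - cdf M a) = integral {a..b} l" if ab: "a \<le> b" "T \<notin> {a..b}" for a b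
  proof -
    define d where "d = (if T < a then a - T else T - b)"
    have d: "d > 0" "\<And>x. x \<in> {a..b} \<Longrightarrow> d \<le> \<bar>x - T\<bar>" using ab by (auto simp: d_def)
    have ne: "x \<noteq> T" if "x \<in> {a..b}" for x using ab that by auto
    have int: "set_integrable lborel {a..b} l"
      using ne by (intro borel_integrable_atLeastAtMost' continuous_on_subset[OF cont]) auto
    have "of_real (prob {a<..b}) = (CLINT x:{a..b}|lborel. l x)"
    proof (rule prob_Ioc_eq_integral_of_inversion[OF ab(1) atoms])
      show "set_borel_measurable lborel {a..b} l"
        using int unfolding set_borel_measurable_def set_integrable_def by (rule borel_measurable_integrable)
      fix x assume x: "x \<in> {a..b}"
      show "(\<lambda>n. 1 / (2 * pi) * char_inversion M n x) \<longlonglongrightarrow> l x"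
        by (rule lim[OF ne[OF x]])
      fix n
      have "norm (char_inversion M n x) \<le> K / \<bar>x - T\<bar>" by (rule bd[OF ne[OF x]])
      also have "\<dots> \<le> K / d" using K d(1) d(2)[OF x] by (intro divide_left_mono) auto
      finally show "norm (char_inversion M n x) \<le> K / d" .
    qed
    also have "(CLINT x:{a..b}|lborel. l x) = integral {a..b} l" by (rule set_borel_integral_eq_integral(2)[OF int])
    also have "prob {a<..b} = cdf M b - cdf M a"
      using ab(1) by (cases "a = b") (auto simp: cdf_diff_eq)
    finally show ?thesis .
  qed
  have deriv: "((\<lambda>u. complex_of_real (cdf M u)) has_vector_derivative l x) (at x)" if x: "x \<noteq> T" for x
  proof -
    define d where "d = \<bar>x - T\<bar> / 2"
    have d: "d > 0" "T \<notin> {x - d..x + d}" using x by (auto simp: d_def abs_if field_simps split: if_splits)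
    have "((\<lambda>u. integral {x - d..u} l) has_vector_derivative l x) (at x within {x - d..x + d})"
      using d by (intro integral_has_vector_derivative continuous_on_subset[OF cont]) auto
    then have "((\<lambda>u. complex_of_real (cdf M (x - d)) + integral {x - d..u} l) has_vector_derivative l x) (at x)"
      using has_vector_derivative_add[OF has_vector_derivative_const] d(1) by (fastforce simp: at_within_Icc_at)
    then show ?thesis
    proof (rule has_vector_derivative_transform_within_open[where S = "{x - d<..<x + d}"])
      fix u assume u: "u \<in> {x - d<..<x + d}"
      have "complex_of_real (cdf M u - cdf M (x - d)) = integral {x - d..u} l"
        by (rule cdf_int) (use u d in auto)
      then show "complex_of_real (cdf M (x - d)) + integral {x - d..u} l = complex_of_real (cdf M u)"
        by (simp add: algebra_simps)
    qed (use d in auto)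
  qed
  have dRe: "(cdf M has_real_derivative Re (l x)) (at x)" and dIm: "((\<lambda>u. 0) has_real_derivative Im (l x)) (at x)"
    if "x \<noteq> T" for x
    using deriv[OF that] by (auto simp: has_vector_derivative_complex_iff)
  have Im0: "Im (l x) = 0" if "x \<noteq> T" for x using DERIV_unique[OF dIm[OF that] DERIV_const] .
  have Re0: "Re (l x) \<ge> 0" if "x \<noteq> T" for x
    by (rule mono_on_imp_deriv_nonneg[where A = UNIV and f = "cdf M", OF _ dRe[OF that]])
       (auto intro!: mono_onI cdf_nondecreasing)
  show "\<And>x. x \<noteq> T \<Longrightarrow> Im (l x) = 0 \<and> Re (l x) \<ge> 0" using Im0 Re0 by blast
  define f where "f x = (if x = T then 0 else Re (l x))" for x
  have f_nn: "f x \<ge> 0" for x using Re0 by (simp add: f_def)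
  have f_meas [measurable]: "f \<in> borel_measurable borel"
  proof -
    have "(\<lambda>x. indicator (- {T}) x *\<^sub>R Re (l x)) \<in> borel_measurable borel"
      by (intro borel_measurable_continuous_on_indicator continuous_intros cont) auto
    moreover have "(\<lambda>x. indicator (- {T}) x *\<^sub>R Re (l x)) = f" by (auto simp: f_def indicator_def)
    ultimately show ?thesis by simp
  qed
  have Ioc: "emeasure (density lborel (\<lambda>x. ennreal (f x))) {a<..b} = emeasure M {a<..b}" for a b
  proof (cases "a \<le> b")
    case True
    have "(f has_integral (cdf M b - cdf M a)) {a..b}"
    proof (rule fundamental_theorem_of_calculus_interior_strong[where S = "{T}"])
      show "continuous_on {a..b} (cdf M)"
        using atoms by (intro continuous_at_imp_continuous_on ballI) (simp add: isCont_cdf)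
      fix x assume "x \<in> {a<..<b} - {T}"
      then show "(cdf M has_vector_derivative f x) (at x)"
        using dRe[of x] by (simp add: f_def has_real_derivative_iff_has_vector_derivative)
    qed (use True in auto)
    from nn_integral_has_integral_lebesgue'[OF f_nn this]
    have "(\<integral>\<^sup>+ x. ennreal (f x) * indicator {a..b} x \<partial>lborel) = ennreal (cdf M b - cdf M a)" .
    moreover have "(\<integral>\<^sup>+ x. ennreal (f x) * indicator {a<..b} x \<partial>lborel) = (\<integral>\<^sup>+ x. ennreal (f x) * indicator {a..b} x \<partial>lborel)"
    proof (rule nn_integral_cong_AE)
      have "AE x in lborel. x \<noteq> a" by (rule AE_lborel_singleton)
      then show "AE x in lborel. ennreal (f x) * indicator {a<..b} x = ennreal (f x) * indicator {a..b} x"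
        by (rule eventually_mono) (auto simp: indicator_def)
    qed
    ultimately show ?thesis using True
      by (simp add: emeasure_density finite_borel_measure.emeasure_Ioc[OF finite_borel_measure_M])
  qed simp
  have "M = density lborel (\<lambda>x. ennreal (f x))"
  proof (rule measure_eqI_generator_eq[where \<Omega> = UNIV and E = "range (\<lambda>(a, b). {a<..b::real})" and A = "\<lambda>i::nat. {- real i<..real i}"])
    show "emeasure M X = emeasure (density lborel (\<lambda>x. ennreal (f x))) X" if "X \<in> range (\<lambda>(a, b). {a<..b::real})" for X
      using that Ioc by auto
    show "(\<Union>i. {- real (i::nat)<..real i}) = UNIV" by (rule UN_Ioc_eq_UNIV)
  qed (auto simp: borel_sigma_sets_Ioc Int_stable_def)
  then show "M = density lborel (\<lambda>x. ennreal (if x = T then 0 else Re (l x)))" by (simp add: f_def)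
  show "(\<lambda>x. if x = T then 0 else Re (l x)) \<in> borel_measurable borel"
    using f_meas by (simp add: f_def[abs_def])
qed

end

section \<open>Digamma differences as Laplace integrals\<close>

lemma integrable_exp_neg:
  fixes c :: real
  assumes c: "c > 0"
  shows "set_integrable lborel {0<..} (\<lambda>u. exp (- c * u))"
proof -
  have "set_integrable lborel (einterval 0 \<infinity>) (\<lambda>u. exp (- c * u))"
  proof (rule interval_integral_FTC_nonneg[where F = "\<lambda>u. - exp (- c * u) / c" and A = "- 1 / c" and B = 0])
    show "((\<lambda>u. - exp (- c * u) / c) has_real_derivative exp (- c * u)) (at u)" for u
      using c by (auto intro!: derivative_eq_intros)
    show "(((\<lambda>u. - exp (- c * u) / c) \<circ> real_of_ereal) \<longlongrightarrow> - 1 / c) (at_right 0)"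
      unfolding zero_ereal_def ereal_tendsto_simps1 using c by (auto intro!: tendsto_eq_intros)
    show "(((\<lambda>u. - exp (- c * u) / c) \<circ> real_of_ereal) \<longlongrightarrow> 0) (at_left \<infinity>)"
      unfolding ereal_tendsto_simps1 using c by real_asymp
  qed (use c in auto)
  then show ?thesis by (simp add: einterval_eq_Ici zero_ereal_def)
qed

lemma integral_cexp_neg:
  fixes w :: complex
  assumes w: "Re w > 0"
  shows "set_integrable lborel {0<..} (\<lambda>u. exp (- w * of_real u))"
    and "(CLINT u:{0<..}|lborel. exp (- w * of_real u)) = 1 / w"
proof -
  have w0: "w \<noteq> 0" using w by auto
  show int: "set_integrable lborel {0<..} (\<lambda>u. exp (- w * of_real u))"
    by (rule set_integrable_bound[OF integrable_exp_neg[OF w]]) (auto simp: set_borel_measurable_def)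
  have "(CLBINT u=0..\<infinity>. exp (- w * of_real u)) = 0 - (- 1 / w)"
  proof (rule interval_integral_FTC_integrable[where F = "\<lambda>u. - exp (- w * of_real u) / w"])
    show "((\<lambda>u. - exp (- w * of_real u) / w) has_vector_derivative exp (- w * of_real u)) (at u)" for u
      by (rule has_vector_derivative_real_field) (use w0 in \<open>auto intro!: derivative_eq_intros\<close>)
    show "set_integrable lborel (einterval 0 \<infinity>) (\<lambda>u. exp (- w * of_real u))"
      using int by (simp add: einterval_eq_Ici zero_ereal_def)
    show "(((\<lambda>u. - exp (- w * of_real u) / w) \<circ> real_of_ereal) \<longlongrightarrow> - 1 / w) (at_right 0)"
      unfolding zero_ereal_def ereal_tendsto_simps1 using w0 by (auto intro!: tendsto_eq_intros)
    show "(((\<lambda>u. - exp (- w * of_real u) / w) \<circ> real_of_ereal) \<longlongrightarrow> 0) (at_left \<infinity>)"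
      unfolding ereal_tendsto_simps1
    proof (rule tendsto_norm_zero_cancel)
      have "((\<lambda>u. exp (- Re w * u) / norm w) \<longlongrightarrow> 0) at_top" using w w0 by real_asymp
      then show "((\<lambda>u. norm (- exp (- w * of_real u) / w)) \<longlongrightarrow> 0) at_top" by (simp add: norm_divide)
    qed
  qed auto
  then show "(CLINT u:{0<..}|lborel. exp (- w * of_real u)) = 1 / w"
    by (simp add: interval_lebesgue_integral_def einterval_eq_Ici zero_ereal_def)
qed

lemma norm_exp_diff_le:
  fixes z w :: complex
  assumes "Re z \<le> 0" "Re w \<le> 0"
  shows "norm (exp z - exp w) \<le> norm (z - w)"
proof -
  have "norm (exp z - exp w) \<le> 1 * norm (z - w)"
    by (rule field_differentiable_bound[where S = "{s. Re s \<le> 0}" and f' = exp])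
       (use assms in \<open>auto intro: convex_halfspace_Re_le has_field_derivative_at_within\<close>)
  then show ?thesis by simp
qed

text \<open>
  The kernel has a singularity \<open>A/u\<close> at 0, which the factor \<open>u\<close> compensates. Half of the exponential
  decay is spent on the factor \<open>A + u\<close>.
\<close>

lemma gamma_kernel_bound:
  assumes A: "A > 0" and a: "a > 0" and u: "u > 0"
  shows "0 \<le> gamma_kernel A a u" "u * gamma_kernel A a u \<le> (A + 2 * A / a) * exp (- (a / (2 * A)) * u)"
proof -
  define x where "x = u / A"
  have x: "x > 0" "u = A * x" using A u by (simp_all add: x_def)
  have e: "exp (- x) < 1" using x by simp
  then show "0 \<le> gamma_kernel A a u" by (simp add: gamma_kernel_def x_def)
  have "exp (- x) * (1 + x) \<le> exp (- x) * exp x" by (intro mult_left_mono exp_ge_add_one_self) auto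
  then have "exp (- x) * (1 + x) \<le> 1" by (simp add: exp_minus)
  then have "x \<le> (1 + x) * (1 - exp (- x))" by (simp add: algebra_simps)
  then have le: "x / (1 - exp (- x)) \<le> 1 + x" using e by (subst pos_divide_le_eq) auto
  define \<beta> where "\<beta> = a / (2 * A)"
  have \<beta>: "\<beta> > 0" using A a by (simp add: \<beta>_def)
  have "\<beta> * u \<le> exp (\<beta> * u)" using exp_ge_add_one_self[of "\<beta> * u"] by linarith
  then have "u * 1 \<le> 1 / \<beta> * exp (\<beta> * u)" using \<beta> by (simp add: field_simps)
  moreover have "A * 1 \<le> A * exp (\<beta> * u)" using A \<beta> u by (intro mult_left_mono) auto
  ultimately have Au: "A + u \<le> (A + 1 / \<beta>) * exp (\<beta> * u)" by (simp add: algebra_simps)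
  have "u * gamma_kernel A a u = A * exp (- a * u / A) * (x / (1 - exp (- x)))"
    using A by (simp add: gamma_kernel_def x_def)
  also have "\<dots> \<le> A * exp (- a * u / A) * (1 + x)" using A le by (intro mult_left_mono) auto
  also have "\<dots> = (A + u) * exp (- (2 * \<beta>) * u)" using A by (simp add: \<beta>_def x_def field_simps)
  also have "\<dots> \<le> (A + 1 / \<beta>) * exp (\<beta> * u) * exp (- (2 * \<beta>) * u)"
    using Au by (intro mult_right_mono) auto
  also have "\<dots> = (A + 1 / \<beta>) * exp (- \<beta> * u)" by (simp add: exp_add[symmetric] mult.assoc)
  finally show "u * gamma_kernel A a u \<le> (A + 2 * A / a) * exp (- (a / (2 * A)) * u)"
    by (simp add: \<beta>_def)
qed

text \<open>
  Term by term, \<open>1/(s + \<alpha>_n)\<close> with \<open>\<alpha>_n = (a + n)/A\<close> is the Laplace transform of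
  \<open>e^(-\<alpha>_n u)\<close>, and these exponentials sum to the kernel. For a single value the resulting integral
  diverges at 0; in the difference, \<open>|e^(-s'u) - e^(-su)| \<le> |s - s'| u\<close> compensates the
  singularity of the kernel.
\<close>

lemma Digamma_diff_integral:
  fixes s s' :: complex
  assumes A: "A > 0" and a: "a > 0" and s: "Re s \<ge> 0" "Re s' \<ge> 0"
  defines "f \<equiv> \<lambda>u. (exp (- s' * of_real u) - exp (- s * of_real u)) * of_real (gamma_kernel A a u)"
  shows "set_integrable lborel {0<..} f"
    and "(CLINT u:{0<..}|lborel. f u) =
       of_real A * Digamma (of_real A * s + of_real a) - of_real A * Digamma (of_real A * s' + of_real a)"
proof -
  let ?d = "\<lambda>u. exp (- s' * complex_of_real u) - exp (- s * of_real u)"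
  let ?z = "of_real A * s + of_real a" and ?z' = "of_real A * s' + of_real a"
  define \<alpha> where "\<alpha> n = (a + real n) / A" for n :: nat
  have \<alpha>: "\<alpha> n > 0" for n using A a by (simp add: \<alpha>_def)
  define g where "g n u = exp (- (s' + of_real (\<alpha> n)) * of_real u) - exp (- (s + of_real (\<alpha> n)) * of_real u)" for n u
  define w where "w u = norm (s - s') * (A + 2 * A / a) * exp (- (a / (2 * A)) * u)" for u
  have w_int: "set_integrable lborel {0<..} w"
    unfolding w_def using A a by (intro set_integrable_mult_right integrable_exp_neg) auto
  have fac: "(\<Sum>n<m. g n u) = ?d u * of_real (\<Sum>n<m. exp (- \<alpha> n * u))" for m u
    by (simp add: g_def sum_distrib_left left_diff_distrib exp_add[symmetric] distrib_right exp_of_real[symmetric] sum_subtractf)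
  have sums: "(\<lambda>n. exp (- \<alpha> n * u)) sums gamma_kernel A a u" if "u > 0" for u
    using gamma_kernel_sums[OF A that] by (simp add: \<alpha>_def)
  have diff: "norm (?d u) \<le> norm (s - s') * u" if "u > 0" for u
  proof -
    have "norm (?d u) \<le> norm (- s' * of_real u - (- s * of_real u))"
      using s that by (intro norm_exp_diff_le) auto
    also have "- s' * of_real u - (- s * of_real u) = (s - s') * of_real u" by (simp add: algebra_simps)
    finally show ?thesis using that by (simp add: norm_mult)
  qed
  have bound: "norm (?d u * of_real k) \<le> w u"
    if u: "u > 0" and k: "0 \<le> k" "k \<le> gamma_kernel A a u" for u k
  proof -
    have "norm (?d u * of_real k) \<le> norm (s - s') * u * k"
      unfolding norm_mult using diff[OF u] u k by (intro mult_mono) auto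
    also have "\<dots> \<le> norm (s - s') * (u * gamma_kernel A a u)"
      unfolding mult.assoc using u k by (intro mult_left_mono) auto
    also have "\<dots> \<le> norm (s - s') * ((A + 2 * A / a) * exp (- (a / (2 * A)) * u))"
      by (intro mult_left_mono gamma_kernel_bound[OF A a u]) auto
    finally show ?thesis by (simp add: w_def mult.assoc)
  qed
  show "set_integrable lborel {0<..} f"
    by (rule set_integrable_bound[OF w_int])
       (use bound gamma_kernel_bound(1)[OF A a] in \<open>auto simp: set_borel_measurable_def f_def intro!: AE_I2 intro: order_trans[OF _ abs_ge_self]\<close>)
  have g_int: "set_integrable lborel {0<..} (g n)" for n
    unfolding g_def using s \<alpha>[of n] by (intro set_integral_diff integral_cexp_neg) auto
  have g_val: "(CLINT u:{0<..}|lborel. g n u) = 1 / (s' + of_real (\<alpha> n)) - 1 / (s + of_real (\<alpha> n))" for n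
  proof -
    have "Re (s' + of_real (\<alpha> n)) > 0" "Re (s + of_real (\<alpha> n)) > 0" using s \<alpha>[of n] by auto
    note i = integral_cexp_neg[OF this(1)] integral_cexp_neg[OF this(2)]
    show ?thesis unfolding g_def set_integral_diff(2)[OF i(1,3)] i(2,4) ..
  qed
  have lim: "(\<lambda>m. CLINT u|lborel. indicator {0<..} u *\<^sub>R (\<Sum>n<m. g n u)) \<longlonglongrightarrow> (CLINT u|lborel. indicator {0<..} u *\<^sub>R f u)"
  proof (rule integral_dominated_convergence[where w = "\<lambda>u. indicator {0<..} u * w u"])
    show "integrable lborel (\<lambda>u. indicator {0<..} u * w u)" using w_int by (simp add: set_integrable_def)
    show "AE u in lborel. (\<lambda>m. indicator {0<..} u *\<^sub>R (\<Sum>n<m. g n u)) \<longlonglongrightarrow> indicator {0<..} u *\<^sub>R f u"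
    proof (rule AE_I2)
      fix u :: real
      show "(\<lambda>m. indicator {0<..} u *\<^sub>R (\<Sum>n<m. g n u)) \<longlonglongrightarrow> indicator {0<..} u *\<^sub>R f u"
      proof (cases "u > 0")
        case True
        have "(\<lambda>m. \<Sum>n<m. exp (- \<alpha> n * u)) \<longlonglongrightarrow> gamma_kernel A a u" using sums[OF True] by (simp add: sums_def)
        then show ?thesis unfolding fac f_def by (intro tendsto_intros)
      qed simp
    qed
    fix m
    show "AE u in lborel. norm (indicator {0<..} u *\<^sub>R (\<Sum>n<m. g n u)) \<le> indicator {0<..} u * w u"
    proof (rule AE_I2)
      fix u :: real
      show "norm (indicator {0<..} u *\<^sub>R (\<Sum>n<m. g n u)) \<le> indicator {0<..} u * w u"
      proof (cases "u > 0")
        case True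
        have "(\<Sum>n<m. exp (- \<alpha> n * u)) \<le> gamma_kernel A a u"
          unfolding sums_unique[OF sums[OF True]] by (intro sum_le_suminf sums_summable[OF sums[OF True]]) auto
        then show ?thesis unfolding fac using True bound[OF True, of "\<Sum>n<m. exp (- \<alpha> n * u)"]
            by (simp add: sum_nonneg del: of_real_sum)
      qed simp
    qed
  qed (auto simp: f_def g_def)
  have eq: "(CLINT u|lborel. indicator {0<..} u *\<^sub>R (\<Sum>n<m. g n u)) =
     of_real A * ((of_real (ln (real m)) - (\<Sum>n<m. inverse (?z + of_nat n)))
       - (of_real (ln (real m)) - (\<Sum>n<m. inverse (?z' + of_nat n))))" for m
  proof -
    have "(CLINT u|lborel. indicator {0<..} u *\<^sub>R (\<Sum>n<m. g n u)) = (\<Sum>n<m. CLINT u:{0<..}|lborel. g n u)"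
      unfolding set_lebesgue_integral_def scaleR_sum_right using g_int
      by (intro Bochner_Integration.integral_sum) (simp add: set_integrable_def)
    also have "\<dots> = (\<Sum>n<m. of_real A * (inverse (?z' + of_nat n) - inverse (?z + of_nat n)))"
    proof (rule sum.cong)
      fix n
      have eq: "z + of_real (\<alpha> n) = (of_real A * z + of_real a + of_nat n) / of_real A" for z :: complex
        using A by (simp add: \<alpha>_def field_simps)
      show "(CLINT u:{0<..}|lborel. g n u) = of_real A * (inverse (?z' + of_nat n) - inverse (?z + of_nat n))"
        unfolding g_val eq by (simp add: divide_inverse right_diff_distrib)
    qed simp
    finally show ?thesis by (simp add: sum_distrib_left[symmetric] sum_subtractf)
  qed
  have lim': "(\<lambda>m. of_real A * ((of_real (ln (real m)) - (\<Sum>n<m. inverse (?z + of_nat n)))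
       - (of_real (ln (real m)) - (\<Sum>n<m. inverse (?z' + of_nat n)))))
     \<longlonglongrightarrow> of_real A * (Digamma (?z) - Digamma (?z'))"
  proof (intro tendsto_mult tendsto_const tendsto_diff Digamma_LIMSEQ)
    have "Re (?z) > 0" "Re (?z') > 0"
      using A a s by (auto intro!: add_nonneg_pos)
    then show "?z \<noteq> 0" "?z' \<noteq> 0" by fastforce+
  qed
  show "(CLINT u:{0<..}|lborel. f u) =
       of_real A * Digamma (?z) - of_real A * Digamma (?z')"
    unfolding set_lebesgue_integral_def right_diff_distrib[symmetric]
    by (rule LIMSEQ_unique[OF lim[unfolded eq] lim'])
qed

lemma Digamma_affine_tendsto:
  assumes A: "A > 0" and a: "a > 0"
  shows "(\<lambda>n. of_real A * Digamma (of_real A * of_nat n + of_real a) - of_real (A * ln A + A * ln (real n)) :: complex) \<longlonglongrightarrow> 0"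
proof -
  define z where "z n = A * real n + a" for n
  have z_top: "filterlim z at_top sequentially" unfolding z_def using A by real_asymp
  have z_pos: "z n > 0" for n using A a by (simp add: z_def add_nonneg_pos)
  have "\<forall>\<^sub>F n in sequentially. norm (Digamma_rem (of_real (z n))) \<le> 8 / z n ^ 2"
    using filterlim_at_top[THEN iffD1, OF z_top, rule_format, of 1]
  proof (rule eventually_mono)
    fix n assume "1 \<le> z n"
    then show "norm (Digamma_rem (of_real (z n))) \<le> 8 / z n ^ 2"
      using Digamma_rem_bound_right[of "of_real (z n)"] by simp
  qed
  moreover have "(\<lambda>n. 8 / z n ^ 2) \<longlonglongrightarrow> 0" unfolding z_def using A by real_asymp
  ultimately have 1: "(\<lambda>n. Digamma_rem (of_real (z n))) \<longlonglongrightarrow> 0" by (rule Lim_null_comparison)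
  have "(\<lambda>n. A * (ln (z n) - ln A - ln (real n)) - A / (2 * z n)) \<longlonglongrightarrow> 0" unfolding z_def using A by real_asymp
  then have 2: "(\<lambda>n. of_real (A * (ln (z n) - ln A - ln (real n)) - A / (2 * z n)) :: complex) \<longlonglongrightarrow> of_real 0"
    by (rule tendsto_of_real)
  have "of_real A * Digamma (of_real A * of_nat n + of_real a) - of_real (A * ln A + A * ln (real n)) =
      of_real A * Digamma_rem (of_real (z n)) + of_real (A * (ln (z n) - ln A - ln (real n)) - A / (2 * z n))" for n
  proof -
    have eq: "of_real A * of_nat n + of_real a = complex_of_real (z n)" by (simp add: z_def)
    show ?thesis unfolding eq Digamma_rem_def Ln_of_real[OF z_pos] by (simp add: algebra_simps)
  qed
  moreover have "(\<lambda>n. of_real A * Digamma_rem (of_real (z n)) + of_real (A * (ln (z n) - ln A - ln (real n)) - A / (2 * z n)))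
     \<longlonglongrightarrow> of_real A * 0 + of_real 0" by (intro tendsto_add tendsto_mult tendsto_const 1 2)
  ultimately show ?thesis by simp
qed

section \<open>The quotient of gamma products: decay and Laplace exponent\<close>

lemma has_field_derivative_prod_log:
  fixes f :: "'i \<Rightarrow> 'a::real_normed_field \<Rightarrow> 'a"
  assumes "finite I" "\<And>i. i \<in> I \<Longrightarrow> (f i has_field_derivative f i s * g i) (at s)"
  shows "((\<lambda>s. \<Prod>i\<in>I. f i s) has_field_derivative (\<Prod>i\<in>I. f i s) * (\<Sum>i\<in>I. g i)) (at s)"
  using assms
proof (induction I rule: finite_induct)
  case (insert i I)
  then have "((\<lambda>s. f i s * (\<Prod>i\<in>I. f i s)) has_field_derivative
      f i s * g i * (\<Prod>i\<in>I. f i s) + (\<Prod>i\<in>I. f i s) * (\<Sum>i\<in>I. g i) * f i s) (at s)"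
    by (intro DERIV_mult) auto
  then show ?case using insert.hyps by (simp add: algebra_simps)
qed simp

text \<open>
  A Gronwall estimate: \<open>|n v|^2 e^(2C/v)\<close> is nonincreasing, since the logarithmic derivative of
  \<open>|n v|^2\<close> is \<open>2 Re (e v)\<close>.
\<close>

lemma norm_le_of_log_derivative_bound:
  fixes n e :: "real \<Rightarrow> complex"
  assumes Y: "0 < Y" "Y \<le> y" and C: "C \<ge> 0"
    and deriv: "\<And>v. v \<ge> Y \<Longrightarrow> (n has_vector_derivative n v * e v) (at v)"
    and bd: "\<And>v. v \<ge> Y \<Longrightarrow> norm (e v) \<le> C / v ^ 2"
  shows "norm (n y) \<le> norm (n Y) * exp (C / Y)"
proof -
  define g where "g v = ((Re (n v)) ^ 2 + (Im (n v)) ^ 2) * exp (2 * C / v)" for v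
  have "g y \<le> g Y"
  proof (rule DERIV_nonpos_imp_nonincreasing[OF Y(2)])
    fix v assume v: "Y \<le> v" "v \<le> y"
    then have v0: "v > 0" using Y by simp
    define m where "m = (Re (n v)) ^ 2 + (Im (n v)) ^ 2"
    have dR: "((\<lambda>v. Re (n v)) has_real_derivative Re (n v * e v)) (at v)"
      and dI: "((\<lambda>v. Im (n v)) has_real_derivative Im (n v * e v)) (at v)"
      using deriv[OF v(1)] by (auto simp: has_vector_derivative_complex_iff)
    have dE: "((\<lambda>v. exp (2 * C / v)) has_real_derivative exp (2 * C / v) * (- (2 * C) / v ^ 2)) (at v)"
      using v0 by (auto intro!: derivative_eq_intros simp: power2_eq_square)
    have dm: "((\<lambda>v. (Re (n v)) ^ 2 + (Im (n v)) ^ 2) has_real_derivative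
        2 * (Re (n v * e v) * Re (n v)) + 2 * (Im (n v * e v) * Im (n v))) (at v)"
      using DERIV_add[OF DERIV_power[OF dR, of 2] DERIV_power[OF dI, of 2]] by simp
    have "(g has_real_derivative (2 * (Re (n v * e v) * Re (n v)) + 2 * (Im (n v * e v) * Im (n v))) * exp (2 * C / v)
        + exp (2 * C / v) * (- (2 * C) / v ^ 2) * m) (at v)"
      unfolding g_def m_def by (rule DERIV_mult[OF dm dE])
    moreover have "(2 * (Re (n v * e v) * Re (n v)) + 2 * (Im (n v * e v) * Im (n v))) * exp (2 * C / v)
        + exp (2 * C / v) * (- (2 * C) / v ^ 2) * m = 2 * m * exp (2 * C / v) * (Re (e v) - C / v ^ 2)"
      by (simp add: m_def power2_eq_square algebra_simps add_divide_distrib)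
    moreover have "\<dots> \<le> 0"
    proof (rule mult_nonneg_nonpos)
      show "Re (e v) - C / v ^ 2 \<le> 0" using bd[OF v(1)] complex_Re_le_cmod[of "e v"] by linarith
    qed (simp add: m_def)
    ultimately show "\<exists>d. (g has_real_derivative d) (at v) \<and> d \<le> 0" by metis
  qed
  then have "norm (n y) ^ 2 * exp (2 * C / y) \<le> norm (n Y) ^ 2 * exp (2 * C / Y)"
    by (simp add: g_def cmod_power2)
  moreover have "norm (n y) ^ 2 * 1 \<le> norm (n y) ^ 2 * exp (2 * C / y)"
    using Y C by (intro mult_left_mono) auto
  moreover have "norm (n Y) ^ 2 * exp (2 * C / Y) = (norm (n Y) * exp (C / Y)) ^ 2"
    by (simp add: power_mult_distrib exp_double[symmetric])
  ultimately have "norm (n y) ^ 2 \<le> (norm (n Y) * exp (C / Y)) ^ 2" by linarith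
  then show ?thesis by (rule power2_le_imp_le) auto
qed

locale fox_parameters =
  fixes p q :: nat and A a B b :: "nat \<Rightarrow> real"
  assumes p: "p \<ge> 1"
    and A: "\<And>i. i \<in> {1..p} \<Longrightarrow> A i > 0" and B: "\<And>j. j \<in> {1..q} \<Longrightarrow> B j > 0"
    and a: "\<And>i. i \<in> {1..p} \<Longrightarrow> a i > 0" and b: "\<And>j. j \<in> {1..q} \<Longrightarrow> b j > 0"
    and mu: "fox_mu p q a b > 0"
    and sum_eq: "(\<Sum>j=1..q. B j) = (\<Sum>i=1..p. A i)"
begin

abbreviation "\<mu> \<equiv> fox_mu p q a b"
abbreviation "\<gamma> \<equiv> fox_gamma p A a"

text \<open>
  The value \<open>ln (1/\<rho>)\<close>: the drift of the law and the exceptional point of the inversion.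
\<close>

definition T :: real where "T = - ln (fox_rho p q A B)"

text \<open>
  The factors with \<open>rGamma\<close> are entire, so \<open>F\<close> is holomorphic to the right of \<open>\<gamma>\<close>, including
  the points where the denominator of the integrand has poles.
\<close>

definition F :: "complex \<Rightarrow> complex" where
  "F s = (\<Prod>k=1..p. Gamma (of_real (A k) * s + of_real (a k))) * (\<Prod>j=1..q. rGamma (of_real (B j) * s + of_real (b j)))"

definition \<Lambda> :: "complex \<Rightarrow> complex" where
  "\<Lambda> s = (\<Sum>k=1..p. of_real (A k) * Digamma (of_real (A k) * s + of_real (a k)))
     - (\<Sum>j=1..q. of_real (B j) * Digamma (of_real (B j) * s + of_real (b j)))"

lemma fox_integrand_eq: "fox_integrand p q A a B b (exp (- t)) s = F s * exp (of_real t * s)"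
proof -
  have "complex_of_real (exp (- t)) powr (- s) = exp (of_real t * s)"
    by (simp add: powr_def Ln_of_real mult.commute)
  then show ?thesis
    by (simp add: fox_integrand_def F_def rGamma_inverse_Gamma prod_inversef[symmetric] divide_inverse)
qed

lemma rho_pos: "fox_rho p q A B > 0"
  unfolding fox_rho_def by (intro mult_pos_pos prod_pos) (use A B in force)+

lemma T_eq: "T = (\<Sum>j=1..q. B j * ln (B j)) - (\<Sum>i=1..p. A i * ln (A i))"
proof -
  have A0: "\<And>i. i \<in> {1..p} \<Longrightarrow> A i powr A i > 0" and B0: "\<And>j. j \<in> {1..q} \<Longrightarrow> B j powr (- B j) > 0"
    using A B by force+
  have "ln (fox_rho p q A B) = ln (\<Prod>i=1..p. A i powr A i) + ln (\<Prod>j=1..q. B j powr (- B j))"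
    unfolding fox_rho_def using A0 B0 by (intro ln_mult_pos prod_pos) blast+
  also have "ln (\<Prod>i=1..p. A i powr A i) = (\<Sum>i=1..p. ln (A i powr A i))" using A0 by (intro ln_prod) auto
  also have "\<dots> = (\<Sum>i=1..p. A i * ln (A i))" using A by (intro sum.cong) (auto simp: ln_powr)
  also have "ln (\<Prod>j=1..q. B j powr (- B j)) = (\<Sum>j=1..q. ln (B j powr (- B j)))" using B0 by (intro ln_prod) auto
  also have "\<dots> = (\<Sum>j=1..q. - (B j * ln (B j)))" using B by (intro sum.cong) (auto simp: ln_powr)
  finally show ?thesis by (simp add: T_def sum_negf)
qed

lemma Re_affine_pos:
  assumes "Re s > \<gamma>" "k \<in> {1..p}"
  shows "Re (of_real (A k) * s + of_real (a k)) > 0"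
proof -
  have "Min ((\<lambda>k. a k / A k) ` {1..p}) \<le> a k / A k" using assms(2) by auto
  then have "Re s > - (a k / A k)" using assms(1) by (simp add: fox_gamma_def)
  then show ?thesis using A[OF assms(2)] by (simp add: field_simps)
qed

lemma gamma_neg: "\<gamma> < 0"
proof -
  have "Min ((\<lambda>k. a k / A k) ` {1..p}) \<in> (\<lambda>k. a k / A k) ` {1..p}" using p by (intro Min_in) auto
  then show ?thesis using A a by (auto simp: fox_gamma_def)
qed

lemma F_holomorphic: "F holomorphic_on {s. Re s > \<gamma>}"
  unfolding F_def
proof (intro holomorphic_intros)
  fix s k assume "s \<in> {s. Re s > \<gamma>}" "k \<in> {1..p}"
  then have "Re (of_real (A k) * s + of_real (a k)) > 0" using Re_affine_pos by blast
  then show "of_real (A k) * s + of_real (a k) \<notin> \<int>\<^sub>\<le>\<^sub>0"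
    by (metis complex_nonpos_Reals_iff leD nonpos_Ints_subset_nonpos_Reals subsetD)
qed

lemma F_cnj: "F (cnj s) = cnj (F s)"
  by (simp add: F_def cnj_Gamma cnj_rGamma cnj_prod)

text \<open>
  The formula fails at the real zeros of the entire factors with \<open>rGamma\<close>; the condition on \<open>s\<close>
  excludes them.
\<close>

lemma F_has_log_derivative:
  assumes s: "Re s > \<gamma>" "Im s \<noteq> 0 \<or> Re s \<ge> 0"
  shows "(F has_field_derivative F s * \<Lambda> s) (at s)"
proof -
  let ?G = "\<lambda>s. \<Prod>k=1..p. Gamma (of_real (A k) * s + of_real (a k))" and ?H = "\<lambda>s. \<Prod>j=1..q. rGamma (of_real (B j) * s + of_real (b j))"
  have 1: "(?G has_field_derivative ?G s * (\<Sum>k=1..p. of_real (A k) * Digamma (of_real (A k) * s + of_real (a k)))) (at s)"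
  proof (rule has_field_derivative_prod_log)
    fix k assume k: "k \<in> {1..p}"
    have "of_real (A k) * s + of_real (a k) \<notin> \<int>\<^sub>\<le>\<^sub>0" using Re_affine_pos[OF s(1) k]
      by (metis complex_nonpos_Reals_iff leD nonpos_Ints_subset_nonpos_Reals subsetD)
    then show "((\<lambda>s. Gamma (of_real (A k) * s + of_real (a k))) has_field_derivative
      Gamma (of_real (A k) * s + of_real (a k)) * (of_real (A k) * Digamma (of_real (A k) * s + of_real (a k)))) (at s)"
      by (auto intro!: derivative_eq_intros)
  qed simp
  have 2: "(?H has_field_derivative ?H s * (\<Sum>j=1..q. - (of_real (B j) * Digamma (of_real (B j) * s + of_real (b j))))) (at s)"
  proof (rule has_field_derivative_prod_log)
    fix j assume j: "j \<in> {1..q}"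
    have "of_real (B j) * s + of_real (b j) \<notin> \<real>\<^sub>\<le>\<^sub>0"
    proof (cases "Im s = 0")
      case True
      then have "B j * Re s + b j > 0" using s B[OF j] b[OF j] by (auto intro!: add_nonneg_pos)
      then show ?thesis by (simp add: complex_nonpos_Reals_iff)
    qed (use B[OF j] in \<open>simp add: complex_nonpos_Reals_iff\<close>)
    then have "of_real (B j) * s + of_real (b j) \<notin> \<int>\<^sub>\<le>\<^sub>0" using nonpos_Ints_subset_nonpos_Reals by blast
    then show "((\<lambda>s. rGamma (of_real (B j) * s + of_real (b j))) has_field_derivative
      rGamma (of_real (B j) * s + of_real (b j)) * - (of_real (B j) * Digamma (of_real (B j) * s + of_real (b j)))) (at s)"
      by (auto intro!: derivative_eq_intros DERIV_chain2[OF has_field_derivative_rGamma_no_nonpos_int])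
  qed simp
  show ?thesis using DERIV_mult[OF 1 2] unfolding F_def \<Lambda>_def by (simp add: sum_negf algebra_simps)
qed

lemma \<Lambda>_asymp:
  "(\<lambda>s. \<Lambda> s + of_real T + of_real \<mu> / s) \<in> O[vertical_strip K](\<lambda>s. of_real (1 / (Im s) ^ 2))"
proof -
  let ?D = "\<lambda>s. (\<Sum>k=1..p. of_real (A k) * Digamma (of_real (A k) * s + of_real (a k)) -
       (of_real (A k * ln (A k)) + of_real (A k) * Ln s + of_real (a k - 1/2) / s))
     - (\<Sum>j=1..q. of_real (B j) * Digamma (of_real (B j) * s + of_real (b j)) -
       (of_real (B j * ln (B j)) + of_real (B j) * Ln s + of_real (b j - 1/2) / s))"
  have "(\<lambda>s. ?D s)
     \<in> O[vertical_strip K](\<lambda>s. of_real (1 / (Im s) ^ 2))"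
    using A B by (intro sum_in_bigo big_sum_in_bigo Digamma_affine_strip) auto
  also have "(\<lambda>s. ?D s)
     = (\<lambda>s. \<Lambda> s + of_real T + of_real \<mu> / s)"
  proof
    fix s
    have sumA: "(\<Sum>k=1..p. of_real (A k) * Ln s) = of_real (\<Sum>i=1..p. A i) * Ln s" 
      and sumB: "(\<Sum>j=1..q. of_real (B j) * Ln s) = of_real (\<Sum>j=1..q. B j) * Ln s"
      by (simp_all add: sum_distrib_right)
    have suma: "(\<Sum>k=1..p. of_real (a k - 1/2) / s) = of_real ((\<Sum>i=1..p. a i) - p / 2) / s"
      and sumb: "(\<Sum>j=1..q. of_real (b j - 1/2) / s) = of_real ((\<Sum>j=1..q. b j) - q / 2) / s"
      by (simp_all add: sum_divide_distrib[symmetric] sum_subtractf)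
    have mu_eq: "of_real \<mu> / s = of_real ((\<Sum>j=1..q. b j) - q / 2) / s - of_real ((\<Sum>i=1..p. a i) - p / 2) / s"
      unfolding diff_divide_distrib[symmetric] of_real_diff[symmetric]
      by (simp add: fox_mu_def diff_divide_distrib algebra_simps)
    show "?D s
     = \<Lambda> s + of_real T + of_real \<mu> / s"
      unfolding sum_subtractf sum.distrib sumA sumB sum_eq suma sumb mu_eq T_eq \<Lambda>_def
      by (simp only: of_real_diff of_real_sum) (simp add: algebra_simps)
  qed
  finally show ?thesis .
qed

text \<open>
  By \<open>\<Lambda>_asymp\<close> the function \<open>F(s) e^(Ts) s^\<mu>\<close> has a logarithmic derivative of order
  \<open>1/(Im s)^2\<close>, which is integrable along vertical lines, so it is bounded in the strip far above the real axis.
  The part below the axis follows by complex conjugation.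
\<close>

lemma F_decay:
  assumes c: "\<gamma> < c1" "c1 \<le> c2"
  obtains C Y where "C \<ge> 0" "Y \<ge> 1"
    "\<And>s. c1 \<le> Re s \<Longrightarrow> Re s \<le> c2 \<Longrightarrow> \<bar>Im s\<bar> \<ge> Y \<Longrightarrow> norm (F s) \<le> C * \<bar>Im s\<bar> powr (- \<mu>)"
    "\<And>s. c1 \<le> Re s \<Longrightarrow> Re s \<le> c2 \<Longrightarrow> \<bar>Im s\<bar> \<ge> Y \<Longrightarrow> norm (F s * (\<Lambda> s + of_real T)) \<le> C * \<bar>Im s\<bar> powr (- 1 - \<mu>)"
proof -
  define K where "K = \<bar>c1\<bar> + \<bar>c2\<bar>"
  obtain C' where C': "C' > 0"
    "eventually (\<lambda>s. norm (\<Lambda> s + of_real T + of_real \<mu> / s) \<le> C' * norm (of_real (1 / (Im s) ^ 2) :: complex)) (vertical_strip K)"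
    using \<Lambda>_asymp[of K] by (elim landau_o.bigE)
  then obtain Y' where Y': "\<And>s. \<bar>Re s\<bar> \<le> K \<Longrightarrow> \<bar>Im s\<bar> \<ge> Y' \<Longrightarrow> norm (\<Lambda> s + of_real T + of_real \<mu> / s) \<le> C' / (Im s) ^ 2"
    unfolding eventually_vertical_strip by (auto simp: norm_divide norm_power)
  define Y where "Y = max 1 Y'"
  have Y: "Y \<ge> 1" "Y \<ge> Y'" by (auto simp: Y_def)
  have E: "norm (\<Lambda> s + of_real T + of_real \<mu> / s) \<le> C' / (Im s) ^ 2" if "c1 \<le> Re s" "Re s \<le> c2" "\<bar>Im s\<bar> \<ge> Y" for s
    using that Y by (intro Y') (auto simp: K_def)
  define N where "N = (\<lambda>s. F s * exp (of_real T * s) * exp (of_real \<mu> * Ln s))"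
  have dN: "(N has_field_derivative N s * (\<Lambda> s + of_real T + of_real \<mu> / s)) (at s)"
    if s: "Re s > \<gamma>" "Im s > 0" for s
  proof -
    have "s \<noteq> 0" "s \<notin> \<real>\<^sub>\<le>\<^sub>0" using s by (auto simp: complex_nonpos_Reals_iff)
    then show ?thesis unfolding N_def
      using s by (auto intro!: derivative_eq_intros F_has_log_derivative simp: field_simps)
  qed
  have "bounded ((\<lambda>c. N (Complex c Y)) ` {c1..c2})"
  proof (intro compact_imp_bounded compact_continuous_image)
    have "continuous_on {c1..c2} (\<lambda>c. N (of_real c + \<i> * of_real Y))"
    proof (rule continuous_on_compose2[where f = "\<lambda>c. of_real c + \<i> * of_real Y" and g = N and t = "{s. Re s > \<gamma> \<and> Im s > 0}"])
      show "continuous_on {s. \<gamma> < Re s \<and> 0 < Im s} N"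
        using dN by (intro continuous_at_imp_continuous_on ballI) (auto intro: DERIV_isCont)
    qed (use c Y in \<open>auto intro!: continuous_intros\<close>)
    then show "continuous_on {c1..c2} (\<lambda>c. N (Complex c Y))" by (simp add: Complex_eq)
  qed simp
  then obtain D where D: "D > 0" "\<And>c. c \<in> {c1..c2} \<Longrightarrow> norm (N (Complex c Y)) \<le> D"
    unfolding bounded_pos by auto
  define D' where "D' = D * exp (C' / Y)"
  have D': "D' > 0" using D by (simp add: D'_def)
  have N_bd: "norm (N s) \<le> D'" if s: "c1 \<le> Re s" "Re s \<le> c2" "Im s \<ge> Y" for s
  proof -
    let ?n = "\<lambda>y. N (Complex (Re s) y)"
    have "norm (?n (Im s)) \<le> norm (?n Y) * exp (C' / Y)"
    proof (rule norm_le_of_log_derivative_bound)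
      fix v assume v: "v \<ge> Y"
      let ?z = "Complex (Re s) v"
      have "(Complex (Re s) has_vector_derivative \<i>) (at v)"
        by (simp add: has_vector_derivative_complex_iff)
      from field_vector_diff_chain_at[OF this dN[of ?z]] s v Y c
      show "(?n has_vector_derivative ?n v * (\<i> * (\<Lambda> ?z + of_real T + of_real \<mu> / ?z))) (at v)"
        by (simp add: comp_def mult_ac)
      show "norm (\<i> * (\<Lambda> ?z + of_real T + of_real \<mu> / ?z)) \<le> C' / v ^ 2"
        using E[of ?z] s v Y by (simp add: norm_mult)
    qed (use Y s C'(1) in auto)
    also have "\<dots> \<le> D'" unfolding D'_def using D(2)[of "Re s"] s by (intro mult_right_mono) auto
    finally show ?thesis by simp
  qed
  define C1 where "C1 = D' * exp (\<bar>T\<bar> * K)"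
  have C1: "C1 > 0" using D' by (simp add: C1_def)
  have up: "norm (F s) \<le> C1 * (Im s) powr (- \<mu>)" if s: "c1 \<le> Re s" "Re s \<le> c2" "Im s \<ge> Y" for s
  proof -
    have s0: "s \<noteq> 0" "Im s > 0" using s Y by auto
    have le: "Im s \<le> norm s" using abs_Im_le_cmod[of s] by linarith
    have "norm (N s) = norm (F s) * exp (T * Re s) * norm s powr \<mu>"
      using s0 by (simp add: N_def norm_mult powr_def)
    then have "norm (F s) = norm (N s) * exp (- (T * Re s)) * norm s powr (- \<mu>)"
      using s0 by (simp add: powr_minus exp_minus field_simps)
    also have "\<dots> \<le> D' * exp (\<bar>T\<bar> * K) * (Im s) powr (- \<mu>)"
    proof (intro mult_mono N_bd s)
      have "- (T * Re s) \<le> \<bar>T\<bar> * \<bar>Re s\<bar>" by (metis abs_ge_minus_self abs_mult)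
      also have "\<dots> \<le> \<bar>T\<bar> * K" using s by (intro mult_left_mono) (auto simp: K_def)
      finally show "exp (- (T * Re s)) \<le> exp (\<bar>T\<bar> * K)" by simp
      show "norm s powr - \<mu> \<le> Im s powr - \<mu>" using le s0 mu by (intro powr_mono2') auto
    qed (use D' in auto)
    finally show ?thesis by (simp add: C1_def)
  qed
  have F_bd: "norm (F s) \<le> C1 * \<bar>Im s\<bar> powr (- \<mu>)" if s: "c1 \<le> Re s" "Re s \<le> c2" "\<bar>Im s\<bar> \<ge> Y" for s
  proof (cases "Im s \<ge> 0")
    case True
    then show ?thesis using up[of s] s by simp
  next
    case False
    then show ?thesis using up[of "cnj s"] s by (simp add: F_cnj)
  qed
  have L_bd: "norm (\<Lambda> s + of_real T) \<le> (C' + \<mu>) / \<bar>Im s\<bar>" if s: "c1 \<le> Re s" "Re s \<le> c2" "\<bar>Im s\<bar> \<ge> Y" for s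
  proof -
    have s0: "s \<noteq> 0" "\<bar>Im s\<bar> \<ge> 1" using s Y by auto
    have "norm (\<Lambda> s + of_real T) \<le> norm (\<Lambda> s + of_real T + of_real \<mu> / s) + norm (of_real \<mu> / s)"
      by (metis add_diff_cancel_right' norm_triangle_ineq4)
    also have "\<dots> \<le> C' / (Im s) ^ 2 + \<mu> / \<bar>Im s\<bar>"
    proof (intro add_mono E s)
      show "norm (of_real \<mu> / s) \<le> \<mu> / \<bar>Im s\<bar>" unfolding norm_divide
        using mu s0 abs_Im_le_cmod[of s] by (simp add: frac_le)
    qed
    also have "C' / (Im s) ^ 2 \<le> C' / \<bar>Im s\<bar>"
    proof (intro divide_left_mono)
      show "\<bar>Im s\<bar> \<le> (Im s) ^ 2" using s0 mult_right_mono[of 1 "\<bar>Im s\<bar>" "\<bar>Im s\<bar>"]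
        by (simp add: power2_eq_square abs_mult_self_eq)
    qed (use C'(1) s0 in auto)
    finally show ?thesis by (simp add: add_divide_distrib)
  qed
  have "norm (F s * (\<Lambda> s + of_real T)) \<le> C1 * (C' + \<mu>) * \<bar>Im s\<bar> powr (- 1 - \<mu>)"
    if s: "c1 \<le> Re s" "Re s \<le> c2" "\<bar>Im s\<bar> \<ge> Y" for s
  proof -
    have "norm (F s * (\<Lambda> s + of_real T)) \<le> (C1 * \<bar>Im s\<bar> powr (- \<mu>)) * ((C' + \<mu>) / \<bar>Im s\<bar>)"
      unfolding norm_mult using C1 by (intro mult_mono F_bd L_bd s) auto
    also have "\<dots> = C1 * (C' + \<mu>) * \<bar>Im s\<bar> powr (- 1 - \<mu>)"
      using s Y by (simp add: powr_diff powr_minus divide_inverse mult_ac)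
    finally show ?thesis .
  qed
  note FL_bd = this
  show ?thesis
  proof (rule that[of "max C1 (C1 * (C' + \<mu>))" Y])
    fix s assume s: "c1 \<le> Re s" "Re s \<le> c2" "\<bar>Im s\<bar> \<ge> Y"
    show "norm (F s) \<le> max C1 (C1 * (C' + \<mu>)) * \<bar>Im s\<bar> powr (- \<mu>)"
      by (rule order_trans[OF F_bd[OF s]], rule mult_right_mono) auto
    show "norm (F s * (\<Lambda> s + of_real T)) \<le> max C1 (C1 * (C' + \<mu>)) * \<bar>Im s\<bar> powr (- 1 - \<mu>)"
      by (rule order_trans[OF FL_bd[OF s]], rule mult_right_mono) auto
  qed (use C1 Y(1) in auto)
qed

abbreviation "P \<equiv> fox_P p q A a B b"

lemma P_measurable [measurable]: "P \<in> borel_measurable borel"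
  unfolding fox_P_eq_gamma_kernel[abs_def] by measurable

lemma \<Lambda>_diff:
  assumes s: "Re s \<ge> 0" "Re s' \<ge> 0"
  defines "d \<equiv> \<lambda>u. exp (- s' * of_real u) - exp (- s * of_real u)"
  shows "set_integrable lborel {0<..} (\<lambda>u. d u * of_real (P u))"
    and "(CLINT u:{0<..}|lborel. d u * of_real (P u)) = \<Lambda> s - \<Lambda> s'"
proof -
  have eq: "d u * of_real (P u) = (\<Sum>i=1..p. d u * of_real (gamma_kernel (A i) (a i) u)) - (\<Sum>j=1..q. d u * of_real (gamma_kernel (B j) (b j) u))" for u
    by (simp add: fox_P_eq_gamma_kernel sum_distrib_left right_diff_distrib)
  note DA = Digamma_diff_integral[OF A a s, folded d_def] and DB = Digamma_diff_integral[OF B b s, folded d_def]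
  have iA: "set_integrable lborel {0<..} (\<lambda>u. \<Sum>i=1..p. d u * of_real (gamma_kernel (A i) (a i) u))"
    using DA(1) unfolding set_integrable_def scaleR_sum_right by (intro Bochner_Integration.integrable_sum) (auto simp: d_def)
  have iB: "set_integrable lborel {0<..} (\<lambda>u. \<Sum>j=1..q. d u * of_real (gamma_kernel (B j) (b j) u))"
    using DB(1) unfolding set_integrable_def scaleR_sum_right by (intro Bochner_Integration.integrable_sum) (auto simp: d_def)
  show "set_integrable lborel {0<..} (\<lambda>u. d u * of_real (P u))" unfolding eq using iA iB by (rule set_integral_diff)
  have "(CLINT u:{0<..}|lborel. d u * of_real (P u)) =
      (\<Sum>i=1..p. CLINT u:{0<..}|lborel. d u * of_real (gamma_kernel (A i) (a i) u)) - (\<Sum>j=1..q. CLINT u:{0<..}|lborel. d u * of_real (gamma_kernel (B j) (b j) u))"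
    unfolding eq set_integral_diff(2)[OF iA iB] using DA(1) DB(1)
    unfolding set_lebesgue_integral_def set_integrable_def scaleR_sum_right
    by (intro arg_cong2[of _ _ _ _ minus] Bochner_Integration.integral_sum) (auto simp: d_def)
  also have "(\<Sum>i=1..p. CLINT u:{0<..}|lborel. d u * of_real (gamma_kernel (A i) (a i) u)) =
      (\<Sum>i=1..p. of_real (A i) * Digamma (of_real (A i) * s + of_real (a i)) - of_real (A i) * Digamma (of_real (A i) * s' + of_real (a i)))"
    using DA(2) by (intro sum.cong) (auto simp: d_def)
  also have "(\<Sum>j=1..q. CLINT u:{0<..}|lborel. d u * of_real (gamma_kernel (B j) (b j) u)) =
      (\<Sum>j=1..q. of_real (B j) * Digamma (of_real (B j) * s + of_real (b j)) - of_real (B j) * Digamma (of_real (B j) * s' + of_real (b j)))"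
    using DB(2) by (intro sum.cong) (auto simp: d_def)
  finally show "(CLINT u:{0<..}|lborel. d u * of_real (P u)) = \<Lambda> s - \<Lambda> s'"
    by (simp add: \<Lambda>_def sum_subtractf algebra_simps)
qed

lemma \<Lambda>_tendsto: "(\<lambda>n. \<Lambda> (of_nat n)) \<longlonglongrightarrow> - of_real T"
proof -
  let ?D = "\<lambda>n. (\<Sum>k=1..p. of_real (A k) * Digamma (of_real (A k) * of_nat n + of_real (a k)) - of_real (A k * ln (A k) + A k * ln (real n)))
     - (\<Sum>j=1..q. of_real (B j) * Digamma (of_real (B j) * of_nat n + of_real (b j)) - of_real (B j * ln (B j) + B j * ln (real n)))"
  have "(\<lambda>n. ?D n)
     \<longlonglongrightarrow> (\<Sum>k=1..p. 0) - (\<Sum>j=1..q. 0 :: complex)"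
    using A a B b by (intro tendsto_diff tendsto_sum Digamma_affine_tendsto) auto
  moreover have "?D n
     = \<Lambda> (of_nat n) + of_real T" for n
  proof -
    have sumA: "(\<Sum>k=1..p. A k * ln (real n)) = (\<Sum>i=1..p. A i) * ln (real n)"
      and sumB: "(\<Sum>j=1..q. B j * ln (real n)) = (\<Sum>i=1..p. A i) * ln (real n)"
      by (simp only: sum_distrib_right) (simp only: sum_eq[symmetric] sum_distrib_right)
    show ?thesis
      unfolding sum_subtractf of_real_sum[symmetric] sum.distrib sumA sumB T_eq \<Lambda>_def
      by (simp only: of_real_diff of_real_add) (simp add: algebra_simps)
  qed
  ultimately have "(\<lambda>n. \<Lambda> (of_nat n) + of_real T) \<longlonglongrightarrow> 0" by simp
  from tendsto_diff[OF this tendsto_const[of "of_real T"]] show ?thesis by simp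
qed

text \<open>
  Monotone convergence for \<open>(1 - e^(-nu)) P(u)\<close>, whose integral is \<open>\<Lambda>(n) - \<Lambda>(0)\<close>, gives the
  integrability of \<open>P\<close> at 0 and at infinity together with \<open>\<integral> P = -T - \<Lambda>(0)\<close>.
\<close>

lemma P_integrable_and_\<Lambda>_eq:
  assumes nn: "\<And>u. u > 0 \<Longrightarrow> P u \<ge> 0"
  shows "set_integrable lborel {0<..} P"
    and "\<And>s. Re s \<ge> 0 \<Longrightarrow> \<Lambda> s = - of_real T - (CLINT u:{0<..}|lborel. P u *\<^sub>R exp (- s * of_real u))"
proof -
  define f where "f n u = indicator {0<..} u *\<^sub>R ((1 - exp (- real n * u)) * P u)" for n :: nat and u
  have c: "of_real (f n u) = indicator {0<..} u *\<^sub>R ((exp (- 0 * of_real u) - exp (- of_nat n * of_real u)) * of_real (P u) :: complex)" for n u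
    by (simp add: f_def scaleR_conv_of_real exp_of_real[symmetric])
  have f_int: "integrable lborel (f n)" for n
    using \<Lambda>_diff(1)[of "of_nat n" 0] unfolding set_integrable_def c[symmetric] complex_of_real_integrable_eq by simp
  have f_val: "complex_of_real (integral\<^sup>L lborel (f n)) = \<Lambda> (of_nat n) - \<Lambda> 0" for n
    using \<Lambda>_diff(2)[of "of_nat n" 0] unfolding set_lebesgue_integral_def c[symmetric] integral_complex_of_real by simp
  define I where "I = Re (- of_real T - \<Lambda> 0)"
  have "(\<lambda>n. complex_of_real (integral\<^sup>L lborel (f n))) \<longlonglongrightarrow> - of_real T - \<Lambda> 0"
    unfolding f_val by (intro tendsto_diff tendsto_const \<Lambda>_tendsto)
  note limc = this
  from tendsto_Re[OF this] have lim: "(\<lambda>n. integral\<^sup>L lborel (f n)) \<longlonglongrightarrow> I" by (simp add: I_def)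
  have Ic: "of_real I = - of_real T - \<Lambda> 0" by (rule LIMSEQ_unique[OF tendsto_of_real[OF lim] limc])
  have mono: "AE u in lborel. mono (\<lambda>n. f n u)"
  proof (intro AE_I2 monoI)
    fix u :: real and m n :: nat assume mn: "m \<le> n"
    show "f m u \<le> f n u"
    proof (cases "u > 0")
      case True
      have "real m * u \<le> real n * u" using mn True by (intro mult_right_mono) auto
      then show ?thesis using True nn[OF True] by (simp add: f_def mult_right_mono)
    qed (simp add: f_def)
  qed
  have pt: "AE u in lborel. (\<lambda>n. f n u) \<longlonglongrightarrow> indicator {0<..} u *\<^sub>R P u"
  proof (rule AE_I2)
    fix u :: real
    show "(\<lambda>n. f n u) \<longlonglongrightarrow> indicator {0<..} u *\<^sub>R P u"
    proof (cases "u > 0")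
      case True
      then have "(\<lambda>n. exp (- real n * u)) \<longlonglongrightarrow> 0" by real_asymp
      then have "(\<lambda>n. indicator {0<..} u *\<^sub>R ((1 - exp (- real n * u)) * P u)) \<longlonglongrightarrow> indicator {0<..} u *\<^sub>R ((1 - 0) * P u)"
        by (intro tendsto_intros)
      then show ?thesis by (simp add: f_def)
    qed (simp add: f_def)
  qed
  have meas: "(\<lambda>u. indicator {0<..} u *\<^sub>R P u) \<in> borel_measurable lborel" by simp
  show int: "set_integrable lborel {0<..} P"
    unfolding set_integrable_def by (rule integrable_monotone_convergence[OF f_int mono pt lim meas])
  have Ival: "(LINT u:{0<..}|lborel. P u) = I"
    unfolding set_lebesgue_integral_def by (rule integral_monotone_convergence[OF f_int mono pt lim meas])
  fix s :: complex assume s: "Re s \<ge> 0"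
  have i1: "set_integrable lborel {0<..} (\<lambda>u. complex_of_real (P u))"
    by (rule set_integrable_bound[OF int]) (auto simp: set_borel_measurable_def)
  have i2: "set_integrable lborel {0<..} (\<lambda>u. P u *\<^sub>R exp (- s * of_real u))"
    by (rule set_integrable_bound[OF int])
       (use s in \<open>auto simp: set_borel_measurable_def intro!: AE_I2 mult_left_le\<close>)
  have "\<Lambda> s - \<Lambda> 0 = (CLINT u:{0<..}|lborel. of_real (P u) - P u *\<^sub>R exp (- s * of_real u))"
    using \<Lambda>_diff(2)[of s 0] s by (simp add: left_diff_distrib scaleR_conv_of_real mult.commute)
  also have "\<dots> = of_real I - (CLINT u:{0<..}|lborel. P u *\<^sub>R exp (- s * of_real u))"
    unfolding set_integral_diff(2)[OF i1 i2] set_integral_complex_of_real Ival ..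
  finally show "\<Lambda> s = - of_real T - (CLINT u:{0<..}|lborel. P u *\<^sub>R exp (- s * of_real u))"
    unfolding Ic by (simp add: algebra_simps)
qed

text \<open>
  Both sides satisfy the same linear differential equation in \<open>t\<close>, whose coefficient is given by the
  formula for \<open>\<Lambda>\<close> on the imaginary axis; they agree at \<open>t = 0\<close>.
\<close>

lemma exists_distribution_of_gamma_ratio:
  assumes nn: "\<And>u. u > 0 \<Longrightarrow> P u \<ge> 0" and T: "T \<ge> 0"
  obtains M where "infinitely_divisible M" "\<And>t. F (- (\<i> * of_real t)) = F 0 * char M t"
proof -
  define K where "K t = (CLINT u:{0<..}|lborel. P u *\<^sub>R iexp (t * u))" for t
  obtain M where M: "infinitely_divisible M" "\<And>t. char M t = exp (\<i> * of_real (T * t) + levy_exponent P t)"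
    using exists_infinitely_divisible[OF P_measurable P_integrable_and_\<Lambda>_eq(1)[OF nn] nn T] by blast
  define r where "r t = F (- (\<i> * of_real t)) * exp (- (\<i> * of_real (T * t) + levy_exponent P t))" for t
  have "(r has_vector_derivative 0) (at t)" for t
  proof -
    let ?s = "- (\<i> * complex_of_real t)"
    have J': "(levy_exponent P has_vector_derivative \<i> * K t) (at t)"
      unfolding K_def by (rule levy_exponent_has_vector_derivative[OF P_measurable P_integrable_and_\<Lambda>_eq(1)[OF nn] nn])
    have "((\<lambda>t. - (\<i> * complex_of_real t)) has_vector_derivative - \<i>) (at t)"
      by (auto intro!: derivative_eq_intros has_vector_derivative_real_field)
    from field_vector_diff_chain_at[OF this F_has_log_derivative[of ?s]]
    have F': "((\<lambda>t. F (- (\<i> * of_real t))) has_vector_derivative - \<i> * (F ?s * \<Lambda> ?s)) (at t)"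
      using gamma_neg by (simp add: comp_def)
    have lin: "((\<lambda>t. - (\<i> * complex_of_real (T * t) + levy_exponent P t)) has_vector_derivative - (\<i> * of_real T + \<i> * K t)) (at t)"
      by (intro has_vector_derivative_minus has_vector_derivative_add J')
         (auto intro!: derivative_eq_intros has_vector_derivative_real_field)
    from field_vector_diff_chain_at[OF this DERIV_exp]
    have E': "((\<lambda>t. exp (- (\<i> * complex_of_real (T * t) + levy_exponent P t))) has_vector_derivative
       - (\<i> * of_real T + \<i> * K t) * exp (- (\<i> * of_real (T * t) + levy_exponent P t))) (at t)"
      by (simp add: comp_def)
    have L: "\<Lambda> ?s = - of_real T - K t"
      using P_integrable_and_\<Lambda>_eq(2)[OF nn, of ?s] by (simp add: K_def mult_ac)
    from has_vector_derivative_mult[OF F' E'] show ?thesis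
      unfolding r_def L by (simp add: algebra_simps)
  qed
  then have "r t = r 0" for t
    by (metis UNIV_I convex_UNIV has_vector_derivative_zero_constant)
  moreover have "r 0 = F 0" by (simp add: r_def levy_exponent_def set_lebesgue_integral_def)
  ultimately have r0: "r t = F 0" for t by simp
  have "F (- (\<i> * of_real t)) = F 0 * char M t" for t
  proof -
    have "F (- (\<i> * of_real t)) * exp (- (\<i> * of_real (T * t) + levy_exponent P t)) = F 0" using r0[of t] by (simp add: r_def)
    then show ?thesis unfolding M(2) exp_minus by (simp add: field_simps)
  qed
  then show ?thesis using that M(1) by blast
qed

section \<open>Inversion of the quotient of gamma products\<close>

definition F_axis :: "real \<Rightarrow> complex" where
  "F_axis y = F (\<i> * of_real y)"

text \<open>
  Up to the factors \<open>\<i>\<close> and \<open>e^(Ts)\<close>, the derivative of \<open>F(s) e^(Ts)\<close> along the imaginary axis.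
  It is integrable even where \<open>F\<close> itself is not.
\<close>

definition F_axis_deriv :: "real \<Rightarrow> complex" where
  "F_axis_deriv y = deriv F (\<i> * of_real y) + of_real T * F (\<i> * of_real y)"

text \<open>
  For \<open>f = F_axis\<close> this is, up to the factor \<open>2 \<pi>\<close>, the integral in the definition of the
  H-function at \<open>exp (-t)\<close> for the abscissa \<open>c = 0\<close>.
\<close>

definition truncated_fourier :: "(real \<Rightarrow> complex) \<Rightarrow> real \<Rightarrow> real \<Rightarrow> complex" where
  "truncated_fourier f R t = (CLINT y:{-R<..<R}|lborel. f y * iexp (t * y))"

text \<open>
  The limit of the truncated integrals after integration by parts; the factor \<open>t - T\<close> in the
  denominator comes from there.
\<close>

definition inverse_transform :: "real \<Rightarrow> complex" where
  "inverse_transform t = - (CLINT y|lborel. F_axis_deriv y * iexp (t * y)) / of_real (2 * pi * (t - T))"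

lemma open_halfplane: "open {s. Re s > \<gamma>}" and convex_halfplane: "convex {s. Re s > \<gamma>}"
  by (simp_all add: open_halfspace_Re_gt convex_halfspace_Re_gt)

lemma continuous_F_axis: "continuous_on UNIV F_axis" and continuous_F_axis_deriv: "continuous_on UNIV F_axis_deriv"
proof -
  have mem: "(\<lambda>y. \<i> * complex_of_real y) ` UNIV \<subseteq> {s. Re s > \<gamma>}" using gamma_neg by auto
  have F: "continuous_on {s. Re s > \<gamma>} F" by (rule holomorphic_on_imp_continuous_on[OF F_holomorphic])
  have F': "continuous_on {s. Re s > \<gamma>} (deriv F)"
    by (rule holomorphic_on_imp_continuous_on[OF holomorphic_deriv[OF F_holomorphic open_halfplane]])
  have 1: "continuous_on UNIV (\<lambda>y. F (\<i> * of_real y))" "continuous_on UNIV (\<lambda>y. deriv F (\<i> * of_real y))"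
    by (rule continuous_on_compose2[OF F _ mem] continuous_on_compose2[OF F' _ mem], intro continuous_intros)+
  show "continuous_on UNIV F_axis" unfolding F_axis_def[abs_def] by (rule 1)
  show "continuous_on UNIV F_axis_deriv" unfolding F_axis_deriv_def[abs_def] by (intro continuous_intros 1)
qed

lemma F_axis_measurable [measurable]: "F_axis \<in> borel_measurable borel" "F_axis_deriv \<in> borel_measurable borel"
  using continuous_F_axis continuous_F_axis_deriv by (auto intro: borel_measurable_continuous_onI)

lemma F_axis_deriv_eq: "F_axis_deriv y = F (\<i> * of_real y) * (\<Lambda> (\<i> * of_real y) + of_real T)"
proof -
  have "deriv F (\<i> * of_real y) = F (\<i> * of_real y) * \<Lambda> (\<i> * of_real y)"
    using gamma_neg by (intro DERIV_imp_deriv F_has_log_derivative) auto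
  then show ?thesis by (simp add: F_axis_deriv_def algebra_simps)
qed

lemma bounded_on_Icc:
  fixes f :: "real \<Rightarrow> complex"
  assumes "continuous_on UNIV f"
  obtains D where "\<And>y. \<bar>y\<bar> \<le> Y \<Longrightarrow> norm (f y) \<le> D"
proof -
  have "bounded (f ` {- Y..Y})"
    by (intro compact_imp_bounded compact_continuous_image continuous_on_subset[OF assms]) auto
  then obtain D where "\<And>x. x \<in> f ` {- Y..Y} \<Longrightarrow> norm x \<le> D" unfolding bounded_iff by blast
  then show ?thesis using that[of D] by (auto simp: abs_le_iff)
qed

lemma F_axis_decay:
  obtains C Y where "C \<ge> 0" "Y > 0" "\<And>y. \<bar>y\<bar> \<ge> Y \<Longrightarrow> norm (F_axis y) \<le> C * \<bar>y\<bar> powr (- \<mu>)"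
    "\<And>y. \<bar>y\<bar> \<ge> Y \<Longrightarrow> norm (F_axis_deriv y) \<le> C * \<bar>y\<bar> powr (- 1 - \<mu>)"
proof -
  obtain C Y where CY: "C \<ge> 0" "Y \<ge> 1"
    "\<And>s. 0 \<le> Re s \<Longrightarrow> Re s \<le> 0 \<Longrightarrow> \<bar>Im s\<bar> \<ge> Y \<Longrightarrow> norm (F s) \<le> C * \<bar>Im s\<bar> powr (- \<mu>)"
    "\<And>s. 0 \<le> Re s \<Longrightarrow> Re s \<le> 0 \<Longrightarrow> \<bar>Im s\<bar> \<ge> Y \<Longrightarrow> norm (F s * (\<Lambda> s + of_real T)) \<le> C * \<bar>Im s\<bar> powr (- 1 - \<mu>)"
    using F_decay[OF gamma_neg order_refl] by metis
  show ?thesis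
  proof (rule that[of C Y])
    fix y assume "\<bar>y\<bar> \<ge> Y"
    then show "norm (F_axis y) \<le> C * \<bar>y\<bar> powr (- \<mu>)" "norm (F_axis_deriv y) \<le> C * \<bar>y\<bar> powr (- 1 - \<mu>)"
      using CY(3,4)[of "\<i> * of_real y"] by (auto simp: F_axis_def F_axis_deriv_eq)
  qed (use CY in auto)
qed

lemma F_axis_deriv_integrable: "integrable lborel F_axis_deriv"
proof -
  obtain C Y where CY: "C \<ge> 0" "Y > 0"
    "\<And>y. \<bar>y\<bar> \<ge> Y \<Longrightarrow> norm (F_axis_deriv y) \<le> C * \<bar>y\<bar> powr (- 1 - \<mu>)" by (rule F_axis_decay) blast
  obtain D where "\<And>y. \<bar>y\<bar> \<le> Y \<Longrightarrow> norm (F_axis_deriv y) \<le> D" using bounded_on_Icc[OF continuous_F_axis_deriv] by metis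
  then show ?thesis using CY mu by (intro integrable_of_power_decay[where C = C and Y = Y and \<epsilon> = \<mu> and D = D]) auto
qed

lemma F_axis_bounded: obtains D where "\<And>y. norm (F_axis y) \<le> D"
proof -
  obtain C Y where CY: "C \<ge> 0" "Y > 0" "\<And>y. \<bar>y\<bar> \<ge> Y \<Longrightarrow> norm (F_axis y) \<le> C * \<bar>y\<bar> powr (- \<mu>)"
    by (rule F_axis_decay) blast
  obtain D where D: "\<And>y. \<bar>y\<bar> \<le> Y \<Longrightarrow> norm (F_axis y) \<le> D" using bounded_on_Icc[OF continuous_F_axis] by metis
  have "norm (F_axis y) \<le> max D (C * Y powr (- \<mu>))" for y
  proof (cases "\<bar>y\<bar> \<le> Y")
    case False
    then have "norm (F_axis y) \<le> C * \<bar>y\<bar> powr (- \<mu>)" by (intro CY) auto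
    also have "\<dots> \<le> C * Y powr (- \<mu>)" using False CY mu by (intro mult_left_mono powr_mono2') auto
    finally show ?thesis by simp
  qed (use D in \<open>simp add: le_max_iff_disj\<close>)
  then show ?thesis by (rule that)
qed

lemma F_axis_tendsto_0: "((\<lambda>R. F_axis R) \<longlongrightarrow> 0) at_top" "((\<lambda>R. F_axis (- R)) \<longlongrightarrow> 0) at_top"
proof -
  obtain C Y where CY: "C \<ge> 0" "Y > 0" "\<And>y. \<bar>y\<bar> \<ge> Y \<Longrightarrow> norm (F_axis y) \<le> C * \<bar>y\<bar> powr (- \<mu>)"
    by (rule F_axis_decay) blast
  have lim: "((\<lambda>R. C * R powr (- \<mu>)) \<longlongrightarrow> 0) at_top"
    using mu by (intro tendsto_mult_right_zero tendsto_neg_powr filterlim_ident) auto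
  have "\<forall>\<^sub>F R in at_top. norm (F_axis R) \<le> C * R powr (- \<mu>)" "\<forall>\<^sub>F R in at_top. norm (F_axis (- R)) \<le> C * R powr (- \<mu>)"
    using CY(3)[of R for R] CY(3)[of "- R" for R] CY(2)
    by (auto intro!: eventually_mono[OF eventually_ge_at_top[of Y]]) (smt (verit))+
  then show "((\<lambda>R. F_axis R) \<longlongrightarrow> 0) at_top" "((\<lambda>R. F_axis (- R)) \<longlongrightarrow> 0) at_top"
    using lim by (auto intro: Lim_null_comparison)
qed

lemma set_integrable_Ioo_of_continuous:
  fixes f :: "real \<Rightarrow> complex"
  assumes "continuous_on UNIV f"
  shows "set_integrable lborel {u<..<v} f"
  by (rule set_integrable_subset[of _ "{u..v}"])
     (auto intro: borel_integrable_atLeastAtMost' continuous_on_subset[OF assms])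

lemma truncated_fourier_by_parts:
  assumes R: "R \<ge> 0"
  shows "\<i> * of_real (t - T) * truncated_fourier F_axis R t =
    F_axis R * iexp (t * R) - F_axis (- R) * iexp (- (t * R)) - \<i> * truncated_fourier F_axis_deriv R t"
proof -
  define h where "h y = F_axis y * iexp (t * y)" for y
  define g where "g y = F_axis_deriv y * iexp (t * y)" for y
  have h_cont: "continuous_on UNIV h" unfolding h_def by (intro continuous_intros continuous_F_axis)
  have g_cont: "continuous_on UNIV g" unfolding g_def by (intro continuous_intros continuous_F_axis_deriv)
  have d: "(h has_vector_derivative \<i> * g y + \<i> * of_real (t - T) * h y) (at y)" for y
  proof -
    let ?s = "\<i> * complex_of_real y"
    have "((\<lambda>s. F s * exp (of_real t * s)) has_field_derivative
        (F ?s * \<Lambda> ?s) * exp (of_real t * ?s) + (of_real t * exp (of_real t * ?s)) * F ?s) (at ?s)"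
      using gamma_neg by (intro DERIV_mult F_has_log_derivative) (auto intro!: derivative_eq_intros)
    moreover have "((\<lambda>y. \<i> * complex_of_real y) has_vector_derivative \<i>) (at y)"
      by (auto intro!: derivative_eq_intros has_vector_derivative_real_field)
    ultimately have "((\<lambda>s. F s * exp (of_real t * s)) \<circ> (\<lambda>y. \<i> * complex_of_real y) has_vector_derivative
        \<i> * ((F ?s * \<Lambda> ?s) * exp (of_real t * ?s) + (of_real t * exp (of_real t * ?s)) * F ?s)) (at y)"
      by (intro field_vector_diff_chain_at)
    moreover have "(\<lambda>s. F s * exp (of_real t * s)) \<circ> (\<lambda>y. \<i> * complex_of_real y) = h"
      by (simp add: h_def F_axis_def fun_eq_iff mult_ac)
    moreover have "\<i> * ((F ?s * \<Lambda> ?s) * exp (of_real t * ?s) + (of_real t * exp (of_real t * ?s)) * F ?s) =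
        \<i> * g y + \<i> * of_real (t - T) * h y"
      by (simp add: g_def h_def F_axis_def F_axis_deriv_eq algebra_simps)
    ultimately show ?thesis by simp
  qed
  have "(CLBINT y=-R..R. \<i> * g y + \<i> * of_real (t - T) * h y) = h R - h (- R)"
  proof (rule interval_integral_FTC_finite)
    show "continuous_on {min (- R) R..max (- R) R} (\<lambda>y. \<i> * g y + \<i> * of_real (t - T) * h y)"
      by (intro continuous_intros continuous_on_subset[OF h_cont] continuous_on_subset[OF g_cont]) auto
  qed (rule has_vector_derivative_at_within[OF d])
  then have e1: "(CLINT y:{-R<..<R}|lborel. \<i> * g y + \<i> * of_real (t - T) * h y) = h R - h (- R)"
    using R by (simp add: interval_lebesgue_integral_def)
  have e2: "(CLINT y:{-R<..<R}|lborel. \<i> * g y + \<i> * of_real (t - T) * h y) =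
      \<i> * (CLINT y:{-R<..<R}|lborel. g y) + \<i> * of_real (t - T) * (CLINT y:{-R<..<R}|lborel. h y)"
  proof -
    have "set_integrable lborel {-R<..<R} (\<lambda>y. \<i> * g y)" "set_integrable lborel {-R<..<R} (\<lambda>y. \<i> * of_real (t - T) * h y)"
      by (intro set_integrable_mult_right set_integrable_Ioo_of_continuous h_cont g_cont)+
    then show ?thesis by (subst set_integral_add(2)) simp_all
  qed
  have "\<i> * of_real (t - T) * (CLINT y:{-R<..<R}|lborel. h y) = h R - h (- R) - \<i> * (CLINT y:{-R<..<R}|lborel. g y)"
    unfolding e1[symmetric] e2 by simp
  then show ?thesis unfolding truncated_fourier_def h_def g_def by (simp only: mult_minus_right)
qed

lemma truncated_fourier_eq:
  assumes "R \<ge> 0" "t \<noteq> T"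
  shows "truncated_fourier F_axis R t = (F_axis R * iexp (t * R) - F_axis (- R) * iexp (- (t * R)) - \<i> * truncated_fourier F_axis_deriv R t)
     / (\<i> * of_real (t - T))"
  using truncated_fourier_by_parts[OF assms(1), of t] assms(2) by (simp add: nonzero_eq_divide_eq mult.commute)

lemma truncated_fourier_tendsto:
  assumes t: "t \<noteq> T"
  shows "((\<lambda>R. truncated_fourier F_axis R t / of_real (2 * pi)) \<longlongrightarrow> inverse_transform t) at_top"
proof -
  let ?I = "CLINT y|lborel. F_axis_deriv y * iexp (t * y)"
  have 1: "((\<lambda>R. truncated_fourier F_axis_deriv R t) \<longlongrightarrow> ?I) at_top"
    unfolding truncated_fourier_def set_lebesgue_integral_def
  proof (rule integral_dominated_convergence_at_top[where w = "\<lambda>y. norm (F_axis_deriv y)"])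
    show "AE y in lborel. ((\<lambda>R. indicator {-R<..<R} y *\<^sub>R (F_axis_deriv y * iexp (t * y))) \<longlongrightarrow> F_axis_deriv y * iexp (t * y)) at_top"
    proof (rule AE_I2, rule tendsto_eventually)
      fix y :: real
      show "\<forall>\<^sub>F R in at_top. indicator {-R<..<R} y *\<^sub>R (F_axis_deriv y * iexp (t * y)) = F_axis_deriv y * iexp (t * y)"
        by (rule eventually_mono[OF eventually_gt_at_top[of "\<bar>y\<bar>"]]) (auto simp: indicator_def)
    qed
    show "\<forall>\<^sub>F R in at_top. AE y in lborel. norm (indicator {-R<..<R} y *\<^sub>R (F_axis_deriv y * iexp (t * y))) \<le> norm (F_axis_deriv y)"
      by (intro always_eventually allI AE_I2) (auto simp: indicator_def norm_mult)
  qed (use F_axis_deriv_integrable in auto)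
  have bdry: "((\<lambda>R. F_axis R * iexp (t * R)) \<longlongrightarrow> 0) at_top" "((\<lambda>R. F_axis (- R) * iexp (- (t * R))) \<longlongrightarrow> 0) at_top"
    by (insert F_axis_tendsto_0[THEN tendsto_norm_zero])
       (rule tendsto_norm_zero_cancel, simp add: norm_mult del: of_real_mult of_real_minus)+
  have "((\<lambda>R. (F_axis R * iexp (t * R) - F_axis (- R) * iexp (- (t * R)) - \<i> * truncated_fourier F_axis_deriv R t)
     / (\<i> * of_real (t - T)) / of_real (2 * pi)) \<longlongrightarrow> (0 - 0 - \<i> * ?I) / (\<i> * of_real (t - T)) / of_real (2 * pi)) at_top"
    using t by (intro tendsto_divide tendsto_diff tendsto_mult tendsto_const bdry 1) auto
  also have "(0 - 0 - \<i> * ?I) / (\<i> * of_real (t - T)) / of_real (2 * pi) = inverse_transform t"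
    using t by (simp add: inverse_transform_def)
  finally show ?thesis
    by (rule Lim_transform_eventually)
       (use t in \<open>auto intro!: eventually_mono[OF eventually_ge_at_top[of 0]] simp: truncated_fourier_eq\<close>)
qed

lemma truncated_fourier_bounded:
  obtains K where "\<And>R t. R \<ge> 0 \<Longrightarrow> t \<noteq> T \<Longrightarrow> norm (truncated_fourier F_axis R t) \<le> K / \<bar>t - T\<bar>"
proof -
  obtain D where D: "\<And>y. norm (F_axis y) \<le> D" by (rule F_axis_bounded) blast
  define N where "N = (LINT y|lborel. norm (F_axis_deriv y))"
  have "norm (truncated_fourier F_axis R t) \<le> (D + D + N) / \<bar>t - T\<bar>" if "R \<ge> 0" "t \<noteq> T" for R t
  proof -
    have "norm (truncated_fourier F_axis_deriv R t)
       \<le> (LINT y|lborel. norm (indicator {-R<..<R} y *\<^sub>R (F_axis_deriv y * iexp (t * y))))"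
      unfolding truncated_fourier_def set_lebesgue_integral_def by (rule integral_norm_bound)
    also have "\<dots> \<le> N" unfolding N_def
      by (rule integral_mono') (use F_axis_deriv_integrable in \<open>auto simp: indicator_def norm_mult\<close>)
    finally have W: "norm (truncated_fourier F_axis_deriv R t) \<le> N" .
    have "norm (F_axis R * iexp (t * R) - F_axis (- R) * iexp (- (t * R)) - \<i> * truncated_fourier F_axis_deriv R t)
       \<le> D + D + N"
      by (rule order_trans[OF norm_triangle_ineq4] add_mono)+
         (use W D in \<open>auto simp: norm_mult simp del: of_real_mult of_real_minus\<close>)
    then show ?thesis unfolding truncated_fourier_eq[OF that] norm_divide
      by (simp add: norm_mult divide_right_mono flip: of_real_diff)
  qed
  then show ?thesis by (rule that)
qed

lemma inverse_transform_continuous: "continuous_on (- {T}) inverse_transform"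
proof -
  have "isCont (\<lambda>t. CLINT y|lborel. F_axis_deriv y * iexp (t * y)) t" for t
    unfolding continuous_at_sequentially comp_def
  proof safe
    fix X assume X: "X \<longlonglongrightarrow> t"
    show "(\<lambda>n. CLINT y|lborel. F_axis_deriv y * iexp (X n * y)) \<longlonglongrightarrow> (CLINT y|lborel. F_axis_deriv y * iexp (t * y))"
      by (rule integral_dominated_convergence[where w = "\<lambda>y. norm (F_axis_deriv y)"])
         (use F_axis_deriv_integrable in \<open>auto simp: norm_mult intro!: AE_I2 tendsto_intros X\<close>)
  qed
  then have "continuous_on (- {T}) (\<lambda>t. CLINT y|lborel. F_axis_deriv y * iexp (t * y))"
    by (simp add: continuous_at_imp_continuous_on)
  then show ?thesis unfolding inverse_transform_def by (intro continuous_intros) auto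
qed

text \<open>
  On the half-plane the integrand has a primitive \<open>\<Phi>\<close>, so the integrals at the abscissas \<open>c\<close> and
  0 differ by increments of \<open>\<Phi>\<close> along two horizontal segments. These tend to zero by the uniform decay of
  \<open>F\<close> in the strip between the two abscissas.
\<close>

lemma has_fox_H_inverse_transform:
  assumes t: "t \<noteq> T"
  shows "has_fox_H p q A a B b (exp (- t)) (inverse_transform t)"
  unfolding has_fox_H_def
proof (intro allI impI)
  fix c assume c: "\<gamma> < c"
  define f where "f s = F s * exp (of_real t * s)" for s
  have f_hol: "f holomorphic_on {s. Re s > \<gamma>}" unfolding f_def by (intro holomorphic_intros F_holomorphic)
  obtain \<Phi> where \<Phi>: "\<And>s. Re s > \<gamma> \<Longrightarrow> (\<Phi> has_field_derivative f s) (at s)"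
    using holomorphic_convex_primitive'[OF convex_halfplane open_halfplane f_hol] at_within_open[OF _ open_halfplane]
    by (metis mem_Collect_eq)
  have contour: "contour_integral (linepath (Complex c (- R)) (Complex c R)) (fox_integrand p q A a B b (exp (- t)))
      = \<Phi> (Complex c R) - \<Phi> (Complex c (- R))" for R
  proof -
    have sub: "path_image (linepath (Complex c (- R)) (Complex c R)) \<subseteq> {s. Re s > \<gamma>}"
    proof -
      have "closed_segment (Complex c (- R)) (Complex c R) \<subseteq> {s. Re s > \<gamma>}"
        by (rule closed_segment_subset[OF _ _ convex_halfplane]) (use c in auto)
      then show ?thesis by simp
    qed
    have "(f has_contour_integral (\<Phi> (pathfinish (linepath (Complex c (- R)) (Complex c R))) - \<Phi> (pathstart (linepath (Complex c (- R)) (Complex c R)))))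
        (linepath (Complex c (- R)) (Complex c R))"
      by (rule contour_integral_primitive[OF _ _ sub]) (use \<Phi> in \<open>auto intro: has_field_derivative_at_within\<close>)
    moreover have "fox_integrand p q A a B b (exp (- t)) = f" by (simp add: fun_eq_iff fox_integrand_eq f_def)
    ultimately show ?thesis by (simp add: contour_integral_unique)
  qed
  have axis_int: "\<Phi> (Complex 0 R) - \<Phi> (Complex 0 (- R)) = \<i> * truncated_fourier F_axis R t" if R: "R \<ge> 0" for R
  proof -
    have d: "((\<lambda>y. \<Phi> (Complex 0 y)) has_vector_derivative \<i> * (F_axis y * iexp (t * y))) (at y)" for y
    proof -
      have "(Complex 0 has_vector_derivative \<i>) (at y)" by (simp add: has_vector_derivative_complex_iff)
      from field_vector_diff_chain_at[OF this \<Phi>[of "Complex 0 y"]] gamma_neg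
      show ?thesis by (simp add: comp_def f_def F_axis_def Complex_eq mult_ac)
    qed
    have "(CLBINT y=-R..R. \<i> * (F_axis y * iexp (t * y))) = \<Phi> (Complex 0 R) - \<Phi> (Complex 0 (- R))"
    proof (rule interval_integral_FTC_finite)
      show "continuous_on {min (- R) R..max (- R) R} (\<lambda>y. \<i> * (F_axis y * iexp (t * y)))"
        by (intro continuous_intros continuous_on_subset[OF continuous_F_axis]) auto
    qed (rule has_vector_derivative_at_within[OF d])
    then show ?thesis using R by (simp add: interval_lebesgue_integral_def truncated_fourier_def)
  qed
  define c1 where "c1 = min 0 c"
  define c2 where "c2 = max 0 c"
  have c12: "\<gamma> < c1" "c1 \<le> c2" using c gamma_neg by (auto simp: c1_def c2_def)
  obtain C Y where CY: "C \<ge> 0" "Y \<ge> 1"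
    "\<And>s. c1 \<le> Re s \<Longrightarrow> Re s \<le> c2 \<Longrightarrow> \<bar>Im s\<bar> \<ge> Y \<Longrightarrow> norm (F s) \<le> C * \<bar>Im s\<bar> powr (- \<mu>)"
    by (rule F_decay[OF c12]) blast
  have shift: "norm (\<Phi> (Complex c y) - \<Phi> (Complex 0 y)) \<le> C * exp (\<bar>t\<bar> * \<bar>c\<bar>) * \<bar>c\<bar> * \<bar>y\<bar> powr (- \<mu>)" if y: "\<bar>y\<bar> \<ge> Y" for y
  proof -
    have "norm (\<Phi> (Complex c y) - \<Phi> (Complex 0 y)) \<le> C * \<bar>y\<bar> powr (- \<mu>) * exp (\<bar>t\<bar> * \<bar>c\<bar>) * norm (Complex c y - Complex 0 y)"
    proof (rule field_differentiable_bound[where S = "closed_segment (Complex c y) (Complex 0 y)" and f' = f])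
      fix s assume "s \<in> closed_segment (Complex c y) (Complex 0 y)"
      then obtain u where u: "0 \<le> u" "u \<le> 1" "s = Complex ((1 - u) * c) y"
        by (auto simp: closed_segment_def complex_eq_iff algebra_simps)
      have s: "c1 \<le> Re s" "Re s \<le> c2" "\<bar>Re s\<bar> \<le> \<bar>c\<bar>" "Im s = y"
      proof -
        have "\<bar>(1 - u) * c\<bar> \<le> 1 * \<bar>c\<bar>" unfolding abs_mult using u by (intro mult_right_mono) auto
        then show "\<bar>Re s\<bar> \<le> \<bar>c\<bar>" by (simp add: u)
        moreover have "c \<ge> 0 \<Longrightarrow> (1 - u) * c \<ge> 0" "c \<le> 0 \<Longrightarrow> (1 - u) * c \<le> 0" using u by (auto simp: mult_nonneg_nonpos)
        ultimately show "c1 \<le> Re s" "Re s \<le> c2" "Im s = y" unfolding c1_def c2_def u(3) by (auto simp: min_def max_def)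
      qed
      have "Re s > \<gamma>" using s c12 by linarith
      then show "(\<Phi> has_field_derivative f s) (at s within closed_segment (Complex c y) (Complex 0 y))"
        by (rule has_field_derivative_at_within[OF \<Phi>])
      have "t * Re s \<le> \<bar>t\<bar> * \<bar>c\<bar>"
      proof -
        have "t * Re s \<le> \<bar>t\<bar> * \<bar>Re s\<bar>" by (metis abs_ge_self abs_mult)
        also have "\<dots> \<le> \<bar>t\<bar> * \<bar>c\<bar>" using s by (intro mult_left_mono) auto
        finally show ?thesis .
      qed
      then show "norm (f s) \<le> C * \<bar>y\<bar> powr (- \<mu>) * exp (\<bar>t\<bar> * \<bar>c\<bar>)"
        unfolding f_def norm_mult using CY(3)[of s] s y CY(1) by (intro mult_mono) auto
    qed auto
    also have "norm (Complex c y - Complex 0 y) = \<bar>c\<bar>" by (simp add: cmod_def)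
    finally show ?thesis by (simp add: mult_ac)
  qed
  have shift0: "((\<lambda>R. C * exp (\<bar>t\<bar> * \<bar>c\<bar>) * \<bar>c\<bar> * \<bar>R\<bar> powr (- \<mu>)) \<longlongrightarrow> 0) at_top"
    using mu by (intro tendsto_mult_right_zero tendsto_neg_powr filterlim_abs_real) auto
  have s1: "((\<lambda>R. \<Phi> (Complex c R) - \<Phi> (Complex 0 R)) \<longlongrightarrow> 0) at_top"
    by (rule Lim_null_comparison[OF _ shift0], rule eventually_mono[OF eventually_ge_at_top[of Y]])
       (use shift in \<open>auto intro: order_trans[OF _ abs_ge_self]\<close>)
  have s2: "((\<lambda>R. \<Phi> (Complex c (- R)) - \<Phi> (Complex 0 (- R))) \<longlongrightarrow> 0) at_top"
  proof (rule Lim_null_comparison[OF _ shift0], rule eventually_mono[OF eventually_ge_at_top[of Y]])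
    fix R assume "Y \<le> R"
    then have "\<bar>- R\<bar> \<ge> Y" by simp
    from shift[OF this] show "norm (\<Phi> (Complex c (- R)) - \<Phi> (Complex 0 (- R))) \<le> C * exp (\<bar>t\<bar> * \<bar>c\<bar>) * \<bar>c\<bar> * \<bar>R\<bar> powr (- \<mu>)" by simp
  qed
  let ?g = "\<lambda>R. 1 / (2 * of_real pi * \<i>) * ((\<Phi> (Complex c R) - \<Phi> (Complex 0 R)) - (\<Phi> (Complex c (- R)) - \<Phi> (Complex 0 (- R))))
      + truncated_fourier F_axis R t / of_real (2 * pi)"
  have "((\<lambda>R. ?g R) \<longlongrightarrow> 1 / (2 * of_real pi * \<i>) * (0 - 0) + inverse_transform t) at_top"
    by (intro tendsto_add tendsto_mult tendsto_const tendsto_diff s1 s2 truncated_fourier_tendsto[OF t])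
  then have lim: "((\<lambda>R. ?g R) \<longlongrightarrow> inverse_transform t) at_top" by simp
  show "((\<lambda>R. 1 / (2 * of_real pi * \<i>) *
              contour_integral (linepath (Complex c (- R)) (Complex c R)) (fox_integrand p q A a B b (exp (- t))))
          \<longlongrightarrow> inverse_transform t) at_top"
  proof (rule Lim_transform_eventually[OF lim], rule eventually_mono[OF eventually_ge_at_top[of 0]])
    fix R :: real assume R: "0 \<le> R"
    have eq: "truncated_fourier F_axis R t / of_real (2 * pi) = 1 / (2 * of_real pi * \<i>) * (\<Phi> (Complex 0 R) - \<Phi> (Complex 0 (- R)))"
      unfolding axis_int[OF R] by simp
    show "?g R = 1 / (2 * of_real pi * \<i>) *
              contour_integral (linepath (Complex c (- R)) (Complex c R)) (fox_integrand p q A a B b (exp (- t)))"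
      unfolding contour eq distrib_left[symmetric] by (rule arg_cong[where f = "(*) _"]) simp
  qed
qed

lemma fox_H_eq:
  assumes "t \<noteq> T"
  shows "fox_H p q A a B b (exp (- t)) = inverse_transform t"
  unfolding fox_H_def
proof (rule the_equality)
  show "has_fox_H p q A a B b (exp (- t)) (inverse_transform t)" by (rule has_fox_H_inverse_transform[OF assms])
  fix L assume "has_fox_H p q A a B b (exp (- t)) L"
  then show "L = inverse_transform t"
    using has_fox_H_inverse_transform[OF assms] gamma_neg unfolding has_fox_H_def
    by (blast intro: tendsto_unique[OF trivial_limit_at_top_linorder])
qed

definition norming :: real where
  "norming = (\<Prod>j=1..q. Gamma (b j)) / (\<Prod>i=1..p. Gamma (a i))"

lemma norming_pos: "norming > 0"
  unfolding norming_def using a b by (intro divide_pos_pos prod_pos) (auto intro: Gamma_real_pos)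

lemma F_0: "F 0 = of_real (1 / norming)"
  by (simp add: F_def norming_def Gamma_complex_of_real rGamma_inverse_Gamma prod_inversef[symmetric] divide_inverse)

lemma fox_density_eq: "t \<noteq> T \<Longrightarrow> fox_density p q A a B b t = norming * Re (inverse_transform t)"
  by (simp add: fox_density_def fox_H_eq norming_def)

text \<open>
  The characteristic function of the law is \<open>F\<close> on the imaginary axis, traversed in the opposite direction
  and divided by \<open>F 0\<close>; hence its inversion integrals are the truncated integrals above.
\<close>

lemma inverse_transform_density:
  assumes nn: "\<And>u. u > 0 \<Longrightarrow> P u \<ge> 0" and T: "T \<ge> 0"
  shows "\<And>t. t \<noteq> T \<Longrightarrow> inverse_transform t \<in> \<real> \<and> 0 \<le> Re (inverse_transform t)"
    and "\<exists>M. infinitely_divisible M \<and>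
            distributed M lborel (\<lambda>x. x)
              (\<lambda>t. ennreal (fox_density p q A a B b t * indicator {0<..} t))"
proof -
  obtain M where M: "infinitely_divisible M" "\<And>t. F (- (\<i> * of_real t)) = F 0 * char M t"
    using exists_distribution_of_gamma_ratio[OF nn T] by blast
  have nonneg: "nonneg_distribution M" using M(1) by (simp add: infinitely_divisible_def)
  then have rd: "real_distribution M" by (simp add: nonneg_distribution_def)
  interpret M: real_distribution M by fact
  have char_eq: "char M t = of_real norming * F_axis (- t)" for t
    using M(2)[of t] norming_pos by (simp add: F_axis_def F_0)
  have atoms: "measure M {x} = 0" for x
  proof -
    obtain C Y where CY: "C \<ge> 0" "Y > 0" "\<And>y. \<bar>y\<bar> \<ge> Y \<Longrightarrow> norm (F_axis y) \<le> C * \<bar>y\<bar> powr (- \<mu>)"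
      by (rule F_axis_decay) blast
    have "norm (char M y) \<le> (norming * C) * \<bar>y\<bar> powr (- \<mu>)" if "\<bar>y\<bar> \<ge> Y" for y
      using CY(3)[of "- y"] that norming_pos by (simp add: char_eq norm_mult)
    from M.no_atoms_of_char_decay[OF mu CY(2) this] show ?thesis .
  qed
  define l where "l t = of_real norming * inverse_transform t" for t
  have J: "char_inversion M n x = of_real norming * truncated_fourier F_axis (real n) x" for n x
  proof -
    have "char_inversion M n x =
       (CLINT y|lborel. of_real norming * (indicator {- real n<..<real n} (- y) *\<^sub>R (F_axis (- y) * iexp (x * - y))))"
      unfolding char_inversion_def set_lebesgue_integral_def by (intro Bochner_Integration.integral_cong) (auto simp: char_eq indicator_def mult_ac)
    also have "\<dots> = of_real norming * (CLINT y|lborel. indicator {- real n<..<real n} (- y) *\<^sub>R (F_axis (- y) * iexp (x * - y)))"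
      by (rule integral_mult_right_zero)
    also have "(CLINT y|lborel. indicator {- real n<..<real n} (- y) *\<^sub>R (F_axis (- y) * iexp (x * - y))) = truncated_fourier F_axis (real n) x"
      using lborel_integral_real_affine[of "- 1" "\<lambda>y. indicator {- real n<..<real n} y *\<^sub>R (F_axis y * iexp (x * y))" 0]
      by (simp add: truncated_fourier_def set_lebesgue_integral_def)
    finally show ?thesis .
  qed
  have l_cont: "continuous_on (- {T}) l" unfolding l_def by (intro continuous_intros inverse_transform_continuous)
  have l_lim: "(\<lambda>n. 1 / (2 * pi) * char_inversion M n x) \<longlonglongrightarrow> l x" if "x \<noteq> T" for x
  proof -
    have "(\<lambda>n. of_real norming * (truncated_fourier F_axis (real n) x / of_real (2 * pi))) \<longlonglongrightarrow> l x"
      unfolding l_def by (intro tendsto_mult tendsto_const filterlim_compose[OF truncated_fourier_tendsto[OF that] filterlim_real_sequentially])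
    then show ?thesis unfolding J by (simp add: mult_ac)
  qed
  obtain K where K: "\<And>R t. R \<ge> 0 \<Longrightarrow> t \<noteq> T \<Longrightarrow> norm (truncated_fourier F_axis R t) \<le> K / \<bar>t - T\<bar>" by (rule truncated_fourier_bounded) blast
  have l_bd: "norm (char_inversion M n x) \<le> (norming * K) / \<bar>x - T\<bar>" if "x \<noteq> T" for x n
    unfolding J norm_mult using mult_left_mono[OF K[of "real n" x], of norming] that norming_pos by simp
  have D1: "Im (l t) = 0 \<and> 0 \<le> Re (l t)" if "t \<noteq> T" for t
    by (rule M.density_of_inversion(1)[where K = "norming * K"]) (rule atoms l_cont l_lim l_bd that | assumption)+
  have D2: "(\<lambda>t. if t = T then 0 else Re (l t)) \<in> borel_measurable borel"
    by (rule M.density_of_inversion(2)[where K = "norming * K"]) (rule atoms l_cont l_lim l_bd | assumption)+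
  have D3: "M = density lborel (\<lambda>t. ennreal (if t = T then 0 else Re (l t)))"
    by (rule M.density_of_inversion(3)[where K = "norming * K"]) (rule atoms l_cont l_lim l_bd | assumption)+
  have real: "inverse_transform t \<in> \<real> \<and> 0 \<le> Re (inverse_transform t)" if "t \<noteq> T" for t
    using D1[OF that] norming_pos by (simp add: l_def complex_is_Real_iff zero_le_mult_iff)
  then show "\<And>t. t \<noteq> T \<Longrightarrow> inverse_transform t \<in> \<real> \<and> 0 \<le> Re (inverse_transform t)" by blast
  define f where "f t = (if t = T then 0 else Re (l t))" for t
  have f_meas [measurable]: "f \<in> borel_measurable borel" using D2 by (simp add: f_def[abs_def])
  have Mf: "M = density lborel (\<lambda>t. ennreal (f t))" using D3 by (simp add: f_def)
  have f_eq: "fox_density p q A a B b t = f t" if "t \<noteq> T" for t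
    using that by (simp add: f_def l_def fox_density_eq)
  define g where "g t = ennreal (fox_density p q A a B b t * indicator {0<..} t)" for t
  have g_meas: "g \<in> borel_measurable borel"
  proof -
    have "g = (\<lambda>t. if t = T then g T else ennreal (f t * indicator {0<..} t))"
      by (auto simp: fun_eq_iff g_def f_eq)
    moreover have "(\<lambda>t. if t = T then g T else ennreal (f t * indicator {0<..} t)) \<in> borel_measurable borel" by measurable
    ultimately show ?thesis by simp
  qed
  have "M = density lborel g"
  proof (subst Mf, rule density_cong)
    \<comment> \<open>On the negative half-line the density vanishes almost everywhere, because the law is concentrated
      on \<open>[0,\<infinity>)\<close>; the points 0 and \<open>T\<close> form a null set.\<close>
    have "emeasure M {..<0} = 0" using nonneg by (simp add: nonneg_distribution_def)
    then have "(\<integral>\<^sup>+ t. ennreal (f t) * indicator {..<0} t \<partial>lborel) = 0"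
      by (subst (asm) Mf) (simp add: emeasure_density)
    then have "AE t in lborel. ennreal (f t) * indicator {..<0} t = 0"
      by (subst (asm) nn_integral_0_iff_AE) auto
    moreover have "AE t in lborel. t \<noteq> T" "AE t in lborel. t \<noteq> (0::real)" by (rule AE_lborel_singleton)+
    ultimately show "AE t in lborel. ennreal (f t) = g t"
    proof eventually_elim
      case (elim t)
      then show ?case by (cases "t > 0") (auto simp: g_def f_eq indicator_def not_less)
    qed
  qed (use g_meas in auto)
  then have "distributed M lborel (\<lambda>x. x) g"
    unfolding distributed_def using g_meas by (simp add: distr_id2 measurable_def)
  then show "\<exists>M. infinitely_divisible M \<and>
            distributed M lborel (\<lambda>x. x)
              (\<lambda>t. ennreal (fox_density p q A a B b t * indicator {0<..} t))"
    using M(1) by (auto simp: g_def[abs_def])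
qed

end

section \<open>Infinite divisibility of the density built from the H-function\<close>

theorem corollary2:
  fixes p q :: nat and A a B b :: "nat \<Rightarrow> real"
  assumes "p \<ge> 1" and "q \<ge> 1"
    and "\<And>i. i \<in> {1..p} \<Longrightarrow> A i > 0" and "\<And>j. j \<in> {1..q} \<Longrightarrow> B j > 0"
    and "\<And>i. i \<in> {1..p} \<Longrightarrow> a i > 0" and "\<And>j. j \<in> {1..q} \<Longrightarrow> b j > 0"
    and "fox_mu p q a b > 0"
    and "(\<Sum>j=1..q. B j) = (\<Sum>i=1..p. A i)"
    and "fox_rho p q A B \<le> 1"
    and "(\<forall>u>0. fox_P p q A a B b u \<ge> 0) \<or>
         cond_a p q A a B b \<or> cond_b p q A a B b \<or> cond_c p q A a B b"
  shows "(\<forall>t>0. t \<noteq> ln (1 / fox_rho p q A B) \<longrightarrow>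
            (\<exists>L. has_fox_H p q A a B b (exp (- t)) L) \<and>
            fox_H p q A a B b (exp (- t)) \<in> \<real> \<and>
            fox_density p q A a B b t \<ge> 0) \<and>
         (\<exists>M. infinitely_divisible M \<and>
            distributed M lborel (\<lambda>x. x)
              (\<lambda>t. ennreal (fox_density p q A a B b t * indicator {0<..} t)))"
proof -
  interpret fox_parameters p q A a B b using assms by unfold_locales auto
  have nn: "fox_P p q A a B b u \<ge> 0" if "u > 0" for u
    using assms(10)
  proof (elim disjE)
    assume "cond_a p q A a B b"
    from cond_a_imp_fox_P_nonneg[OF _ _ sum_eq this that] show ?thesis using A B by blast
  next
    assume "cond_b p q A a B b"
    from cond_b_imp_fox_P_nonneg[OF p _ _ sum_eq this that] show ?thesis using A B by blast
  next
    assume "cond_c p q A a B b"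
    from cond_c_imp_fox_P_nonneg[OF _ _ this that] show ?thesis using A B by blast
  qed (use that in blast)
  have T: "T \<ge> 0" using assms(9) rho_pos by (simp add: T_def)
  have T': "ln (1 / fox_rho p q A B) = T" using rho_pos by (simp add: T_def ln_div)
  note density = inverse_transform_density[OF nn T]
  show ?thesis unfolding T'
    using density has_fox_H_inverse_transform norming_pos by (auto simp: fox_H_eq fox_density_eq)
qed

end
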